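(* Let $\mu_X\preceq_c\mu_Y\preceq_c\mu_Z$ be probability measures on compact subsets $X,Y,Z\subset\mathbb{R}$, and assume: (A1) $X=[\underline{x},\overline{x}]$ and $\mu_X$ is absolutely continuous with respect to Lebesgue measure. (A2) $\mu_Y=\sum_{i=0}^2a_i\delta_{y_i}$ is supported on the three points $y_0,y_1,y_2$. (A3) $Z=Z_-\cup Z_+$ is the union of two intervals $Z_-=[\underline{z_-},\overline{z_-}]$ and $Z_+=[\underline{z_+},\overline{z_+}]$ with $\overline{z_-}<y_0<y_1<y_2<\underline{z_+}$, and $\mu_Z$ is non-atomic. (A4) The cost function takes the form $c(x,y,z)=f(x,y)z^2$, where $f$ is a differentiable function (on $X\times[y_0,y_2]$) with $\partial_xf<0$ and $\partial_yf<0$. Then the solution to the three-period martingale optimal transport problem $$\inf_{\pi\in\Pi_M(\mu_X,\mu_Y,\mu_Z)}\int c(x,y,z)\,d\pi$$ is unique.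
   Context: Convex order: $\mu\preceq_c\nu$ means $\int\varphi\,d\mu\le\int\varphi\,d\nu$ for all convex $\varphi:\mathbb{R}\to\mathbb{R}$. $\Pi_M(\mu_X,\mu_Y,\mu_Z)$ is the set of probability measures $\pi$ on $X\times Y\times Z$ with marginals $\mu_X,\mu_Y,\mu_Z$ such that under $\pi$ the conditional mean of $y$ given $x$ is $x$, and the conditional mean of $z$ given $(x,y)$ is $y$, $\pi$-a.s. *)

theory Defs
  imports "HOL-Probability.Probability"
begin

text \<open>A probability measure on a subset \<open>S\<close> of the line is represented as a Borel probability
  measure on all of \<open>\<real>\<close> for which almost every point lies in \<open>S\<close>.\<close>

definition prob_measure_on :: "real set \<Rightarrow> real measure \<Rightarrow> bool" where
  "prob_measure_on S \<mu> \<longleftrightarrow> prob_space \<mu> \<and> sets \<mu> = sets borel \<and> (AE x in \<mu>. x \<in> S)"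

text \<open>Meant for compactly supported measures, for which every convex (hence continuous) function
  on the line is integrable, so that the Bochner integrals below are the actual ones.\<close>

definition convex_order :: "real measure \<Rightarrow> real measure \<Rightarrow> bool" (infix \<open>\<preceq>\<^sub>c\<close> 50) where
  "\<mu> \<preceq>\<^sub>c \<nu> \<longleftrightarrow>
     (\<forall>\<phi> :: real \<Rightarrow> real. convex_on UNIV \<phi> \<longrightarrow> (\<integral>x. \<phi> x \<partial>\<mu>) \<le> (\<integral>x. \<phi> x \<partial>\<nu>))"

definition nonatomic :: "real measure \<Rightarrow> bool" where
  "nonatomic \<mu> \<longleftrightarrow> (\<forall>z. measure \<mu> {z} = 0)"

text \<open>The triple \<open>(x, y, z)\<close> is the nested pair \<open>(x, (y, z))\<close>. Conditioning on \<open>x\<close>, respectively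
  \<open>(x, y)\<close>, is conditioning on the sigma-algebra generated by that coordinate map. If the
  marginals live on \<open>X\<close>, \<open>Y\<close> and \<open>Z\<close>, then \<open>\<pi>\<close> automatically lives on \<open>X \<times> Y \<times> Z\<close>.\<close>

definition martingale_plans ::
  "real measure \<Rightarrow> real measure \<Rightarrow> real measure \<Rightarrow> (real \<times> real \<times> real) measure set" where
  "martingale_plans \<mu>X \<mu>Y \<mu>Z = {\<pi>.
     prob_space \<pi> \<and> sets \<pi> = sets borel \<and>
     distr \<pi> borel (\<lambda>(x, y, z). x) = \<mu>X \<and>
     distr \<pi> borel (\<lambda>(x, y, z). y) = \<mu>Y \<and>
     distr \<pi> borel (\<lambda>(x, y, z). z) = \<mu>Z \<and>
     (AE (x, y, z) in \<pi>.
        real_cond_exp \<pi> (vimage_algebra (space \<pi>) (\<lambda>(x, y, z). x) borel)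
          (\<lambda>(x, y, z). y) (x, y, z) = x) \<and>
     (AE (x, y, z) in \<pi>.
        real_cond_exp \<pi> (vimage_algebra (space \<pi>) (\<lambda>(x, y, z). (x, y)) borel)
          (\<lambda>(x, y, z). z) (x, y, z) = y)}"

text \<open>The cost \<open>c\<close> is only meaningful on a set \<open>D\<close> on which the plans are concentrated. Integrating
  over \<open>D\<close> discards its values elsewhere; those are arbitrary, possibly not measurable, and a
  Bochner integral over the whole space would then silently be \<open>0\<close>.\<close>

definition transport_cost ::
  "(real \<times> real \<times> real) set \<Rightarrow> (real \<Rightarrow> real \<Rightarrow> real \<Rightarrow> real) \<Rightarrow>
   (real \<times> real \<times> real) measure \<Rightarrow> real" where
  "transport_cost D c \<pi> = (LINT (x, y, z):D|\<pi>. c x y z)"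

definition mot_solution ::
  "(real \<times> real \<times> real) set \<Rightarrow> (real \<Rightarrow> real \<Rightarrow> real \<Rightarrow> real) \<Rightarrow>
   real measure \<Rightarrow> real measure \<Rightarrow> real measure \<Rightarrow> (real \<times> real \<times> real) measure \<Rightarrow> bool" where
  "mot_solution D c \<mu>X \<mu>Y \<mu>Z \<pi> \<longleftrightarrow>
     \<pi> \<in> martingale_plans \<mu>X \<mu>Y \<mu>Z \<and>
     (\<forall>\<pi>' \<in> martingale_plans \<mu>X \<mu>Y \<mu>Z. transport_cost D c \<pi> \<le> transport_cost D c \<pi>')"

end

theory Submission
  imports Defs
begin

text \<open>
  Layer-cake integration over the values of \<open>f\<close> reduces the cost of a plan \<open>\<pi>\<close> to its level costs
  \<open>C g = \<integral> 1{f(x,y) > g} z\<^sup>2 d\<pi>\<close>. The law of \<open>z\<close> on \<open>{f(x,y) > g}\<close> is a part of \<open>\<mu>Z\<close> whose mass \<open>M g\<close>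
  and first moment \<open>m g\<close> depend only on the coupling of \<open>x\<close> and \<open>y\<close>; among all such parts, the restriction
  of \<open>\<mu>Z\<close> to an interval \<open>(l g, u g)\<close> around the gap of \<open>Z\<close> is the unique one of least second moment
  (compare with the quadratic \<open>(z - l g) (z - u g)\<close>). The intervals are nested in \<open>g\<close>, so they are realised
  simultaneously, by the plan that sends \<open>(x, y)\<close> to the end points of the interval of level \<open>f(x,y)\<close>.
  The same quadratics bound \<open>C g\<close> from below by functions that are affine in \<open>(M g, m g)\<close>; with Helly's theorem
  for the couplings of \<open>x\<close> and \<open>y\<close>, this gives a minimizer.

  If two plans are optimal, comparing both with the nested plan over the average of their couplings shows that
  they use the same intervals and have the same functions \<open>M\<close> and \<open>m\<close>. The difference of the
  distribution functions of their couplings on the three lines \<open>y = y i\<close> is therefore a multiple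
  \<open>q(x)\<close> of a fixed vector for which \<open>q\<close> takes the same value at points \<open>x0 > x1\<close> with
  \<open>f(x0, y 0) = f(x1, y 1)\<close>; moving to the left, \<open>q\<close> vanishes. Hence the couplings agree, and the martingale condition
  fixes the weights of the two end points.
\<close>


section \<open>Measures and integrals\<close>

text \<open>An arbitrary plan is known only through its marginals and its two martingale conditions,
  so the argument runs through quantities that are linear in the law of (x, y). On a superlevel set
  of \<open>F\<close> the martingale condition replaces z by y, and the comparison quadratic then
  bounds the second moment of z below by the mass and the first moment of y alone. A limit is
  therefore taken only for couplings, never for plans in three variables. Each assumption has its
  place. As \<open>\<mu>X\<close> has no atoms and \<open>F\<close> decreases strictly in x, the law
  of \<open>F\<close> has no atoms under any coupling: the countably many jumps of the interval ends
  are not seen, and superlevel sets meet the lines in initial segments. The gap of Z around the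
  \<open>y i\<close> guarantees intervals of prescribed mass and mean, keeps their lengths away from
  zero and makes the two weights well defined. Three support points leave one free function after
  mass and mean are fixed, and the decrease in y orders the cuts of two neighbouring lines.\<close>

definition sum_measure :: "'i set \<Rightarrow> ('i \<Rightarrow> 'a measure) \<Rightarrow> 'a measure \<Rightarrow> 'a measure" where
  "sum_measure I N K = measure_of (space K) (sets K) (\<lambda>A. \<Sum>i\<in>I. emeasure (N i) A)"

lemma sets_sum_measure [simp, measurable_cong]: "sets (sum_measure I N K) = sets K"
  by (simp add: sum_measure_def)

lemma space_sum_measure [simp]: "space (sum_measure I N K) = space K"
  by (simp add: sum_measure_def)

text \<open>The reference \<open>K\<close> supplies only the sigma-algebra. Additivity holds because
  a series of nonnegative terms commutes with the sum over \<open>I\<close>.\<close>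

lemma emeasure_sum_measure:
  assumes "\<And>i. i \<in> I \<Longrightarrow> sets (N i) = sets K" and "A \<in> sets K"
  shows "emeasure (sum_measure I N K) A = (\<Sum>i\<in>I. emeasure (N i) A)"
proof (rule emeasure_measure_of[OF sum_measure_def])
  show "sets K \<subseteq> Pow (space K)"
    by (rule sets.space_closed)
  show "A \<in> sets (sum_measure I N K)"
    using assms(2) by simp
  show "positive (sets (sum_measure I N K)) (\<lambda>A. \<Sum>i\<in>I. emeasure (N i) A)"
    by (simp add: positive_def)
  show "countably_additive (sets (sum_measure I N K)) (\<lambda>A. \<Sum>i\<in>I. emeasure (N i) A)"
  proof (rule countably_additiveI)
    fix B :: "nat \<Rightarrow> 'b set"
    assume B: "range B \<subseteq> sets (sum_measure I N K)" "disjoint_family B"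
    have "(\<Sum>n. \<Sum>i\<in>I. emeasure (N i) (B n)) = (\<Sum>i\<in>I. \<Sum>n. emeasure (N i) (B n))"
      by (rule suminf_sum) auto
    also have "\<dots> = (\<Sum>i\<in>I. emeasure (N i) (\<Union>n. B n))"
      using B assms(1) by (intro sum.cong refl suminf_emeasure) auto
    finally show "(\<Sum>n. \<Sum>i\<in>I. emeasure (N i) (B n)) = (\<Sum>i\<in>I. emeasure (N i) (\<Union>n. B n))" .
  qed
qed

lemma nn_integral_sum_measure:
  assumes N: "\<And>i. i \<in> I \<Longrightarrow> sets (N i) = sets K" and f: "f \<in> borel_measurable K"
  shows "(\<integral>\<^sup>+x. f x \<partial>sum_measure I N K) = (\<Sum>i\<in>I. \<integral>\<^sup>+x. f x \<partial>N i)"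
proof -
  have m: "u \<in> borel_measurable (N i)" if "u \<in> borel_measurable K" "i \<in> I" for u :: "'b \<Rightarrow> ennreal" and i
    using that(1) by (simp add: measurable_cong_sets[OF N[OF that(2)] refl])
  from f show ?thesis
  proof (induction rule: borel_measurable_induct)
    case (cong f g)
    have "(\<integral>\<^sup>+x. f x \<partial>N i) = (\<integral>\<^sup>+x. g x \<partial>N i)" if "i \<in> I" for i
      using cong(3) sets_eq_imp_space_eq[OF N[OF that]] by (intro nn_integral_cong) simp
    moreover have "integral\<^sup>N (sum_measure I N K) f = integral\<^sup>N (sum_measure I N K) g"
      using cong(3) by (intro nn_integral_cong) simp
    ultimately show ?case
      using cong(4) by simp
  next
    case (set A)
    then show ?case
      using N by (simp add: emeasure_sum_measure)
  next
    case (mult u c)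
    then show ?case
      using m[OF mult(2)] by (simp add: nn_integral_cmult sum_distrib_left)
  next
    case (add u v)
    have "(\<integral>\<^sup>+x. u x + v x \<partial>N i) = (\<integral>\<^sup>+x. u x \<partial>N i) + (\<integral>\<^sup>+x. v x \<partial>N i)" if "i \<in> I" for i
      using m[OF add.hyps(1) that] m[OF add.hyps(3) that] by (rule nn_integral_add)
    then show ?case
      using add.hyps(1,3) add.IH by (simp add: nn_integral_add sum.distrib add.commute[of "v _"]
          add.commute[of "\<Sum>i\<in>I. integral\<^sup>N (N i) v"])
  next
    case (seq U)
    have "(\<integral>\<^sup>+x. Sup (range U) x \<partial>sum_measure I N K) = (SUP j. \<integral>\<^sup>+x. U j x \<partial>sum_measure I N K)"
      using nn_integral_monotone_convergence_SUP[OF seq.hyps(3), of "sum_measure I N K"] seq.hyps(1)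
      by (simp add: image_comp)
    also have "\<dots> = (SUP j. \<Sum>i\<in>I. \<integral>\<^sup>+x. U j x \<partial>N i)"
      using seq.IH by simp
    also have "\<dots> = (\<Sum>i\<in>I. SUP j. \<integral>\<^sup>+x. U j x \<partial>N i)"
      using seq.hyps(3) by (intro ennreal_SUP_sum)
         (auto simp: incseq_def le_fun_def intro!: nn_integral_mono)
    also have "\<dots> = (\<Sum>i\<in>I. \<integral>\<^sup>+x. Sup (range U) x \<partial>N i)"
      using nn_integral_monotone_convergence_SUP[OF seq.hyps(3)] m[OF seq.hyps(1)]
      by (intro sum.cong refl) (simp add: image_comp)
    finally show ?case .
  qed
qed

lemma (in finite_measure) integrable_bounded:
  fixes f :: "'a \<Rightarrow> real"
  assumes "f \<in> borel_measurable M" and "\<And>x. x \<in> space M \<Longrightarrow> \<bar>f x\<bar> \<le> B"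
  shows "integrable M f"
  using assms by (intro integrable_const_bound[where B=B]) auto

lemma finite_measure_sum_measure:
  assumes "finite I" "\<And>i. i \<in> I \<Longrightarrow> sets (N i) = sets K" "\<And>i. i \<in> I \<Longrightarrow> finite_measure (N i)"
  shows "finite_measure (sum_measure I N K)"
proof
  have "emeasure (sum_measure I N K) (space K) = (\<Sum>i\<in>I. emeasure (N i) (space K))"
    using assms by (intro emeasure_sum_measure) auto
  also have "\<dots> < \<infinity>"
    using assms(1,3) by (auto simp: finite_measure.emeasure_finite top.not_eq_extremum[symmetric])
  finally show "emeasure (sum_measure I N K) (space (sum_measure I N K)) \<noteq> \<infinity>"
    by simp
qed

text \<open>Boundedness and finiteness make the integrals of the positive and the negative part
  finite, so the identity for nonnegative functions applies to each and the results can be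
  subtracted.\<close>

lemma integral_sum_measure:
  fixes f :: "'a \<Rightarrow> real"
  assumes I: "finite I" and N: "\<And>i. i \<in> I \<Longrightarrow> sets (N i) = sets K" "\<And>i. i \<in> I \<Longrightarrow> finite_measure (N i)"
    and f: "f \<in> borel_measurable K" "\<And>x. x \<in> space K \<Longrightarrow> \<bar>f x\<bar> \<le> B"
  shows "(\<integral>x. f x \<partial>sum_measure I N K) = (\<Sum>i\<in>I. \<integral>x. f x \<partial>N i)"
proof -
  interpret S: finite_measure "sum_measure I N K"
    by (rule finite_measure_sum_measure[OF I N])
  have fS: "integrable (sum_measure I N K) f"
    using f by (intro S.integrable_bounded[where B=B]) auto
  have fN: "integrable (N i) f" if "i \<in> I" for i
    using f measurable_cong_sets[OF N(1)[OF that] refl] sets_eq_imp_space_eq[OF N(1)[OF that]]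
    by (intro finite_measure.integrable_bounded[OF N(2)[OF that], where B=B]) auto
  have sum: "enn2real (\<integral>\<^sup>+x. ennreal (g x) \<partial>sum_measure I N K) = (\<Sum>i\<in>I. enn2real (\<integral>\<^sup>+x. ennreal (g x) \<partial>N i))"
    if g: "g \<in> borel_measurable K" and fin: "\<And>i. i \<in> I \<Longrightarrow> (\<integral>\<^sup>+x. ennreal (g x) \<partial>N i) \<noteq> \<infinity>" for g :: "'a \<Rightarrow> real"
  proof -
    have "(\<integral>\<^sup>+x. ennreal (g x) \<partial>sum_measure I N K) = (\<Sum>i\<in>I. ennreal (enn2real (\<integral>\<^sup>+x. ennreal (g x) \<partial>N i)))"
      using g fin by (subst nn_integral_sum_measure[OF N(1)]) (auto simp: less_top intro!: sum.cong)
    also have "\<dots> = ennreal (\<Sum>i\<in>I. enn2real (\<integral>\<^sup>+x. ennreal (g x) \<partial>N i))"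
      by (intro sum_ennreal) simp
    finally show ?thesis
      by (simp add: sum_nonneg)
  qed
  have fin: "(\<integral>\<^sup>+x. ennreal (f x) \<partial>N i) \<noteq> \<infinity>" "(\<integral>\<^sup>+x. ennreal (- f x) \<partial>N i) \<noteq> \<infinity>" if "i \<in> I" for i
    using fN[OF that] by (auto simp: real_integrable_def)
  show ?thesis
    using sum[of f] sum[of "\<lambda>x. - f x"] f(1) fin fN
    by (simp add: real_lebesgue_integral_def[OF fS] real_lebesgue_integral_def sum_subtractf)
qed

section \<open>Integrals determined by half-lines, and conditional means\<close>

lemma emeasure_distr_density_halfline:
  fixes h \<phi> :: "'a \<Rightarrow> real"
  assumes "finite_measure M" and [measurable]: "h \<in> borel_measurable M" "\<phi> \<in> borel_measurable M"
    and h: "AE x in M. 0 \<le> h x \<and> h x \<le> B"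
  shows "emeasure (distr (density M h) borel \<phi>) {g<..} = ennreal (\<integral>x. indicator {g<..} (\<phi> x) * h x \<partial>M)"
proof -
  interpret finite_measure M by fact
  have "emeasure (distr (density M h) borel \<phi>) {g<..} = (\<integral>\<^sup>+x. ennreal (h x) * indicator (\<phi> -` {g<..} \<inter> space M) x \<partial>M)"
    by (simp add: emeasure_distr emeasure_density)
  also have "\<dots> = (\<integral>\<^sup>+x. ennreal (indicator {g<..} (\<phi> x) * h x) \<partial>M)"
    by (intro nn_integral_cong) (auto simp: indicator_def)
  also have "\<dots> = ennreal (\<integral>x. indicator {g<..} (\<phi> x) * h x \<partial>M)"
  proof (rule nn_integral_eq_integral)
    show "integrable M (\<lambda>x. indicator {g<..} (\<phi> x) * h x)"
      by (intro integrable_const_bound[where B="\<bar>B\<bar>"] eventually_mono[OF h]) (auto simp: indicator_def)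
  qed (use h in \<open>auto simp: indicator_def\<close>)
  finally show ?thesis .
qed

text \<open>The shift by the bound \<open>B\<close> turns the signed measures \<open>h M\<close> and \<open>k N\<close> into positive ones, whose
  images are determined by their values on half-lines.\<close>

lemma integral_eq_of_halflines:
  fixes h :: "'a \<Rightarrow> real" and k :: "'b \<Rightarrow> real" and \<psi> :: "real \<Rightarrow> real"
  assumes "finite_measure M" "finite_measure N"
    and [measurable]: "h \<in> borel_measurable M" "k \<in> borel_measurable N"
      "\<phi> \<in> borel_measurable M" "\<theta> \<in> borel_measurable N" "\<psi> \<in> borel_measurable borel"
    and B: "AE x in M. \<bar>h x\<bar> \<le> B" "AE x in N. \<bar>k x\<bar> \<le> B" and C: "\<And>t. \<bar>\<psi> t\<bar> \<le> C"
    and mass: "\<And>g. ((\<integral>x. indicator {g<..} (\<phi> x) \<partial>M) :: real) = (\<integral>x. indicator {g<..} (\<theta> x) \<partial>N)"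
    and eq: "\<And>g. (\<integral>x. indicator {g<..} (\<phi> x) * h x \<partial>M) = (\<integral>x. indicator {g<..} (\<theta> x) * k x \<partial>N)"
  shows "(\<integral>x. \<psi> (\<phi> x) * h x \<partial>M) = (\<integral>x. \<psi> (\<theta> x) * k x \<partial>N)"
    and "(\<integral>x. \<psi> (\<phi> x) \<partial>M) = (\<integral>x. \<psi> (\<theta> x) \<partial>N)"
proof -
  interpret M: finite_measure M by fact
  interpret N: finite_measure N by fact
  have pos: "(\<integral>x. \<psi> (\<phi> x) * h' x \<partial>M) = (\<integral>x. \<psi> (\<theta> x) * k' x \<partial>N)"
    if [measurable]: "h' \<in> borel_measurable M" "k' \<in> borel_measurable N"
      and B': "AE x in M. 0 \<le> h' x \<and> h' x \<le> B'" "AE x in N. 0 \<le> k' x \<and> k' x \<le> B'"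
      and eq': "\<And>g. (\<integral>x. indicator {g<..} (\<phi> x) * h' x \<partial>M) = (\<integral>x. indicator {g<..} (\<theta> x) * k' x \<partial>N)"
    for h' k' B'
  proof -
    have D: "distr (density M h') borel \<phi> = distr (density N k') borel \<theta>"
      by (rule measure_eqI_lessThan) (simp_all add: eq'
        emeasure_distr_density_halfline[OF assms(1) _ _ B'(1)] emeasure_distr_density_halfline[OF assms(2) _ _ B'(2)])
    have "(\<integral>x. \<psi> (\<phi> x) * h' x \<partial>M) = (\<integral>t. \<psi> t \<partial>distr (density M h') borel \<phi>)"
      using B' by (subst integral_distr) (auto simp: integral_density mult.commute)
    also have "\<dots> = (\<integral>x. \<psi> (\<theta> x) * k' x \<partial>N)"
      unfolding D using B' by (subst integral_distr) (auto simp: integral_density mult.commute)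
    finally show ?thesis .
  qed
  \<comment> \<open>The constant weight 1 is an instance of the nonnegative case; it accounts for
    the contribution of the shift that is subtracted at the end.\<close>
  have one: "(\<integral>x. \<psi> (\<phi> x) * 1 \<partial>M) = (\<integral>x. \<psi> (\<theta> x) * 1 \<partial>N)"
    by (rule pos[where B'=1]) (simp_all add: mass)
  then show "(\<integral>x. \<psi> (\<phi> x) \<partial>M) = (\<integral>x. \<psi> (\<theta> x) \<partial>N)"
    by simp
  have C0: "0 \<le> C"
    using C[of 0] by linarith
  have ih: "integrable M (\<lambda>x. \<psi> (\<phi> x) * h x)"
    using B(1) C C0 by (intro M.integrable_const_bound[where B="C * B"])
      (auto elim!: eventually_mono simp: abs_mult intro!: mult_mono)
  have ik: "integrable N (\<lambda>x. \<psi> (\<theta> x) * k x)"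
    using B(2) C C0 by (intro N.integrable_const_bound[where B="C * B"])
      (auto elim!: eventually_mono simp: abs_mult intro!: mult_mono)
  have cM: "integrable M (\<lambda>x. \<psi> (\<phi> x) * c)" for c
    using C by (intro integrable_mult_left M.integrable_bounded[where B=C]) auto
  have cN: "integrable N (\<lambda>x. \<psi> (\<theta> x) * c)" for c
    using C by (intro integrable_mult_left N.integrable_bounded[where B=C]) auto
  have "(\<integral>x. \<psi> (\<phi> x) * (h x + B) \<partial>M) = (\<integral>x. \<psi> (\<theta> x) * (k x + B) \<partial>N)"
  proof (rule pos[where B'="2*B"])
    show "AE x in M. 0 \<le> h x + B \<and> h x + B \<le> 2 * B"
      using B(1) by eventually_elim auto
    show "AE x in N. 0 \<le> k x + B \<and> k x + B \<le> 2 * B"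
      using B(2) by eventually_elim auto
    fix g
    have 1: "integrable M (\<lambda>x. indicator {g<..} (\<phi> x) * h x)" "integrable M (\<lambda>x. indicator {g<..} (\<phi> x) * B)"
      using B(1) by (intro M.integrable_const_bound[where B="\<bar>B\<bar>"]; auto elim!: eventually_mono simp: indicator_def)+
    have 2: "integrable N (\<lambda>x. indicator {g<..} (\<theta> x) * k x)" "integrable N (\<lambda>x. indicator {g<..} (\<theta> x) * B)"
      using B(2) by (intro N.integrable_const_bound[where B="\<bar>B\<bar>"]; auto elim!: eventually_mono simp: indicator_def)+
    show "(\<integral>x. indicator {g<..} (\<phi> x) * (h x + B) \<partial>M) = (\<integral>x. indicator {g<..} (\<theta> x) * (k x + B) \<partial>N)"
      using mass[of g] eq[of g] 1 2 by (simp add: distrib_left)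
  qed auto
  then show "(\<integral>x. \<psi> (\<phi> x) * h x \<partial>M) = (\<integral>x. \<psi> (\<theta> x) * k x \<partial>N)"
    using ih ik cM[of B] cN[of B] one by (simp add: distrib_left)
qed

text \<open>The sets of the sigma-algebra generated by \<open>h\<close> are exactly the preimages of
  Borel sets, so the defining property of the conditional expectation becomes a family of integral
  identities.\<close>

lemma real_cond_exp_eq_iff:
  fixes U :: "'a \<Rightarrow> real" and v :: "'b::topological_space \<Rightarrow> real"
  assumes "prob_space M" and [measurable]: "h \<in> borel_measurable M" "v \<in> borel_measurable borel"
    and U: "integrable M U" "integrable M (\<lambda>\<omega>. v (h \<omega>))"
  shows "(AE \<omega> in M. real_cond_exp M (vimage_algebra (space M) h borel) U \<omega> = v (h \<omega>)) \<longleftrightarrow>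
    (\<forall>A\<in>sets borel. (\<integral>\<omega>. indicator A (h \<omega>) * U \<omega> \<partial>M) = (\<integral>\<omega>. indicator A (h \<omega>) * v (h \<omega>) \<partial>M))"
    (is "?L \<longleftrightarrow> ?R")
proof -
  let ?F = "vimage_algebra (space M) h borel"
  interpret prob_space M by fact
  have sub: "subalgebra M ?F"
    by (auto simp: subalgebra_def sets_vimage_algebra2 intro!: measurable_sets)
  interpret S: sigma_finite_subalgebra M ?F
    using sub by (intro finite_measure_subalgebra_is_sigma_finite) unfold_locales
  have hF: "h \<in> measurable ?F borel"
    by (intro measurable_vimage_algebra1) auto
  show ?thesis
  proof
    assume L: ?L
    show ?R
    proof
      fix A :: "'b set" assume A: "A \<in> sets borel"
      let ?A = "h -` A \<inter> space M"
      have "?A \<in> sets ?F"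
        using A by (rule in_vimage_algebra)
      then have A': "?A \<in> sets M"
        using sub by (auto simp: subalgebra_def)
      have "(\<integral>\<omega>. indicator A (h \<omega>) * U \<omega> \<partial>M) = (\<integral>\<omega>\<in>?A. U \<omega> \<partial>M)"
        by (auto simp: set_lebesgue_integral_def indicator_def intro!: Bochner_Integration.integral_cong)
      also have "\<dots> = (\<integral>\<omega>\<in>?A. real_cond_exp M ?F U \<omega> \<partial>M)"
        by (intro S.real_cond_exp_intA U) fact
      also have "\<dots> = (\<integral>\<omega>. indicator A (h \<omega>) * v (h \<omega>) \<partial>M)"
        unfolding set_lebesgue_integral_def using L A A'
        by (intro integral_cong_AE) (auto simp: indicator_def elim!: eventually_mono)
      finally show "(\<integral>\<omega>. indicator A (h \<omega>) * U \<omega> \<partial>M) = (\<integral>\<omega>. indicator A (h \<omega>) * v (h \<omega>) \<partial>M)" .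
    qed
  next
    assume R: ?R
    show ?L
    proof (rule S.real_cond_exp_charact[OF _ U])
      show "(\<lambda>\<omega>. v (h \<omega>)) \<in> borel_measurable ?F"
        using hF by measurable
      fix B assume "B \<in> sets ?F"
      then obtain A where A: "A \<in> sets borel" "B = h -` A \<inter> space M"
        by (auto simp: sets_vimage_algebra2)
      have "(\<integral>\<omega>\<in>B. w \<omega> \<partial>M) = (\<integral>\<omega>. indicator A (h \<omega>) * w \<omega> \<partial>M)" for w :: "'a \<Rightarrow> real"
        by (auto simp: A(2) set_lebesgue_integral_def indicator_def intro!: Bochner_Integration.integral_cong)
      then show "(\<integral>\<omega>\<in>B. U \<omega> \<partial>M) = (\<integral>\<omega>\<in>B. v (h \<omega>) \<partial>M)"
        using R A(1) by simp
    qed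
  qed
qed

lemma borel_measurable_fst [measurable]:
  "fst \<in> borel_measurable (borel :: ('a::topological_space \<times> 'b::topological_space) measure)"
  by (intro borel_measurable_continuous_onI continuous_intros)

lemma borel_measurable_snd [measurable]:
  "snd \<in> borel_measurable (borel :: ('a::topological_space \<times> 'b::topological_space) measure)"
  by (intro borel_measurable_continuous_onI continuous_intros)

text \<open>\<open>Q\<close> is the law of a point that moves from \<open>x\<close> to
  \<open>T0 x\<close> with probability \<open>w x\<close> and to \<open>T1 x\<close> otherwise. It
  serves to send (x, y) to the two ends of an interval.\<close>

lemma exists_two_point_mixture:
  fixes w :: "'a \<Rightarrow> real"
  assumes "prob_space P" and [measurable]: "w \<in> borel_measurable P" "T0 \<in> measurable P K" "T1 \<in> measurable P K"
    and w: "AE x in P. 0 \<le> w x \<and> w x \<le> 1"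
  obtains Q where "prob_space Q" "sets Q = sets K"
    "\<And>\<phi> :: 'b \<Rightarrow> real. \<And>B. \<phi> \<in> borel_measurable K \<Longrightarrow> (\<And>x. x \<in> space K \<Longrightarrow> \<bar>\<phi> x\<bar> \<le> B) \<Longrightarrow>
      (\<integral>x. \<phi> x \<partial>Q) = (\<integral>x. w x * \<phi> (T0 x) + (1 - w x) * \<phi> (T1 x) \<partial>P)"
proof -
  interpret P: prob_space P by fact
  define N where "N b = (if b then distr (density P w) K T0 else distr (density P (\<lambda>x. 1 - w x)) K T1)" for b
  define Q where "Q = sum_measure UNIV N K"
  have sN: "sets (N b) = sets K" for b
    by (simp add: N_def)
  have fin: "finite_measure (density P (\<lambda>x. ennreal (v x)))" if [measurable]: "v \<in> borel_measurable P"
    and v: "AE x in P. 0 \<le> v x \<and> v x \<le> 1" for v :: "'a \<Rightarrow> real"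
  proof
    have "emeasure (density P (\<lambda>x. ennreal (v x))) (space P) = (\<integral>\<^sup>+x. ennreal (v x) \<partial>P)"
      by (auto simp: emeasure_density intro!: nn_integral_cong)
    also have "\<dots> \<le> (\<integral>\<^sup>+x. 1 \<partial>P)"
      using v by (intro nn_integral_mono_AE) (auto elim!: eventually_mono simp: ennreal_le_1)
    also have "\<dots> < \<infinity>"
      by (simp add: P.emeasure_space_1)
    finally show "emeasure (density P (\<lambda>x. ennreal (v x))) (space (density P (\<lambda>x. ennreal (v x)))) \<noteq> \<infinity>"
      by simp
  qed
  have w': "AE x in P. 0 \<le> 1 - w x \<and> 1 - w x \<le> 1"
    using w by eventually_elim auto
  have fN: "finite_measure (N b)" for b
    using fin[OF _ w] fin[OF _ w'] by (auto simp: N_def intro!: finite_measure.finite_measure_distr)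
  have int: "(\<integral>x. \<phi> x \<partial>Q) = (\<integral>x. w x * \<phi> (T0 x) + (1 - w x) * \<phi> (T1 x) \<partial>P)"
    if [measurable]: "\<phi> \<in> borel_measurable K" and b: "\<And>x. x \<in> space K \<Longrightarrow> \<bar>\<phi> x\<bar> \<le> B" for \<phi> :: "'b \<Rightarrow> real" and B
  proof -
    have B: "AE x in P. \<bar>\<phi> (T0 x)\<bar> \<le> B \<and> \<bar>\<phi> (T1 x)\<bar> \<le> B"
      using b by (intro AE_I2) (auto dest: measurable_space[OF assms(3)] measurable_space[OF assms(4)])
    have le: "\<bar>v * t\<bar> \<le> B" if "0 \<le> v" "v \<le> 1" "\<bar>t\<bar> \<le> B" for v t :: real
      using mult_mono[of v 1 "\<bar>t\<bar>" B] that by (auto simp: abs_mult)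
    have "AE x in P. \<bar>w x * \<phi> (T0 x)\<bar> \<le> B \<and> \<bar>(1 - w x) * \<phi> (T1 x)\<bar> \<le> B"
      using w B by eventually_elim (intro conjI le; simp)
    then have i: "integrable P (\<lambda>x. w x * \<phi> (T0 x))" "integrable P (\<lambda>x. (1 - w x) * \<phi> (T1 x))"
      by (auto intro!: P.integrable_const_bound[where B=B])
    have "(\<integral>x. \<phi> x \<partial>Q) = (\<Sum>b\<in>UNIV. \<integral>x. \<phi> x \<partial>N b)"
      unfolding Q_def using b by (intro integral_sum_measure sN fN) auto
    also have "\<dots> = (\<integral>x. \<phi> x \<partial>N True) + (\<integral>x. \<phi> x \<partial>N False)"
      by (simp add: UNIV_bool)
    also have "(\<integral>x. \<phi> x \<partial>N True) = (\<integral>x. w x * \<phi> (T0 x) \<partial>P)"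
      using w by (simp add: N_def integral_distr integral_density)
    also have "(\<integral>x. \<phi> x \<partial>N False) = (\<integral>x. (1 - w x) * \<phi> (T1 x) \<partial>P)"
      using w' by (simp add: N_def integral_distr integral_density)
    finally show ?thesis
      using i by simp
  qed
  have sQ: "sets Q = sets K"
    by (simp add: Q_def)
  interpret Q: finite_measure Q
    unfolding Q_def by (intro finite_measure_sum_measure sN fN) auto
  have "(\<integral>x. 1 \<partial>Q) = (1::real)"
    by (subst int[of _ 1]) (auto simp: P.prob_space)
  then have "prob_space Q"
    by (intro prob_spaceI) (simp add: Q.emeasure_eq_measure)
  then show ?thesis
    using that sQ int by blast
qed

lemma sum_atMost_2: "(\<Sum>i\<le>2. f i) = f 0 + f 1 + f (2::nat)"
  by (simp add: numeral_2_eq_2)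

lemma continuous_on_fst_section:
  fixes F :: "real \<Rightarrow> real \<Rightarrow> real"
  assumes "continuous_on UNIV (\<lambda>(x, v). F x v)"
  shows "isCont (\<lambda>x. F x v) x"
proof -
  have "continuous_on UNIV (\<lambda>x. (\<lambda>(x, v). F x v) (x, v))"
    by (rule continuous_on_compose2[OF assms]) (auto intro: continuous_intros)
  then show ?thesis
    by (simp add: continuous_on_eq_continuous_at)
qed

lemma convex_on_max:
  fixes f g :: "'a::real_vector \<Rightarrow> real"
  assumes "convex_on S f" "convex_on S g"
  shows "convex_on S (\<lambda>x. max (f x) (g x))"
proof (rule convex_onI)
  show "convex S"
    using assms(1) by (rule convex_on_imp_convex)
  fix t :: real and x y assume t: "0 < t" "t < 1" and xy: "x \<in> S" "y \<in> S"
  have "f ((1 - t) *\<^sub>R x + t *\<^sub>R y) \<le> (1 - t) * f x + t * f y" "g ((1 - t) *\<^sub>R x + t *\<^sub>R y) \<le> (1 - t) * g x + t * g y"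
    using assms t xy by (auto intro: convex_onD)
  moreover have "(1 - t) * f x \<le> (1 - t) * max (f x) (g x)" "t * f y \<le> t * max (f y) (g y)"
    "(1 - t) * g x \<le> (1 - t) * max (f x) (g x)" "t * g y \<le> t * max (f y) (g y)"
    using t by (auto intro!: mult_left_mono)
  ultimately show "max (f ((1 - t) *\<^sub>R x + t *\<^sub>R y)) (g ((1 - t) *\<^sub>R x + t *\<^sub>R y)) \<le>
    (1 - t) * max (f x) (g x) + t * max (f y) (g y)"
    by linarith
qed

lemma convex_on_affine: "convex_on UNIV (\<lambda>t::real. a * t + b)"
  by (rule convex_onI) (auto simp: algebra_simps)

text \<open>At the ends of the interval only one-sided derivatives are available, so the sign of the
  derivative is used inside and continuity carries the conclusion to the ends.\<close>

lemma strict_decreasing_of_derivative: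
  fixes h h' :: "real \<Rightarrow> real"
  assumes "\<And>t. t \<in> {a..b} \<Longrightarrow> (h has_real_derivative h' t) (at t within {a..b}) \<and> h' t < 0"
    and st: "a \<le> s" "s < t" "t \<le> b"
  shows "h t < h s"
proof (rule DERIV_neg_imp_decreasing_open[OF st(2)])
  show "\<exists>d. DERIV h r :> d \<and> d < 0" if "s < r" "r < t" for r
    using assms(1)[of r] at_within_Icc_at[of a r b] that st by auto
  have "continuous_on {a..b} h"
    using assms(1) by (blast intro: DERIV_continuous_on)
  then show "continuous_on {s..t} h"
    by (rule continuous_on_subset) (use st in auto)
qed

section \<open>Nested intervals around the gap\<close>

text \<open>Strict superlevel sets are right-continuous in the level: as the level tends to
  \<open>g\<close> from above, the indicators converge at every point.\<close>

lemma tendsto_integral_superlevel: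
  fixes h :: "'a \<Rightarrow> real" and s :: "nat \<Rightarrow> real"
  assumes h: "integrable M h" and [measurable]: "\<phi> \<in> borel_measurable M"
    and s: "s \<longlonglongrightarrow> g" "\<And>n. g \<le> s n"
  shows "(\<lambda>n. \<integral>x. indicator {s n<..} (\<phi> x) * h x \<partial>M) \<longlonglongrightarrow> (\<integral>x. indicator {g<..} (\<phi> x) * h x \<partial>M)"
proof (rule integral_dominated_convergence[where w="\<lambda>x. \<bar>h x\<bar>"])
  have [measurable]: "h \<in> borel_measurable M"
    using h by auto
  show "(\<lambda>x. indicator {g<..} (\<phi> x) * h x) \<in> borel_measurable M"
    "(\<lambda>x. indicator {s n<..} (\<phi> x) * h x) \<in> borel_measurable M" for n
    by measurable
  show "AE x in M. (\<lambda>n. indicator {s n<..} (\<phi> x) * h x) \<longlonglongrightarrow> indicator {g<..} (\<phi> x) * h x"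
  proof (rule AE_I2)
    fix x
    have "(\<lambda>n. indicator {s n<..} (\<phi> x) :: real) \<longlonglongrightarrow> indicator {g<..} (\<phi> x)"
    proof (cases "g < \<phi> x")
      case True
      then have "eventually (\<lambda>n. s n < \<phi> x) sequentially"
        using s(1) by (rule order_tendstoD(2)[rotated])
      then show ?thesis
        using True by (intro tendsto_eventually) (auto elim!: eventually_mono simp: indicator_def)
    next
      case False
      then have "\<not> s n < \<phi> x" for n
        using s(2)[of n] by linarith
      then show ?thesis
        using False by (simp add: indicator_def)
    qed
    then show "(\<lambda>n. indicator {s n<..} (\<phi> x) * h x) \<longlonglongrightarrow> indicator {g<..} (\<phi> x) * h x"
      by (intro tendsto_intros)
  qed
  show "AE x in M. norm (indicator {s n<..} (\<phi> x) * h x) \<le> \<bar>h x\<bar>" for n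
    by (auto simp: indicator_def)
qed (use h in auto)

lemma countable_discont_mono_antimono:
  fixes l u :: "real \<Rightarrow> real"
  assumes "mono l" "antimono u"
  shows "countable ({g. \<not> isCont l g} \<union> {g. \<not> isCont u g})"
proof -
  have "countable {g. \<not> isCont (\<lambda>g. - u g) g}"
    using assms(2) by (intro mono_ctble_discont) (auto simp: mono_def antimono_def)
  moreover have "isCont (\<lambda>g. - u g) g \<longleftrightarrow> isCont u g" for g
    using continuous_minus[of "at g" u] continuous_minus[of "at g" "\<lambda>g. - u g"] by auto
  ultimately show ?thesis
    using mono_ctble_discont[OF assms(1)] by simp
qed

lemma borel_measurable_antimono:
  fixes u :: "real \<Rightarrow> real"
  assumes "antimono u"
  shows "u \<in> borel_measurable borel"
proof -
  have "(\<lambda>g. - u g) \<in> borel_measurable borel"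
    using assms by (intro borel_measurable_mono) (auto simp: mono_def antimono_def)
  then show ?thesis
    by (simp add: borel_measurable_uminus_eq)
qed

text \<open>The average over the two ends with mean \<open>z\<close> is affine in \<open>z\<close>.
  This is what allows z to be exchanged for its conditional mean y, in both directions.\<close>

lemma endpoint_average_affine:
  fixes l u z \<alpha> \<beta> :: real
  shows "(\<alpha> * (u - z) + \<beta> * (z - l)) / (u - l) = (\<alpha> * u - \<beta> * l) / (u - l) + (\<beta> - \<alpha>) / (u - l) * z"
  by (simp add: add_divide_distrib[symmetric] algebra_simps)

lemma endpoint_average_eq:
  fixes l u z \<alpha> \<beta> :: real
  assumes "l < u" "z = l \<and> \<alpha> = c \<or> z = u \<and> \<beta> = c"
  shows "(\<alpha> * (u - z) + \<beta> * (z - l)) / (u - l) = c"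
  using assms by auto

text \<open>\<open>\<Phi>\<close> and \<open>\<Psi>\<close> give the first moment of a piece below
  and above a gap as functions of its mass. For fixed total mass \<open>M\<close> the moment depends
  continuously on the share taken below; the extreme shares give values on both sides of
  \<open>m\<close>, and the intermediate value theorem applies.\<close>

lemma exists_mass_moment_split:
  fixes \<Phi> \<Psi> :: "real \<Rightarrow> real"
  assumes \<Phi>: "\<And>s t. 0 \<le> s \<Longrightarrow> s \<le> t \<Longrightarrow> t \<le> p \<Longrightarrow> c1 * (t - s) \<le> \<Phi> t - \<Phi> s \<and> \<Phi> t - \<Phi> s \<le> c2 * (t - s)"
    and \<Psi>: "\<And>s t. 0 \<le> s \<Longrightarrow> s \<le> t \<Longrightarrow> t \<le> q \<Longrightarrow> d1 * (t - s) \<le> \<Psi> t - \<Psi> s \<and> \<Psi> t - \<Psi> s \<le> d2 * (t - s)"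
    and 0: "\<Phi> 0 = 0" "\<Psi> 0 = 0" and pq: "0 \<le> p" "0 \<le> q" "p + q = 1" and e: "\<Phi> p + \<Psi> q = e"
    and M: "0 \<le> M" "M \<le> 1" and m: "c2 * M \<le> m" "m \<le> d1 * M"
      "c2 * (1 - M) \<le> e - m" "e - m \<le> d1 * (1 - M)"
  shows "\<exists>\<alpha> \<beta>. 0 \<le> \<alpha> \<and> \<alpha> \<le> p \<and> 0 \<le> \<beta> \<and> \<beta> \<le> q \<and> \<alpha> + \<beta> = M \<and> \<Phi> \<alpha> + \<Psi> \<beta> = m"
proof -
  \<comment> \<open>The share below the gap may not exceed \<open>p\<close> or \<open>M\<close>, and
    the share \<open>M - \<alpha>\<close> above it may not exceed \<open>q\<close>.\<close>
  define lo hi where "lo = max 0 (M - q)" and "hi = min M p"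
  have lohi: "0 \<le> lo" "lo \<le> hi" "hi \<le> p" "hi \<le> M" "M - lo \<le> q"
    using pq M by (auto simp: lo_def hi_def)
  have lip: "c-lipschitz_on {0..r} \<theta>"
    if \<theta>: "\<And>s t. 0 \<le> s \<Longrightarrow> s \<le> t \<Longrightarrow> t \<le> r \<Longrightarrow> b1 * (t - s) \<le> \<theta> t - \<theta> s \<and> \<theta> t - \<theta> s \<le> b2 * (t - s)"
      and c: "c = max \<bar>b1\<bar> \<bar>b2\<bar>" for \<theta> :: "real \<Rightarrow> real" and b1 b2 r c
  proof (rule lipschitz_on_leI)
    fix s t assume st: "s \<in> {0..r}" "t \<in> {0..r}" "s \<le> t"
    have "b2 * (t - s) \<le> c * (t - s)" "- c * (t - s) \<le> b1 * (t - s)"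
      using st(3) by (intro mult_right_mono; simp add: c; linarith)+
    then show "dist (\<theta> s) (\<theta> t) \<le> c * dist s t"
      using \<theta>[of s t] st by (auto simp: dist_real_def abs_if)
  qed (use c in auto)
  have c\<Phi>: "continuous_on {0..p} \<Phi>"
    using lip[OF \<Phi> refl] by (rule lipschitz_on_continuous_on)
  have c\<Psi>: "continuous_on {0..q} \<Psi>"
    using lip[OF \<Psi> refl] by (rule lipschitz_on_continuous_on)
  have "continuous_on {lo..hi} (\<lambda>\<alpha>. \<Phi> \<alpha> + \<Psi> (M - \<alpha>))"
    using lohi by (intro continuous_intros continuous_on_compose2[OF c\<Phi>] continuous_on_compose2[OF c\<Psi>]) auto
  moreover have "m \<le> \<Phi> lo + \<Psi> (M - lo)"
  proof (cases "M \<le> q")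
    case True
    then show ?thesis
      using \<Psi>[of 0 M] 0 M m by (simp add: lo_def)
  next
    \<comment> \<open>The whole upper mass \<open>q\<close> is used, so the estimate is made on the
      complement, of mass \<open>1 - M\<close>, which lies entirely below the gap.\<close>
    case False
    then show ?thesis
      using \<Phi>[of "M - q" p] pq M m(3) e by (simp add: lo_def algebra_simps)
  qed
  moreover have "\<Phi> hi + \<Psi> (M - hi) \<le> m"
  proof (cases "M \<le> p")
    case True
    then show ?thesis
      using \<Phi>[of 0 M] 0 M m by (simp add: hi_def)
  next
    case False
    have eq: "q - (M - p) = 1 - M"
      using pq by simp
    have "d1 * (1 - M) \<le> \<Psi> q - \<Psi> (M - p)"
      using False \<Psi>[of "M - p" q] pq M unfolding eq by simp
    then show ?thesis
      using False m(4) e by (simp add: hi_def)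
  qed
  ultimately obtain \<alpha> where "lo \<le> \<alpha>" "\<alpha> \<le> hi" "\<Phi> \<alpha> + \<Psi> (M - \<alpha>) = m"
    using IVT2'[of "\<lambda>\<alpha>. \<Phi> \<alpha> + \<Psi> (M - \<alpha>)" hi m lo] lohi(2) by blast
  then show ?thesis
    using lohi by (intro exI[of _ \<alpha>] exI[of _ "M - \<alpha>"]) auto
qed

text \<open>\<open>M g\<close> and \<open>m g\<close> stand for the mass and the first moment that have to be transported into the
  interval \<open>(l g, u g)\<close>. Since the prescribed points lie in the gap, the equality of the means is all
  that is needed.\<close>

lemma exists_nested_intervals:
  fixes \<nu> :: "real measure" and M m :: "real \<Rightarrow> real"
  assumes \<nu>: "prob_measure_on ({zml..zmu} \<union> {zpl..zpu}) \<nu>" "nonatomic \<nu>"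
    and z: "zml \<le> zmu" "zmu < y0" "y0 \<le> y2" "y2 < zpl" "zpl \<le> zpu"
    and M: "\<And>g. 0 \<le> M g \<and> M g \<le> 1"
    and m: "\<And>g. y0 * M g \<le> m g \<and> m g \<le> y2 * M g"
      "\<And>g. y0 * (1 - M g) \<le> (\<integral>z. z \<partial>\<nu>) - m g \<and> (\<integral>z. z \<partial>\<nu>) - m g \<le> y2 * (1 - M g)"
    and incr: "\<And>g g'. g \<le> g' \<Longrightarrow> M g' \<le> M g \<and> y0 * (M g - M g') \<le> m g - m g' \<and> m g - m g' \<le> y2 * (M g - M g')"
  obtains l u where "mono l" "antimono u" "\<And>g. zml \<le> l g \<and> l g \<le> zmu" "\<And>g. zpl \<le> u g \<and> u g \<le> zpu"
    "\<And>g. measure \<nu> {l g<..<u g} = M g" "\<And>g. (\<integral>z. indicator {l g<..<u g} z * z \<partial>\<nu>) = m g"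
proof -
  interpret prob_space \<nu>
    using \<nu>(1) by (simp add: prob_measure_on_def)
  have [measurable_cong, simp]: "sets \<nu> = sets borel"
    using \<nu>(1) by (simp add: prob_measure_on_def)
  have sp [simp]: "space \<nu> = UNIV"
    using sets_eq_imp_space_eq[of \<nu> borel] by simp
  have Z: "AE z in \<nu>. z \<in> {zml..zmu} \<union> {zpl..zpu}"
    using \<nu>(1) by (simp add: prob_measure_on_def)
  interpret finite_borel_measure \<nu>
    by unfold_locales simp
  have atom: "measure \<nu> {x} = 0" for x
    using \<nu>(2) by (simp add: nonatomic_def)
  have notatom: "AE z in \<nu>. z \<noteq> x" for x
    using AE_iff_measurable[of "{x}" \<nu> "\<lambda>z. z \<noteq> x"] atom[of x] by (simp add: emeasure_eq_measure)
  have zb: "AE z in \<nu>. \<bar>z\<bar> \<le> max \<bar>zml\<bar> \<bar>zpu\<bar>"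
    using Z by eventually_elim (use z in auto)
  have zi: "integrable \<nu> (\<lambda>z. indicator A z * z)" if "A \<in> sets borel" for A
    using zb that by (intro integrable_const_bound[where B="max \<bar>zml\<bar> \<bar>zpu\<bar>"])
      (auto elim!: eventually_mono simp: indicator_def)
  \<comment> \<open>Mass and first moment as functions of position. Reparametrised by mass, the
    moment will be Lipschitz although \<open>\<nu>\<close> need not have a density.\<close>
  define D K where "D t = measure \<nu> {..t}" and "K t = (\<integral>z. indicator {..t} z * z \<partial>\<nu>)" for t
  have cD: "continuous_on A D" for A
    using isCont_cdf atom by (auto simp: D_def[abs_def] cdf_def[abs_def] intro!: continuous_at_imp_continuous_on)
  have D_mono: "D s \<le> D t" if "s \<le> t" for s t
    using that by (auto simp: D_def intro!: finite_measure_mono)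
  have D_diff: "D t - D s = measure \<nu> {s<..t}" if "s \<le> t" for s t
  proof -
    have "{..t} = {..s} \<union> {s<..t}" "{..s} \<inter> {s<..t} = {}"
      using that by auto
    then show ?thesis
      using finite_measure_Union[of "{..s}" "{s<..t}"] by (auto simp: D_def)
  qed
  have K_diff: "K t - K s = (\<integral>z. indicator {s<..t} z * z \<partial>\<nu>)" if "s \<le> t" for s t
  proof -
    have "K t - K s = (\<integral>z. indicator {..t} z * z - indicator {..s} z * z \<partial>\<nu>)"
      unfolding K_def by (intro Bochner_Integration.integral_diff[symmetric] zi) auto
    also have "\<dots> = (\<integral>z. indicator {s<..t} z * z \<partial>\<nu>)"
      using that by (intro Bochner_Integration.integral_cong) (auto simp: indicator_def)
    finally show ?thesis .
  qed
  have K_bounds: "s * (D t - D s) \<le> K t - K s \<and> K t - K s \<le> t * (D t - D s)" if "s \<le> t" for s t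
  proof -
    have "(\<integral>z. indicator {s<..t} z * s \<partial>\<nu>) \<le> (\<integral>z. indicator {s<..t} z * z \<partial>\<nu>)"
      "(\<integral>z. indicator {s<..t} z * z \<partial>\<nu>) \<le> (\<integral>z. indicator {s<..t} z * t \<partial>\<nu>)"
      by (intro integral_mono zi integrable_mult_left integrable_real_indicator;
          auto simp: indicator_def emeasure_eq_measure)+
    then show ?thesis
      using that by (simp add: K_diff D_diff mult.commute)
  qed
  define p where "p = D zmu"
  have D_zml: "D zml = 0"
  proof -
    have "AE z in \<nu>. z \<notin> {..zml}"
      using Z notatom[of zml] by eventually_elim (use z in auto)
    then show ?thesis
      unfolding D_def by (subst prob_eq_0) auto
  qed
  have D_zpl: "D zpl = p"
  proof -
    have "AE z in \<nu>. z \<notin> {zmu<..zpl}"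
      using Z notatom[of zpl] by eventually_elim (use z in auto)
    then have "measure \<nu> {zmu<..zpl} = 0"
      by (subst prob_eq_0) auto
    then show ?thesis
      using D_diff[of zmu zpl] z by (simp add: p_def)
  qed
  have D_zpu: "D zpu = 1"
    unfolding D_def using Z by (subst prob_eq_1) (use z in \<open>auto elim!: eventually_mono\<close>)
  have K_zml: "K zml = 0"
  proof -
    have "AE z in \<nu>. indicator {..zml} z * z = 0"
      using Z notatom[of zml] by eventually_elim (use z in auto)
    then show ?thesis
      unfolding K_def by (rule integral_eq_zero_AE)
  qed
  have K_zpl: "K zpl = K zmu"
    using K_bounds[of zmu zpl] D_zpl z by (simp add: p_def)
  have K_zpu: "K zpu = (\<integral>z. z \<partial>\<nu>)"
    unfolding K_def using Z
    by (intro integral_cong_AE) (use z in \<open>auto elim!: eventually_mono simp: indicator_def\<close>)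
  have p: "0 \<le> p" "p \<le> 1"
    by (auto simp: p_def D_def)
  \<comment> \<open>Quantiles on either side of the gap. \<open>D\<close> may be constant on
    intervals, so an arbitrary preimage is chosen; by \<open>K_flat\<close> the moment does not
    depend on the choice.\<close>
  have "\<exists>l. zml \<le> l \<and> l \<le> zmu \<and> D l = v" if "0 \<le> v" "v \<le> p" for v
    using IVT'[of D zml v zmu] that D_zml cD z by (auto simp: p_def)
  then obtain L where L: "\<And>v. 0 \<le> v \<Longrightarrow> v \<le> p \<Longrightarrow> zml \<le> L v \<and> L v \<le> zmu \<and> D (L v) = v"
    by metis
  have "\<exists>u. zpl \<le> u \<and> u \<le> zpu \<and> D u = v" if "p \<le> v" "v \<le> 1" for v
    using IVT'[of D zpl v zpu] that D_zpl D_zpu cD z by auto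
  then obtain U where U: "\<And>v. p \<le> v \<Longrightarrow> v \<le> 1 \<Longrightarrow> zpl \<le> U v \<and> U v \<le> zpu \<and> D (U v) = v"
    by metis
  have L_mono: "L s \<le> L t" if "0 \<le> s" "s \<le> t" "t \<le> p" for s t
    using L[of s] L[of t] D_mono[of "L t" "L s"] that by (smt (verit))
  have U_mono: "U s \<le> U t" if "p \<le> s" "s \<le> t" "t \<le> 1" for s t
    using U[of s] U[of t] D_mono[of "U t" "U s"] that by (smt (verit))
  \<comment> \<open>First moments of the mass \<open>\<alpha>\<close> adjacent to the gap from below
    and of the mass \<open>\<beta>\<close> adjacent to it from above; together they fill an interval
    around the gap.\<close>
  define \<Phi> \<Psi> where "\<Phi> \<alpha> = K zmu - K (L (p - \<alpha>))" and "\<Psi> \<beta> = K (U (p + \<beta>)) - K zmu" for \<alpha> \<beta>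
  have \<Phi>: "zml * (t - s) \<le> \<Phi> t - \<Phi> s \<and> \<Phi> t - \<Phi> s \<le> zmu * (t - s)" if "0 \<le> s" "s \<le> t" "t \<le> p" for s t
  proof -
    have "L (p - t) \<le> L (p - s)"
      using that by (intro L_mono) auto
    note K_bounds[OF this]
    moreover have "D (L (p - s)) - D (L (p - t)) = t - s"
      using L[of "p - s"] L[of "p - t"] that by simp
    moreover have "zml * (t - s) \<le> L (p - t) * (t - s)" "L (p - s) * (t - s) \<le> zmu * (t - s)"
      using L[of "p - s"] L[of "p - t"] that by (auto intro!: mult_right_mono)
    ultimately show ?thesis
      by (simp add: \<Phi>_def)
  qed
  have \<Psi>: "zpl * (t - s) \<le> \<Psi> t - \<Psi> s \<and> \<Psi> t - \<Psi> s \<le> zpu * (t - s)" if "0 \<le> s" "s \<le> t" "t \<le> 1 - p" for s t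
  proof -
    have "U (p + s) \<le> U (p + t)"
      using that by (intro U_mono) auto
    note K_bounds[OF this]
    moreover have "D (U (p + t)) - D (U (p + s)) = t - s"
      using U[of "p + s"] U[of "p + t"] that by simp
    moreover have "zpl * (t - s) \<le> U (p + s) * (t - s)" "U (p + t) * (t - s) \<le> zpu * (t - s)"
      using U[of "p + s"] U[of "p + t"] that by (auto intro!: mult_right_mono)
    ultimately show ?thesis
      by (simp add: \<Psi>_def)
  qed
  have K_flat: "K s = K t" if "D s = D t" for s t
  proof (cases "s \<le> t")
    case True
    then show ?thesis
      using K_bounds[OF True] that by simp
  next
    case False
    then show ?thesis
      using K_bounds[of t s] that by simp
  qed
  have \<Phi>\<Psi>0: "\<Phi> 0 = 0" "\<Psi> 0 = 0"
    using K_flat[of "L p" zmu] K_flat[of "U p" zmu] L[of p] U[of p] p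
    unfolding \<Phi>_def \<Psi>_def p_def[symmetric] by simp_all
  have "K (L 0) = 0" "K (U 1) = (\<integral>z. z \<partial>\<nu>)"
    using K_flat[of "L 0" zml] K_flat[of "U 1" zpu] L[of 0] U[of 1] p D_zml D_zpu K_zml K_zpu by auto
  then have \<Phi>\<Psi>1: "\<Phi> p + \<Psi> (1 - p) = (\<integral>z. z \<partial>\<nu>)"
    by (simp add: \<Phi>_def \<Psi>_def)
  have "\<exists>\<alpha> \<beta>. 0 \<le> \<alpha> \<and> \<alpha> \<le> p \<and> 0 \<le> \<beta> \<and> \<beta> \<le> 1 - p \<and> \<alpha> + \<beta> = M g \<and> \<Phi> \<alpha> + \<Psi> \<beta> = m g" for g
  proof (rule exists_mass_moment_split[OF \<Phi> \<Psi> \<Phi>\<Psi>0 _ _ _ \<Phi>\<Psi>1])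
    have "zmu * M g \<le> y0 * M g" "y2 * M g \<le> zpl * M g" "zmu * (1 - M g) \<le> y0 * (1 - M g)"
      "y2 * (1 - M g) \<le> zpl * (1 - M g)"
      using M[of g] z by (auto intro!: mult_right_mono)
    then show "zmu * M g \<le> m g" "m g \<le> zpl * M g" "zmu * (1 - M g) \<le> (\<integral>z. z \<partial>\<nu>) - m g"
      "(\<integral>z. z \<partial>\<nu>) - m g \<le> zpl * (1 - M g)"
      using m[of g] by linarith+
  qed (use M p in auto)
  then obtain \<alpha> \<beta> where ab: "\<And>g. 0 \<le> \<alpha> g \<and> \<alpha> g \<le> p \<and> 0 \<le> \<beta> g \<and> \<beta> g \<le> 1 - p \<and> \<alpha> g + \<beta> g = M g \<and> \<Phi> (\<alpha> g) + \<Psi> (\<beta> g) = m g"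
    by metis
  \<comment> \<open>If one share grew with the level, the other would have to shrink by more than
    the total mass does. Mass exchanged across the gap changes the moment by at least
    \<open>zpl - zmu\<close> per unit, so the change of \<open>m\<close> would leave the range
    between \<open>y0\<close> and \<open>y2\<close> per unit of lost mass.\<close>
  have anti: "\<alpha> g' \<le> \<alpha> g \<and> \<beta> g' \<le> \<beta> g" if "g \<le> g'" for g g'
  proof (intro conjI)
    have z1: "zmu * (M g - M g') \<le> y0 * (M g - M g')" "y2 * (M g - M g') \<le> zpl * (M g - M g')"
      using incr[OF that] z by (auto intro!: mult_right_mono)
    show "\<alpha> g' \<le> \<alpha> g"
    proof (rule ccontr)
      assume "\<not> \<alpha> g' \<le> \<alpha> g"
      then have lt: "0 < \<alpha> g' - \<alpha> g"
        by simp
      have eq: "\<beta> g - \<beta> g' = (M g - M g') + (\<alpha> g' - \<alpha> g)"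
        using ab[of g] ab[of g'] by linarith
      have "zpl * (\<beta> g - \<beta> g') - zmu * (\<alpha> g' - \<alpha> g) \<le> m g - m g'"
        using \<Phi>[of "\<alpha> g" "\<alpha> g'"] \<Psi>[of "\<beta> g'" "\<beta> g"] ab[of g] ab[of g'] lt eq incr[OF that] by linarith
      then have "zpl * (M g - M g') + (zpl - zmu) * (\<alpha> g' - \<alpha> g) \<le> m g - m g'"
        unfolding eq by (simp add: algebra_simps)
      moreover have "0 < (zpl - zmu) * (\<alpha> g' - \<alpha> g)"
        using lt z by simp
      ultimately show False
        using z1 incr[OF that] by linarith
    qed
    show "\<beta> g' \<le> \<beta> g"
    proof (rule ccontr)
      assume "\<not> \<beta> g' \<le> \<beta> g"
      then have lt: "0 < \<beta> g' - \<beta> g"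
        by simp
      have eq: "\<alpha> g - \<alpha> g' = (M g - M g') + (\<beta> g' - \<beta> g)"
        using ab[of g] ab[of g'] by linarith
      have "m g - m g' \<le> zmu * (\<alpha> g - \<alpha> g') - zpl * (\<beta> g' - \<beta> g)"
        using \<Phi>[of "\<alpha> g'" "\<alpha> g"] \<Psi>[of "\<beta> g" "\<beta> g'"] ab[of g] ab[of g'] lt eq incr[OF that] by linarith
      then have "m g - m g' \<le> zmu * (M g - M g') - (zpl - zmu) * (\<beta> g' - \<beta> g)"
        unfolding eq by (simp add: algebra_simps)
      moreover have "0 < (zpl - zmu) * (\<beta> g' - \<beta> g)"
        using lt z by simp
      ultimately show False
        using z1 incr[OF that] by linarith
    qed
  qed
  define l u where "l g = L (p - \<alpha> g)" and "u g = U (p + \<beta> g)" for g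
  have l: "zml \<le> l g \<and> l g \<le> zmu \<and> D (l g) = p - \<alpha> g" and u: "zpl \<le> u g \<and> u g \<le> zpu \<and> D (u g) = p + \<beta> g" for g
    using L[of "p - \<alpha> g"] U[of "p + \<beta> g"] ab[of g] by (auto simp: l_def u_def)
  have lu: "l g \<le> u g" for g
    using l[of g] u[of g] z by linarith
  \<comment> \<open>Without atoms the open interval may be exchanged for the half-open one, whose
    mass and moment are increments of \<open>D\<close> and \<open>K\<close>.\<close>
  have ind: "AE z in \<nu>. indicator {l g<..<u g} z = (indicator {l g<..u g} z :: real)" for g
    using notatom[of "u g"] by eventually_elim (auto simp: indicator_def)
  show ?thesis
  proof
    show "mono l"
      unfolding l_def using ab anti by (intro monoI L_mono) (auto simp: algebra_simps)
    show "antimono u"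
      unfolding u_def using ab anti by (intro antimonoI U_mono) (auto simp: algebra_simps)
    show "zml \<le> l g \<and> l g \<le> zmu" "zpl \<le> u g \<and> u g \<le> zpu" for g
      using l u by auto
    show "measure \<nu> {l g<..<u g} = M g" for g
    proof -
      have "measure \<nu> {l g<..<u g} = measure \<nu> {l g<..u g}"
        using notatom[of "u g"] by (intro measure_eq_AE) (auto elim!: eventually_mono)
      then show ?thesis
        using D_diff[OF lu, of g] l[of g] u[of g] ab[of g] by linarith
    qed
    show "(\<integral>z. indicator {l g<..<u g} z * z \<partial>\<nu>) = m g" for g
    proof -
      have "(\<integral>z. indicator {l g<..<u g} z * z \<partial>\<nu>) = (\<integral>z. indicator {l g<..u g} z * z \<partial>\<nu>)"
        using ind[of g] by (intro integral_cong_AE) (auto elim!: eventually_mono)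
      also have "\<dots> = K (u g) - K (l g)"
        by (rule K_diff[OF lu, symmetric])
      also have "\<dots> = m g"
        using ab[of g] by (simp add: \<Phi>_def \<Psi>_def l_def u_def)
      finally show ?thesis .
    qed
  qed
qed

text \<open>The point \<open>z\<close> is inside the intervals of levels just below
  \<open>\<gamma>\<close> and outside those just above, so at a common continuity point of the ends
  it must be an end. Which end is decided by the side of the gap, as the opposite inequality holds
  automatically. Only rational levels are tested, because in applications the inclusions hold almost
  surely for countably many levels at once.\<close>

lemma eq_endpoint_of_nested_intervals:
  fixes l u :: "real \<Rightarrow> real"
  assumes l: "\<And>g. zml \<le> l g \<and> l g \<le> zmu" and u: "\<And>g. zpl \<le> u g \<and> u g \<le> zpu" and "zmu < zpl"
    and z: "z \<in> {zml..zmu} \<union> {zpl..zpu}" and \<gamma>: "\<gamma>0 < \<gamma>" "\<gamma> < \<gamma>1"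
    and cont: "isCont l \<gamma>" "isCont u \<gamma>"
    and below: "\<And>g. g \<in> \<rat> \<Longrightarrow> \<gamma>0 < g \<Longrightarrow> g < \<gamma> \<Longrightarrow> l g < z \<and> z < u g"
    and above: "\<And>g. g \<in> \<rat> \<Longrightarrow> \<gamma> < g \<Longrightarrow> g < \<gamma>1 \<Longrightarrow> \<not> (l g < z \<and> z < u g)"
  shows "z = (if z \<le> zmu then l \<gamma> else u \<gamma>)"
proof -
  have left: "\<exists>g\<in>\<rat>. \<gamma>0 < g \<and> g < \<gamma> \<and> P g" and right: "\<exists>g\<in>\<rat>. \<gamma> < g \<and> g < \<gamma>1 \<and> P g"
    if ev: "eventually P (at \<gamma>)" for P
  proof -
    obtain d where d: "d > 0" "\<And>g. g \<noteq> \<gamma> \<Longrightarrow> dist g \<gamma> < d \<Longrightarrow> P g"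
      using ev by (auto simp: eventually_at)
    obtain g where "g \<in> \<rat>" "max \<gamma>0 (\<gamma> - d) < g" "g < \<gamma>"
      using Rats_dense_in_real[of "max \<gamma>0 (\<gamma> - d)" \<gamma>] d \<gamma> by auto
    then show "\<exists>g\<in>\<rat>. \<gamma>0 < g \<and> g < \<gamma> \<and> P g"
      using d by (intro bexI[of _ g]) (auto simp: dist_real_def)
    obtain g where "g \<in> \<rat>" "\<gamma> < g" "g < min \<gamma>1 (\<gamma> + d)"
      using Rats_dense_in_real[of \<gamma> "min \<gamma>1 (\<gamma> + d)"] d \<gamma> by auto
    then show "\<exists>g\<in>\<rat>. \<gamma> < g \<and> g < \<gamma>1 \<and> P g"
      using d by (intro bexI[of _ g]) (auto simp: dist_real_def)
  qed
  show ?thesis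
  proof (cases "z \<le> zmu")
    case True
    have "\<not> z < l \<gamma>"
    proof
      assume "z < l \<gamma>"
      then have "eventually (\<lambda>g. z < l g) (at \<gamma>)"
        using cont(1) unfolding isCont_def by (rule order_tendstoD(1)[rotated])
      from left[OF this] show False
        using below by fastforce
    qed
    moreover have "\<not> l \<gamma> < z"
    proof
      assume "l \<gamma> < z"
      then have "eventually (\<lambda>g. l g < z) (at \<gamma>)"
        using cont(1) unfolding isCont_def by (rule order_tendstoD(2)[rotated])
      from right[OF this] obtain g where "g \<in> \<rat>" "\<gamma> < g" "g < \<gamma>1" "l g < z"
        by auto
      then show False
        using above[of g] u[of g] True \<open>zmu < zpl\<close> by linarith
    qed
    ultimately show ?thesis
      using True by simp
  next
    case False
    have "\<not> u \<gamma> < z"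
    proof
      assume "u \<gamma> < z"
      then have "eventually (\<lambda>g. u g < z) (at \<gamma>)"
        using cont(2) unfolding isCont_def by (rule order_tendstoD(2)[rotated])
      from left[OF this] show False
        using below by fastforce
    qed
    moreover have "\<not> z < u \<gamma>"
    proof
      assume "z < u \<gamma>"
      then have "eventually (\<lambda>g. z < u g) (at \<gamma>)"
        using cont(2) unfolding isCont_def by (rule order_tendstoD(1)[rotated])
      from right[OF this] obtain g where "g \<in> \<rat>" "\<gamma> < g" "g < \<gamma>1" "z < u g"
        by auto
      then show False
        using above[of g] l[of g] False by linarith
    qed
    ultimately show ?thesis
      using False by simp
  qed
qed

lemma (in finite_measure) AE_not_in_countable:
  assumes [measurable]: "\<phi> \<in> borel_measurable M"
    and "\<And>g::real. AE x in M. \<phi> x \<noteq> g" and "countable S"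
  shows "AE x in M. \<phi> x \<notin> S"
proof -
  have "AE x in M. \<forall>g\<in>S. \<phi> x \<noteq> g"
    using assms by (simp add: AE_ball_countable)
  then show ?thesis
    by eventually_elim auto
qed

text \<open>The generalised inverse \<open>G z = sup {g. z \<in> (l g, u g)}\<close> couples \<open>\<nu>\<close> with \<open>P\<close>: the pairs
  \<open>(G, z)\<close> and \<open>(F, Y)\<close> have the same law of the first and the same conditional mean of the second
  component, and \<open>z\<close> is almost surely an end point of the interval with index \<open>G z\<close>.\<close>

lemma endpoint_kernel_marginal:
  fixes \<nu> :: "real measure" and F Y :: "'a \<Rightarrow> real"
  assumes "prob_space P" and [measurable]: "F \<in> borel_measurable P" "Y \<in> borel_measurable P"
    and \<nu>: "prob_measure_on ({zml..zmu} \<union> {zpl..zpu}) \<nu>"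
    and F: "\<And>x. \<gamma>0 < F x \<and> F x < \<gamma>1" "\<And>g. AE x in P. F x \<noteq> g"
    and Y: "AE x in P. \<bar>Y x\<bar> \<le> C"
    and mean: "(\<integral>x. Y x \<partial>P) = (\<integral>z. z \<partial>\<nu>)"
    and lu: "mono l" "antimono u" "\<And>g. zml \<le> l g \<and> l g \<le> zmu" "\<And>g. zpl \<le> u g \<and> u g \<le> zpu" "zmu < zpl"
    and mass: "\<And>g. measure \<nu> {l g<..<u g} = (\<integral>x. indicator {g<..} (F x) \<partial>P)"
    and moment: "\<And>g. (\<integral>z. indicator {l g<..<u g} z * z \<partial>\<nu>) = (\<integral>x. indicator {g<..} (F x) * Y x \<partial>P)"
    and [measurable]: "B \<in> sets borel"
  shows "(\<integral>x. (indicator B (l (F x)) * (u (F x) - Y x) + indicator B (u (F x)) * (Y x - l (F x))) /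
    (u (F x) - l (F x)) \<partial>P) = measure \<nu> B"
proof -
  interpret P: prob_space P by fact
  interpret prob_space \<nu>
    using \<nu>(1) by (simp add: prob_measure_on_def)
  have [measurable_cong, simp]: "sets \<nu> = sets borel"
    using \<nu>(1) by (simp add: prob_measure_on_def)
  have sp [simp]: "space \<nu> = UNIV"
    using sets_eq_imp_space_eq[of \<nu> borel] by simp
  have Z: "AE z in \<nu>. z \<in> {zml..zmu} \<union> {zpl..zpu}"
    using \<nu>(1) by (simp add: prob_measure_on_def)
  define C' where "C' = max (max \<bar>zml\<bar> \<bar>zpu\<bar>) \<bar>C\<bar>"
  have zb: "AE z in \<nu>. \<bar>z\<bar> \<le> C'"
    using Z by eventually_elim (use lu(3,4)[of 0] lu(5) in \<open>auto simp: C'_def\<close>)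
  have Yb: "AE x in P. \<bar>Y x\<bar> \<le> C'"
    using Y by eventually_elim (auto simp: C'_def)
  have lb: "\<bar>l g\<bar> \<le> C'" "\<bar>u g\<bar> \<le> C'" for g
    using lu(3,4)[of g] lu(5) by (auto simp: C'_def)
  have C'0: "0 \<le> C'"
    by (auto simp: C'_def)
  have [measurable]: "l \<in> borel_measurable borel"
    using lu(1) by (rule borel_measurable_mono)
  have [measurable]: "u \<in> borel_measurable borel"
    using lu(2) by (rule borel_measurable_antimono)
  \<comment> \<open>Inserting \<open>\<gamma>0\<close> keeps the set nonempty when \<open>z\<close>
    lies in none of the intervals, so the supremum is genuine and stays within the range of
    levels.\<close>
  define J where "J z = insert \<gamma>0 {g \<in> {\<gamma>0..\<gamma>1}. l g < z \<and> z < u g}" for z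
  define G where "G z = Sup (J z)" for z
  have \<gamma>01: "\<gamma>0 < \<gamma>1"
    using F(1)[of undefined] by simp
  have J: "J z \<noteq> {}" "bdd_above (J z)" for z
    using \<gamma>01 by (auto simp: J_def intro!: bdd_aboveI[of _ \<gamma>1])
  have less_G: "g < G z \<longleftrightarrow> (\<exists>g'\<in>J z. g < g')" for g z
    unfolding G_def by (rule less_cSup_iff[OF J])
  define s where "s g n = g + (\<gamma>1 - g) / (real n + 1)" for g and n :: nat
  have s: "g < s g n" "s g n \<le> \<gamma>1" if "g < \<gamma>1" for g n
    using that by (auto simp: s_def field_simps intro!: mult_right_mono)
  have s_lim: "(\<lambda>n. s g n) \<longlonglongrightarrow> g" for g
  proof -
    have "(\<lambda>n. g + (\<gamma>1 - g) * inverse (real (Suc n))) \<longlonglongrightarrow> g + (\<gamma>1 - g) * 0"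
      by (intro tendsto_intros LIMSEQ_inverse_real_of_nat)
    then show ?thesis
      by (simp add: s_def divide_inverse add.commute)
  qed
  have nested: "l g < z \<and> z < u g" if "g \<le> g'" "l g' < z" "z < u g'" for g g' z
    using that monoD[OF lu(1) that(1)] antimonoD[OF lu(2) that(1)] by linarith
  have G_mid: "g < G z \<longleftrightarrow> (\<exists>n. l (s g n) < z \<and> z < u (s g n))" if "\<gamma>0 \<le> g" "g < \<gamma>1" for g z
  proof
    assume "g < G z"
    then obtain g' where g': "g' \<in> J z" "g < g'"
      by (auto simp: less_G)
    then have 1: "l g' < z" "z < u g'"
      using that by (auto simp: J_def)
    have "eventually (\<lambda>n. s g n < g') sequentially"
      using s_lim g'(2) by (rule order_tendstoD)
    then obtain n where "s g n < g'"
      by (auto simp: eventually_sequentially)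
    then show "\<exists>n. l (s g n) < z \<and> z < u (s g n)"
      using nested[of "s g n" g' z] 1 by auto
  next
    assume "\<exists>n. l (s g n) < z \<and> z < u (s g n)"
    then obtain n where "l (s g n) < z \<and> z < u (s g n)" ..
    then show "g < G z"
      unfolding less_G using s[OF that(2), of n] that by (intro bexI[of _ "s g n"]) (auto simp: J_def)
  qed
  have G_low: "g < G z" if "g < \<gamma>0" for g z
    unfolding less_G using that by (auto simp: J_def)
  have G_high: "\<not> g < G z" if "\<gamma>1 \<le> g" for g z
    unfolding less_G using that \<gamma>01 by (auto simp: J_def)
  have G_meas: "{z. g < G z} \<in> sets borel" for g
  proof (cases "\<gamma>0 \<le> g \<and> g < \<gamma>1")
    case True
    then have "{z. g < G z} = (\<Union>n. {l (s g n)<..<u (s g n)})"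
      by (auto simp: G_mid)
    then show ?thesis
      by simp
  next
    case False
    then have "{z. g < G z} = UNIV \<or> {z. g < G z} = {}"
      using G_low[of g] G_high[of g] by (cases "g < \<gamma>0") auto
    then show ?thesis
      by auto
  qed
  have [measurable]: "G \<in> borel_measurable borel"
    by (rule borel_measurableI_greater) (use G_meas in auto)
  \<comment> \<open>The set where \<open>G\<close> exceeds \<open>g\<close> need not be the interval
    of level \<open>g\<close>, since the ends may jump there; it is the limit of the intervals of
    levels above \<open>g\<close>. Right-continuity on the side of \<open>F\<close> shows that the
    integrals agree all the same.\<close>
  have halfline: "(\<integral>z. indicator {g<..} (G z) * k z \<partial>\<nu>) = (\<integral>x. indicator {g<..} (F x) * h x \<partial>P)"
    if k: "integrable \<nu> k" and h: "integrable P h" and full: "(\<integral>x. h x \<partial>P) = (\<integral>z. k z \<partial>\<nu>)"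
      and eq: "\<And>g. (\<integral>z. indicator {l g<..<u g} z * k z \<partial>\<nu>) = (\<integral>x. indicator {g<..} (F x) * h x \<partial>P)"
    for k :: "real \<Rightarrow> real" and h :: "'a \<Rightarrow> real" and g
  proof -
    consider "g < \<gamma>0" | "\<gamma>0 \<le> g" "g < \<gamma>1" | "\<gamma>1 \<le> g" by linarith
    then show ?thesis
    proof cases
      case 1
      have "g < F x" for x
        using 1 F(1)[of x] by linarith
      then have "(\<integral>x. indicator {g<..} (F x) * h x \<partial>P) = (\<integral>x. h x \<partial>P)"
        by (intro Bochner_Integration.integral_cong) auto
      moreover have "(\<integral>z. indicator {g<..} (G z) * k z \<partial>\<nu>) = (\<integral>z. k z \<partial>\<nu>)"
        using G_low[OF 1] by (intro Bochner_Integration.integral_cong) auto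
      ultimately show ?thesis
        using full by simp
    next
      case 2
      have [measurable]: "k \<in> borel_measurable borel"
        using k by (auto simp: integrable_iff_bounded)
      have "(\<lambda>n. \<integral>z. indicator {l (s g n)<..<u (s g n)} z * k z \<partial>\<nu>) \<longlonglongrightarrow> (\<integral>z. indicator {g<..} (G z) * k z \<partial>\<nu>)"
      proof (rule integral_dominated_convergence[where w="\<lambda>z. \<bar>k z\<bar>"])
        show "AE z in \<nu>. (\<lambda>n. indicator {l (s g n)<..<u (s g n)} z * k z) \<longlonglongrightarrow> indicator {g<..} (G z) * k z"
        proof (rule AE_I2)
          fix z
          have "(\<lambda>n. indicator {l (s g n)<..<u (s g n)} z :: real) \<longlonglongrightarrow> indicator {g<..} (G z)"
          proof (cases "g < G z")
            case True
            then obtain n0 where n0: "l (s g n0) < z" "z < u (s g n0)"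
              using G_mid[OF 2] by auto
            have "eventually (\<lambda>n. s g n < s g n0) sequentially"
              using s_lim s(1)[OF 2(2)] by (rule order_tendstoD)
            then have "eventually (\<lambda>n. z \<in> {l (s g n)<..<u (s g n)}) sequentially"
              by eventually_elim (use nested[OF _ n0] in auto)
            then show ?thesis
              using True by (intro tendsto_eventually) (auto elim!: eventually_mono simp: indicator_def)
          next
            case False
            then have "indicator {l (s g n)<..<u (s g n)} z = (0::real)" for n
              using G_mid[OF 2] by auto
            then show ?thesis
              using False by simp
          qed
          then show "(\<lambda>n. indicator {l (s g n)<..<u (s g n)} z * k z) \<longlonglongrightarrow> indicator {g<..} (G z) * k z"
            by (intro tendsto_intros)
        qed
        show "AE z in \<nu>. norm (indicator {l (s g n)<..<u (s g n)} z * k z) \<le> \<bar>k z\<bar>" for n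
          by (auto simp: indicator_def)
      qed (use k in auto)
      moreover have "(\<lambda>n. \<integral>x. indicator {s g n<..} (F x) * h x \<partial>P) \<longlonglongrightarrow> (\<integral>x. indicator {g<..} (F x) * h x \<partial>P)"
        using s(1)[OF 2(2)] by (intro tendsto_integral_superlevel h s_lim) (auto intro: less_imp_le)
      ultimately show ?thesis
        unfolding eq by (rule LIMSEQ_unique)
    next
      case 3
      have "\<not> g < F x" for x
        using 3 F(1)[of x] by linarith
      then have "(\<integral>x. indicator {g<..} (F x) * h x \<partial>P) = (\<integral>x. 0 \<partial>P)"
        by (intro Bochner_Integration.integral_cong) auto
      moreover have "(\<integral>z. indicator {g<..} (G z) * k z \<partial>\<nu>) = (\<integral>z. 0 \<partial>\<nu>)"
        using G_high[OF 3] by (intro Bochner_Integration.integral_cong) auto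
      ultimately show ?thesis
        by simp
    qed
  qed
  have zi: "integrable \<nu> (\<lambda>z. z)"
    using zb by (intro integrable_const_bound[where B=C']) auto
  have Yi: "integrable P Y"
    using Yb by (intro P.integrable_const_bound[where B=C']) auto
  have half_mass: "(\<integral>x. indicator {g<..} (F x) \<partial>P) = (\<integral>z. indicator {g<..} (G z) \<partial>\<nu> :: real)" for g
    using halfline[of "\<lambda>z. 1" "\<lambda>x. 1" g] mass prob_space by (simp add: P.prob_space)
  have half_moment: "(\<integral>x. indicator {g<..} (F x) * Y x \<partial>P) = (\<integral>z. indicator {g<..} (G z) * z \<partial>\<nu>)" for g
    using halfline[OF zi Yi mean moment] by simp
  have same: "(\<integral>x. \<psi> (F x) * Y x \<partial>P) = (\<integral>z. \<psi> (G z) * z \<partial>\<nu>)" "(\<integral>x. \<psi> (F x) \<partial>P) = (\<integral>z. \<psi> (G z) \<partial>\<nu>)"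
    if [measurable]: "\<psi> \<in> borel_measurable borel" and "\<And>t. \<bar>\<psi> t\<bar> \<le> b" for \<psi> :: "real \<Rightarrow> real" and b
  proof -
    note * = integral_eq_of_halflines[OF P.finite_measure_axioms finite_measure_axioms
        _ _ _ _ _ Yb zb that(2) half_mass half_moment]
    show "(\<integral>x. \<psi> (F x) * Y x \<partial>P) = (\<integral>z. \<psi> (G z) * z \<partial>\<nu>)" "(\<integral>x. \<psi> (F x) \<partial>P) = (\<integral>z. \<psi> (G z) \<partial>\<nu>)"
      by (rule *; measurable)+
  qed
  have same_null: "AE z in \<nu>. G z \<notin> S" if "AE x in P. F x \<notin> S" and [measurable]: "S \<in> sets borel" for S
  proof -
    have "(\<integral>x. indicator S (F x) \<partial>P) = (\<integral>z. indicator S (G z) \<partial>\<nu> :: real)"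
      by (rule same(2)[of "indicator S" 1]) (auto simp: indicator_def)
    moreover have "(\<integral>x. indicator S (F x) \<partial>P) = (0::real)"
      using that(1) by (intro integral_eq_zero_AE) (auto elim!: eventually_mono)
    moreover have "(\<integral>z. indicator S (G z) \<partial>\<nu>) = prob {z. G z \<in> S}"
    proof -
      have "(\<lambda>z. indicator S (G z) :: real) = indicator {z. G z \<in> S}"
        by (auto simp: indicator_def)
      then show ?thesis
        by simp
    qed
    ultimately show ?thesis
      using prob_eq_0[of "{z. G z \<in> S}"] by simp
  qed
  \<comment> \<open>Levels at which an end jumps, together with those outside the open range of
    \<open>F\<close>. \<open>F\<close> avoids \<open>S\<close> since its law has no atoms, and
    \<open>G\<close> has the same law.\<close>
  define S where "S = {g. \<not> isCont l g} \<union> {g. \<not> isCont u g} \<union> - {\<gamma>0<..<\<gamma>1}"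
  note cS = countable_discont_mono_antimono[OF lu(1,2)]
  have "AE x in P. F x \<notin> S"
    using P.AE_not_in_countable[OF _ F(2) cS] F(1) by (auto elim!: eventually_mono simp: S_def)
  moreover have "S \<in> sets borel"
    unfolding S_def by (intro sets.Un sets.countable[OF _ cS]) auto
  ultimately have "AE z in \<nu>. G z \<notin> S"
    by (rule same_null)
  then have endpoint: "AE z in \<nu>. z = (if z \<le> zmu then l (G z) else u (G z))"
    using Z
  proof eventually_elim
    case (elim z)
    show ?case
    proof (rule eq_endpoint_of_nested_intervals[OF lu(3,4,5) elim(2)])
      show "\<gamma>0 < G z" "G z < \<gamma>1" "isCont l (G z)" "isCont u (G z)"
        using elim(1) by (auto simp: S_def)
      show "l g < z \<and> z < u g" if "\<gamma>0 < g" "g < G z" for g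
      proof -
        from that(2) obtain g' where "g' \<in> J z" "g < g'"
          by (auto simp: less_G)
        then show ?thesis
          using nested[of g g' z] that by (auto simp: J_def)
      qed
      show "\<not> (l g < z \<and> z < u g)" if "G z < g" "g < \<gamma>1" for g
      proof
        assume "l g < z \<and> z < u g"
        moreover have "\<gamma>0 \<le> G z"
          unfolding G_def by (rule cSup_upper[OF _ J(2)]) (simp add: J_def)
        ultimately have "g \<in> J z"
          using that by (auto simp: J_def)
        then have "g \<le> G z"
          unfolding G_def by (rule cSup_upper[OF _ J(2)])
        then show False
          using that by simp
      qed
    qed
  qed
  define \<delta> where "\<delta> = zpl - zmu"
  have gap: "0 < \<delta>" "\<delta> \<le> u t - l t" for t
    using lu(3,4)[of t] lu(5) by (auto simp: \<delta>_def)
  \<comment> \<open>The coefficients of the end-point average as an affine function of the mean.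
    Both are functions of the level, so the average is computed from the level law and the first
    moments by level, which \<open>F\<close>, \<open>Y\<close> and \<open>G\<close>, z
    share.\<close>
  define \<psi>1 \<psi>2 where "\<psi>1 t = (indicator B (l t) * u t - indicator B (u t) * l t) / (u t - l t)"
    and "\<psi>2 t = (indicator B (u t) - indicator B (l t)) / (u t - l t)" for t
  have \<psi> [measurable]: "\<psi>1 \<in> borel_measurable borel" "\<psi>2 \<in> borel_measurable borel"
    unfolding \<psi>1_def \<psi>2_def by measurable
  have quot: "\<bar>x / (u t - l t)\<bar> \<le> b / \<delta>" if "\<bar>x\<bar> \<le> b" for x b t
    using gap(1) gap(2)[of t] that by (auto simp: abs_divide intro!: frac_le)
  have b1: "\<bar>\<psi>1 t\<bar> \<le> (C' + C') / \<delta>" for t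
    unfolding \<psi>1_def using lb[of t] C'0 by (intro quot) (auto simp: indicator_def)
  have b2: "\<bar>\<psi>2 t\<bar> \<le> 1 / \<delta>" for t
    unfolding \<psi>2_def by (intro quot) (auto simp: indicator_def)
  have i1: "integrable P (\<lambda>x. \<psi>1 (F x))" "integrable \<nu> (\<lambda>z. \<psi>1 (G z))"
    using b1 by (auto intro!: integrable_bounded P.integrable_bounded)
  have i2: "integrable P (\<lambda>x. \<psi>2 (F x) * Y x)" "integrable \<nu> (\<lambda>z. \<psi>2 (G z) * z)"
    using Yb zb b2 gap(1) by (auto intro!: integrable_const_bound[where B="1 / \<delta> * C'"]
       P.integrable_const_bound[where B="1 / \<delta> * C'"] elim!: eventually_mono simp: abs_mult simp del: times_divide_eq_left intro!: mult_mono)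
  have "(\<integral>x. (indicator B (l (F x)) * (u (F x) - Y x) + indicator B (u (F x)) * (Y x - l (F x))) /
    (u (F x) - l (F x)) \<partial>P) = (\<integral>x. \<psi>1 (F x) + \<psi>2 (F x) * Y x \<partial>P)"
    by (simp only: \<psi>1_def \<psi>2_def endpoint_average_affine)
  also have "\<dots> = (\<integral>z. \<psi>1 (G z) + \<psi>2 (G z) * z \<partial>\<nu>)"
    using i1 i2 same(2)[OF \<psi>(1) b1] same(1)[OF \<psi>(2) b2] by simp
  also have "\<dots> = (\<integral>z. indicator B z \<partial>\<nu>)"
  proof (rule integral_cong_AE)
    show "AE z in \<nu>. \<psi>1 (G z) + \<psi>2 (G z) * z = indicator B z"
      using endpoint
    proof eventually_elim
      case (elim z)
      have "l (G z) < u (G z)"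
        using gap(1) gap(2)[of "G z"] by linarith
      then show ?case
        unfolding \<psi>1_def \<psi>2_def endpoint_average_affine[symmetric]
        by (rule endpoint_average_eq) (use elim in \<open>auto split: if_splits\<close>)
    qed
  qed measurable
  also have "\<dots> = measure \<nu> B"
    by simp
  finally show ?thesis .
qed

section \<open>Transport plans\<close>

text \<open>\<open>F\<close> is the cost factor extended continuously and boundedly to the whole
  plane, so no domain has to be tracked. Only comparisons at the support points are recorded: strict
  decrease in x on all three lines, and the order of the first two lines.\<close>

locale mot_data =
  fixes \<mu>X \<mu>Y \<mu>Z :: "real measure" and xl xu zml zmu zpl zpu \<gamma>0 \<gamma>1 :: real
    and y :: "nat \<Rightarrow> real" and F :: "real \<Rightarrow> real \<Rightarrow> real"
  assumes X: "prob_measure_on {xl..xu} \<mu>X" "nonatomic \<mu>X"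
    and Y: "prob_measure_on {y 0, y 1, y 2} \<mu>Y"
    and Z: "prob_measure_on ({zml..zmu} \<union> {zpl..zpu}) \<mu>Z" "nonatomic \<mu>Z"
    and bounds: "xl < xu" "zml \<le> zmu" "zmu < y 0" "y 0 < y 1" "y 1 < y 2" "y 2 < zpl" "zpl \<le> zpu"
    and means: "(\<integral>x. x \<partial>\<mu>X) = (\<integral>x. x \<partial>\<mu>Y)" "(\<integral>x. x \<partial>\<mu>Y) = (\<integral>x. x \<partial>\<mu>Z)"
    and F_cont: "continuous_on UNIV (\<lambda>(x, v). F x v)"
    and F_bounds: "\<And>x v. \<gamma>0 < F x v \<and> F x v < \<gamma>1"
    and F_dec: "\<And>i x x'. i \<le> 2 \<Longrightarrow> xl \<le> x \<Longrightarrow> x < x' \<Longrightarrow> x' \<le> xu \<Longrightarrow> F x' (y i) < F x (y i)"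
    and F_dec_y: "\<And>x. xl \<le> x \<Longrightarrow> x \<le> xu \<Longrightarrow> F x (y 1) < F x (y 0)"
begin

text \<open>Martingale plans with both conditional means in integral form, which constructed
  measures can be tested against directly.\<close>

definition plan :: "(real \<times> real \<times> real) measure \<Rightarrow> bool" where
  "plan \<pi> \<longleftrightarrow> prob_space \<pi> \<and> sets \<pi> = sets borel \<and>
    distr \<pi> borel fst = \<mu>X \<and> distr \<pi> borel (\<lambda>\<omega>. fst (snd \<omega>)) = \<mu>Y \<and> distr \<pi> borel (\<lambda>\<omega>. snd (snd \<omega>)) = \<mu>Z \<and>
    (\<forall>A\<in>sets borel. (\<integral>\<omega>. indicator A (fst \<omega>) * fst (snd \<omega>) \<partial>\<pi>) = (\<integral>\<omega>. indicator A (fst \<omega>) * fst \<omega> \<partial>\<pi>)) \<and>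
    (\<forall>A\<in>sets borel. (\<integral>\<omega>. indicator A (fst \<omega>, fst (snd \<omega>)) * snd (snd \<omega>) \<partial>\<pi>) =
      (\<integral>\<omega>. indicator A (fst \<omega>, fst (snd \<omega>)) * fst (snd \<omega>) \<partial>\<pi>))"

definition coupling :: "(real \<times> real) measure \<Rightarrow> bool" where
  "coupling P \<longleftrightarrow> prob_space P \<and> sets P = sets borel \<and> distr P borel fst = \<mu>X \<and> distr P borel snd = \<mu>Y \<and>
    (\<forall>A\<in>sets borel. (\<integral>\<omega>. indicator A (fst \<omega>) * snd \<omega> \<partial>P) = (\<integral>\<omega>. indicator A (fst \<omega>) * fst \<omega> \<partial>P))"

definition bnd :: real where
  "bnd = Max {\<bar>xl\<bar>, \<bar>xu\<bar>, \<bar>y 0\<bar>, \<bar>y 2\<bar>, \<bar>zml\<bar>, \<bar>zpu\<bar>}"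

lemma bnd:
  "x \<in> {xl..xu} \<Longrightarrow> \<bar>x\<bar> \<le> bnd" "x \<in> {y 0..y 2} \<Longrightarrow> \<bar>x\<bar> \<le> bnd" "x \<in> {zml..zpu} \<Longrightarrow> \<bar>x\<bar> \<le> bnd" "0 \<le> bnd"
proof -
  have *: "\<bar>t\<bar> \<le> bnd" if "t \<in> {xl, xu, y 0, y 2, zml, zpu}" for t
    unfolding bnd_def using that by (intro Max_ge) auto
  show "x \<in> {xl..xu} \<Longrightarrow> \<bar>x\<bar> \<le> bnd" "x \<in> {y 0..y 2} \<Longrightarrow> \<bar>x\<bar> \<le> bnd" "x \<in> {zml..zpu} \<Longrightarrow> \<bar>x\<bar> \<le> bnd" "0 \<le> bnd"
    using *[of xl] *[of xu] *[of "y 0"] *[of "y 2"] *[of zml] *[of zpu] by auto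
qed

text \<open>Integration formulas for constructed measures are available for bounded functions;
  truncation makes a coordinate bounded without changing it on the supports.\<close>

definition clip :: "real \<Rightarrow> real" where
  "clip v = max (- bnd) (min bnd v)"

lemma clip: "\<bar>v\<bar> \<le> bnd \<Longrightarrow> clip v = v" "\<bar>clip v\<bar> \<le> bnd"
  using bnd(4) by (auto simp: clip_def)

lemma measurable_clip [measurable]: "clip \<in> borel_measurable borel"
  unfolding clip_def[abs_def] by measurable

lemma borel_measurable_F [measurable (raw)]:
  assumes "f \<in> borel_measurable M" "g \<in> borel_measurable M"
  shows "(\<lambda>x. F (f x) (g x)) \<in> borel_measurable M"
proof -
  have "(\<lambda>(x, v). F x v) \<in> borel_measurable borel"
    using F_cont by (rule borel_measurable_continuous_onI)
  moreover have "(\<lambda>x. (f x, g x)) \<in> borel_measurable M"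
    using assms by (rule borel_measurable_Pair)
  ultimately have "(\<lambda>x. case (f x, g x) of (x, v) \<Rightarrow> F x v) \<in> borel_measurable M"
    by measurable
  then show ?thesis by simp
qed

lemma AE_marginals:
  shows "AE x in \<mu>X. x \<in> {xl..xu}" "AE x in \<mu>Y. x \<in> {y 0, y 1, y 2}" "AE x in \<mu>Z. x \<in> {zml..zmu} \<union> {zpl..zpu}"
    "AE x in \<mu>X. x \<noteq> c" "AE x in \<mu>Z. x \<noteq> c"
    and sets_marginals [simp, measurable_cong]: "sets \<mu>X = sets borel" "sets \<mu>Y = sets borel" "sets \<mu>Z = sets borel"
    and space_marginals [simp]: "space \<mu>X = UNIV" "space \<mu>Y = UNIV" "space \<mu>Z = UNIV"
    and prob_marginals: "prob_space \<mu>X" "prob_space \<mu>Y" "prob_space \<mu>Z"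
proof -
  show s: "sets \<mu>X = sets borel" "sets \<mu>Y = sets borel" "sets \<mu>Z = sets borel"
    and p: "prob_space \<mu>X" "prob_space \<mu>Y" "prob_space \<mu>Z"
    and "AE x in \<mu>X. x \<in> {xl..xu}" "AE x in \<mu>Y. x \<in> {y 0, y 1, y 2}" "AE x in \<mu>Z. x \<in> {zml..zmu} \<union> {zpl..zpu}"
    using X Y Z by (auto simp: prob_measure_on_def)
  show "space \<mu>X = UNIV" "space \<mu>Y = UNIV" "space \<mu>Z = UNIV"
    using sets_eq_imp_space_eq[OF s(1)] sets_eq_imp_space_eq[OF s(2)] sets_eq_imp_space_eq[OF s(3)] by auto
  have "AE x in \<mu>. x \<noteq> c" if "nonatomic \<mu>" "prob_space \<mu>" "sets \<mu> = sets borel" for \<mu> :: "real measure"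
  proof -
    interpret prob_space \<mu> by fact
    have "AE x in \<mu>. x \<notin> {c}"
      using that by (subst prob_eq_0[symmetric]) (auto simp: nonatomic_def)
    then show ?thesis by simp
  qed
  then show "AE x in \<mu>X. x \<noteq> c" "AE x in \<mu>Z. x \<noteq> c"
    using X Z s p by auto
qed

lemma AE_of_distr:
  assumes "distr M borel T = \<mu>" "T \<in> borel_measurable M" "AE x in \<mu>. x \<in> S" "S \<in> sets borel"
  shows "AE \<omega> in M. T \<omega> \<in> S"
proof -
  have "AE x in distr M borel T. x \<in> S"
    using assms(3) unfolding assms(1) .
  then show ?thesis
    using assms by (subst (asm) AE_distr_iff) auto
qed

lemma AE_of_distr_neq:
  fixes c :: real
  assumes "distr M borel T = \<mu>" "T \<in> borel_measurable M" "AE x in \<mu>. x \<noteq> c"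
  shows "AE \<omega> in M. T \<omega> \<noteq> c"
  using AE_of_distr[OF assms(1,2), of "- {c}"] assms(3) by simp

context
  fixes \<pi> :: "(real \<times> real \<times> real) measure"
  assumes prob: "prob_space \<pi>" and sets_\<pi>: "sets \<pi> = sets borel"
    and marg: "distr \<pi> borel fst = \<mu>X" "distr \<pi> borel (\<lambda>\<omega>. fst (snd \<omega>)) = \<mu>Y" "distr \<pi> borel (\<lambda>\<omega>. snd (snd \<omega>)) = \<mu>Z"
begin

lemma measurable_coordinates:
  "fst \<in> borel_measurable \<pi>" "(\<lambda>\<omega>. fst (snd \<omega>)) \<in> borel_measurable \<pi>" "(\<lambda>\<omega>. snd (snd \<omega>)) \<in> borel_measurable \<pi>"
  by (simp_all add: measurable_cong_sets[OF sets_\<pi> refl])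

lemma AE_coordinates:
  "AE \<omega> in \<pi>. fst \<omega> \<in> {xl..xu}" "AE \<omega> in \<pi>. fst (snd \<omega>) \<in> {y 0, y 1, y 2}"
  "AE \<omega> in \<pi>. snd (snd \<omega>) \<in> {zml..zmu} \<union> {zpl..zpu}"
  "AE \<omega> in \<pi>. fst \<omega> \<noteq> c" "AE \<omega> in \<pi>. snd (snd \<omega>) \<noteq> c"
  using AE_of_distr[OF marg(1) _ AE_marginals(1)] AE_of_distr[OF marg(2) _ AE_marginals(2)]
    AE_of_distr[OF marg(3) _ AE_marginals(3)] AE_of_distr_neq[OF marg(1) _ AE_marginals(4)]
    AE_of_distr_neq[OF marg(3) _ AE_marginals(5)] measurable_coordinates by auto

lemma AE_bounds:
  "AE \<omega> in \<pi>. \<bar>fst \<omega>\<bar> \<le> bnd" "AE \<omega> in \<pi>. \<bar>fst (snd \<omega>)\<bar> \<le> bnd" "AE \<omega> in \<pi>. \<bar>snd (snd \<omega>)\<bar> \<le> bnd"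
proof -
  show "AE \<omega> in \<pi>. \<bar>fst \<omega>\<bar> \<le> bnd"
    using AE_coordinates(1) by eventually_elim (rule bnd)
  show "AE \<omega> in \<pi>. \<bar>fst (snd \<omega>)\<bar> \<le> bnd"
    using AE_coordinates(2) by eventually_elim (rule bnd(2); use bounds in auto)
  show "AE \<omega> in \<pi>. \<bar>snd (snd \<omega>)\<bar> \<le> bnd"
    using AE_coordinates(3) by eventually_elim (rule bnd(3); use bounds in auto)
qed

lemma integrable_coordinates:
  "integrable \<pi> fst" "integrable \<pi> (\<lambda>\<omega>. fst (snd \<omega>))" "integrable \<pi> (\<lambda>\<omega>. snd (snd \<omega>))"
proof -
  interpret prob_space \<pi> by (rule prob)
  show "integrable \<pi> fst" "integrable \<pi> (\<lambda>\<omega>. fst (snd \<omega>))" "integrable \<pi> (\<lambda>\<omega>. snd (snd \<omega>))"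
    using AE_bounds measurable_coordinates by (auto intro!: integrable_const_bound[where B=bnd])
qed

lemma martingale_plans_iff_plan: "\<pi> \<in> martingale_plans \<mu>X \<mu>Y \<mu>Z \<longleftrightarrow> plan \<pi>"
proof -
  have e: "(\<lambda>(x, y, z). x) = (fst :: real \<times> real \<times> real \<Rightarrow> real)" "(\<lambda>(x, y, z). y) = (\<lambda>\<omega> :: real \<times> real \<times> real. fst (snd \<omega>))"
    "(\<lambda>(x, y, z). z) = (\<lambda>\<omega> :: real \<times> real \<times> real. snd (snd \<omega>))"
    "(\<lambda>(x, y, z). (x, y)) = (\<lambda>\<omega> :: real \<times> real \<times> real. (fst \<omega>, fst (snd \<omega>)))"
    by auto
  have 1: "(AE \<omega> in \<pi>. real_cond_exp \<pi> (vimage_algebra (space \<pi>) fst borel) (\<lambda>\<omega>. fst (snd \<omega>)) \<omega> = fst \<omega>) \<longleftrightarrow>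
    (\<forall>A\<in>sets borel. (\<integral>\<omega>. indicator A (fst \<omega>) * fst (snd \<omega>) \<partial>\<pi>) = (\<integral>\<omega>. indicator A (fst \<omega>) * fst \<omega> \<partial>\<pi>))"
    using real_cond_exp_eq_iff[OF prob measurable_coordinates(1), of "\<lambda>x. x" "\<lambda>\<omega>. fst (snd \<omega>)"] integrable_coordinates by simp
  have 2: "(AE \<omega> in \<pi>. real_cond_exp \<pi> (vimage_algebra (space \<pi>) (\<lambda>\<omega>. (fst \<omega>, fst (snd \<omega>))) borel) (\<lambda>\<omega>. snd (snd \<omega>)) \<omega> = fst (snd \<omega>)) \<longleftrightarrow>
    (\<forall>A\<in>sets borel. (\<integral>\<omega>. indicator A (fst \<omega>, fst (snd \<omega>)) * snd (snd \<omega>) \<partial>\<pi>) =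
      (\<integral>\<omega>. indicator A (fst \<omega>, fst (snd \<omega>)) * fst (snd \<omega>) \<partial>\<pi>))"
    using real_cond_exp_eq_iff[OF prob borel_measurable_Pair[OF measurable_coordinates(1,2)], of snd "\<lambda>\<omega>. snd (snd \<omega>)"]
      integrable_coordinates by simp
  show ?thesis
    using prob sets_\<pi> marg 1 2 unfolding martingale_plans_def plan_def e by (simp add: case_prod_beta)
qed

end

text \<open>Both notions contain the marginal conditions, and these bound the coordinates and so
  provide the integrability needed to compare the two forms of the martingale property.\<close>

lemma mem_martingale_plans: "\<pi> \<in> martingale_plans \<mu>X \<mu>Y \<mu>Z \<longleftrightarrow> plan \<pi>"
proof -
  have e: "(\<lambda>(x, y, z). x) = (fst :: real \<times> real \<times> real \<Rightarrow> real)" "(\<lambda>(x, y, z). y) = (\<lambda>\<omega> :: real \<times> real \<times> real. fst (snd \<omega>))"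
    "(\<lambda>(x, y, z). z) = (\<lambda>\<omega> :: real \<times> real \<times> real. snd (snd \<omega>))"
    by auto
  have "prob_space \<pi> \<and> sets \<pi> = sets borel \<and> distr \<pi> borel fst = \<mu>X \<and> distr \<pi> borel (\<lambda>\<omega>. fst (snd \<omega>)) = \<mu>Y \<and>
    distr \<pi> borel (\<lambda>\<omega>. snd (snd \<omega>)) = \<mu>Z"
    if "\<pi> \<in> martingale_plans \<mu>X \<mu>Y \<mu>Z \<or> plan \<pi>"
    using that unfolding martingale_plans_def plan_def e by auto
  then show ?thesis
    using martingale_plans_iff_plan by blast
qed

lemma plan_coupling:
  assumes "plan \<pi>"
  shows "coupling (distr \<pi> borel (\<lambda>\<omega>. (fst \<omega>, fst (snd \<omega>))))"
proof -
  interpret prob_space \<pi>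
    using assms by (simp add: plan_def)
  have [measurable_cong]: "sets \<pi> = sets borel"
    using assms by (simp add: plan_def)
  show ?thesis
    using assms by (simp add: plan_def coupling_def prob_space_distr distr_distr comp_def integral_distr)
qed

section \<open>Couplings of the first two marginals\<close>

definition cdfs :: "(real \<times> real) measure \<Rightarrow> nat \<Rightarrow> real \<Rightarrow> real" where
  "cdfs P i x = measure P {\<omega>. fst \<omega> \<le> x \<and> snd \<omega> = y i}"

text \<open>The distribution functions \<open>R i x = P (x' \<le> x, y' = y i)\<close> of the martingale couplings of \<open>\<mu>X\<close> and
  \<open>\<mu>Y\<close>. This set is convex and closed under pointwise convergence.\<close>

definition RR :: "(nat \<Rightarrow> real \<Rightarrow> real) set" where
  "RR = {R. (\<forall>i\<le>2. mono (R i) \<and> (\<forall>x\<le>xl. R i x = 0) \<and> (\<forall>x\<ge>xu. R i x = measure \<mu>Y {y i})) \<and>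
    (\<forall>x. (\<Sum>i\<le>2. R i x) = measure \<mu>X {..x}) \<and>
    (\<forall>x. (\<Sum>i\<le>2. y i * R i x) = (\<integral>t. indicator {..x} t * t \<partial>\<mu>X))}"

text \<open>A generalised inverse of \<open>F\<close> along the line \<open>y = y i\<close>: the
  right end of the initial segment on which \<open>F\<close> exceeds \<open>g\<close>. The inserted
  \<open>xl\<close> is the value for an empty segment.\<close>

definition cut :: "nat \<Rightarrow> real \<Rightarrow> real" where
  "cut i g = Sup (insert xl {x \<in> {xl..xu}. g < F x (y i)})"

lemma y_inj: "i \<le> 2 \<Longrightarrow> j \<le> 2 \<Longrightarrow> y i = y j \<longleftrightarrow> i = j"
  using bounds by (auto simp: le_Suc_eq numeral_2_eq_2)

context
  fixes P :: "(real \<times> real) measure"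
  assumes prob: "prob_space P" and sets_P: "sets P = sets borel"
    and marg: "distr P borel fst = \<mu>X" "distr P borel snd = \<mu>Y"
begin

lemma coupling_measurable: "fst \<in> borel_measurable P" "snd \<in> borel_measurable P"
  by (simp_all add: measurable_cong_sets[OF sets_P refl])

lemma coupling_AE:
  "AE \<omega> in P. fst \<omega> \<in> {xl..xu}" "AE \<omega> in P. snd \<omega> \<in> {y 0, y 1, y 2}" "AE \<omega> in P. fst \<omega> \<noteq> c"
  "AE \<omega> in P. \<bar>fst \<omega>\<bar> \<le> bnd" "AE \<omega> in P. \<bar>snd \<omega>\<bar> \<le> bnd"
proof -
  show 1: "AE \<omega> in P. fst \<omega> \<in> {xl..xu}" and 2: "AE \<omega> in P. snd \<omega> \<in> {y 0, y 1, y 2}" and "AE \<omega> in P. fst \<omega> \<noteq> c"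
    using AE_of_distr[OF marg(1) _ AE_marginals(1)] AE_of_distr[OF marg(2) _ AE_marginals(2)]
      AE_of_distr_neq[OF marg(1) _ AE_marginals(4)] coupling_measurable by auto
  show "AE \<omega> in P. \<bar>fst \<omega>\<bar> \<le> bnd"
    using 1 by eventually_elim (rule bnd)
  show "AE \<omega> in P. \<bar>snd \<omega>\<bar> \<le> bnd"
    using 2 by eventually_elim (rule bnd(2); use bounds in auto)
qed

end

lemma couplingD:
  assumes "coupling P"
  shows "prob_space P" "sets P = sets borel" "distr P borel fst = \<mu>X" "distr P borel snd = \<mu>Y"
    "A \<in> sets borel \<Longrightarrow> (\<integral>\<omega>. indicator A (fst \<omega>) * snd \<omega> \<partial>P) = (\<integral>\<omega>. indicator A (fst \<omega>) * fst \<omega> \<partial>P)"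
  using assms by (auto simp: coupling_def)

lemma coupling_space: "coupling P \<Longrightarrow> space P = UNIV"
  using sets_eq_imp_space_eq[of P borel] by (simp add: coupling_def)

text \<open>Almost every point lies on one of the three lines, so a plane integral is a sum over
  lines once the integrand is described there.\<close>

lemma coupling_sum:
  fixes k :: "real \<Rightarrow> real"
  assumes P: "coupling P" and A: "\<And>i. i \<le> 2 \<Longrightarrow> A i \<in> sets borel"
    and f: "AE \<omega> in P. f \<omega> = (\<Sum>i\<le>2. indicator {\<omega>. fst \<omega> \<in> A i \<and> snd \<omega> = y i} \<omega> * k (y i))" "f \<in> borel_measurable P"
  shows "(\<integral>\<omega>. f \<omega> \<partial>P) = (\<Sum>i\<le>2. k (y i) * measure P {\<omega>. fst \<omega> \<in> A i \<and> snd \<omega> = y i})"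
proof -
  interpret prob_space P
    using P by (rule couplingD)
  have [measurable_cong]: "sets P = sets borel"
    using P by (rule couplingD)
  have B [measurable]: "{\<omega>. fst \<omega> \<in> A i \<and> snd \<omega> = y i} \<in> sets P" if "i \<le> 2" for i
  proof -
    have [measurable]: "A i \<in> sets borel"
      using A that by simp
    have "{\<omega> \<in> space borel. fst \<omega> \<in> A i \<and> snd \<omega> = y i} \<in> sets borel"
      by measurable
    then show ?thesis
      by (simp add: couplingD(2)[OF P])
  qed
  have "(\<integral>\<omega>. f \<omega> \<partial>P) = (\<integral>\<omega>. (\<Sum>i\<le>2. indicator {\<omega>. fst \<omega> \<in> A i \<and> snd \<omega> = y i} \<omega> * k (y i)) \<partial>P)"
    by (intro integral_cong_AE f borel_measurable_sum borel_measurable_times borel_measurable_indicator B) auto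
  also have "\<dots> = (\<Sum>i\<le>2. (\<integral>\<omega>. indicator {\<omega>. fst \<omega> \<in> A i \<and> snd \<omega> = y i} \<omega> * k (y i) \<partial>P))"
    using B by (intro Bochner_Integration.integral_sum integrable_mult_left integrable_real_indicator) (auto simp: emeasure_eq_measure)
  also have "\<dots> = (\<Sum>i\<le>2. k (y i) * measure P {\<omega>. fst \<omega> \<in> A i \<and> snd \<omega> = y i})"
    using coupling_space[OF P] by (intro sum.cong refl) simp
  finally show ?thesis .
qed

lemma coupling_integral_fst:
  assumes P: "coupling P" and [measurable]: "\<phi> \<in> borel_measurable borel"
  shows "(\<integral>\<omega>. \<phi> (fst \<omega>) \<partial>P) = (\<integral>t. \<phi> t \<partial>\<mu>X :: real)"
proof -
  have [measurable]: "fst \<in> borel_measurable P"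
    using coupling_measurable(1) couplingD[OF P] by blast
  show ?thesis
    unfolding couplingD(3)[OF P, symmetric] by (simp add: integral_distr)
qed

lemma coupling_measure_snd:
  assumes P: "coupling P" and [measurable]: "A \<in> sets borel"
  shows "measure P {\<omega>. snd \<omega> \<in> A} = measure \<mu>Y A"
proof -
  have [measurable]: "snd \<in> borel_measurable P"
    using coupling_measurable(2) couplingD[OF P] by blast
  show ?thesis
    unfolding couplingD(4)[OF P, symmetric] using coupling_space[OF P]
    by (simp add: measure_distr vimage_def)
qed

text \<open>The two sum conditions are the first marginal and the martingale property tested on
  half-lines; the boundary values come from the support of \<open>\<mu>X\<close> and the second
  marginal.\<close>

lemma cdfs_in_RR:
  assumes P: "coupling P"
  shows "cdfs P \<in> RR"
proof -
  note D = couplingD[OF P]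
  interpret prob_space P by fact
  have [measurable_cong]: "sets P = sets borel" by fact
  have m [measurable]: "{\<omega>. fst \<omega> \<le> x \<and> snd \<omega> = y i} \<in> sets P" for x i
  proof -
    have "{\<omega> \<in> space borel. fst \<omega> \<le> x \<and> snd \<omega> = y i} \<in> sets borel"
      by measurable
    then show ?thesis
      by (simp add: D(2))
  qed
  note AE = coupling_AE[OF D(1-4)]
  have mono: "mono (cdfs P i)" for i
    unfolding cdfs_def by (intro monoI finite_measure_mono m) auto
  \<comment> \<open>The point \<open>xl\<close> itself is included because \<open>\<mu>X\<close> has
    no atom there.\<close>
  have low: "cdfs P i x = 0" if "x \<le> xl" for i x
  proof -
    have "AE \<omega> in P. \<omega> \<notin> {\<omega>. fst \<omega> \<le> x \<and> snd \<omega> = y i}"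
      using AE(1) AE(3)[of xl] by eventually_elim (use that in auto)
    then show ?thesis
      unfolding cdfs_def by (subst prob_eq_0) auto
  qed
  have high: "cdfs P i x = measure \<mu>Y {y i}" if "x \<ge> xu" for i x
  proof -
    have "measure P {\<omega>. fst \<omega> \<le> x \<and> snd \<omega> = y i} = measure P {\<omega>. snd \<omega> \<in> {y i}}"
    proof (rule measure_eq_AE)
      show "AE \<omega> in P. (\<omega> \<in> {\<omega>. fst \<omega> \<le> x \<and> snd \<omega> = y i}) = (\<omega> \<in> {\<omega>. snd \<omega> \<in> {y i}})"
        using AE(1) by eventually_elim (use that in auto)
      have "{\<omega> \<in> space borel. snd \<omega> \<in> {y i}} \<in> sets (borel :: (real \<times> real) measure)"
        by measurable
      then show "{\<omega>. snd \<omega> \<in> {y i}} \<in> sets P"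
        by (simp add: D(2))
    qed auto
    then show ?thesis
      unfolding cdfs_def using coupling_measure_snd[OF P, of "{y i}"] by simp
  qed
  have sum1: "(\<Sum>i\<le>2. cdfs P i x) = measure \<mu>X {..x}" for x
  proof -
    have "(\<integral>\<omega>. indicator {..x} (fst \<omega>) \<partial>P) = (\<Sum>i\<le>2. (\<lambda>_. 1) (y i) * measure P {\<omega>. fst \<omega> \<in> {..x} \<and> snd \<omega> = y i})"
    proof (rule coupling_sum[OF P])
      show "AE \<omega> in P. indicator {..x} (fst \<omega>) = (\<Sum>i\<le>2. indicator {\<omega>. fst \<omega> \<in> {..x} \<and> snd \<omega> = y i} \<omega> * (\<lambda>_. 1) (y i) :: real)"
        using AE(2) by eventually_elim (use bounds in \<open>auto simp: sum_atMost_2 indicator_def\<close>)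
    qed auto
    then show ?thesis
      by (simp add: cdfs_def coupling_integral_fst[OF P])
  qed
  have sum2: "(\<Sum>i\<le>2. y i * cdfs P i x) = (\<integral>t. indicator {..x} t * t \<partial>\<mu>X)" for x
  proof -
    have "(\<integral>\<omega>. indicator {..x} (fst \<omega>) * snd \<omega> \<partial>P) = (\<Sum>i\<le>2. (\<lambda>v. v) (y i) * measure P {\<omega>. fst \<omega> \<in> {..x} \<and> snd \<omega> = y i})"
    proof (rule coupling_sum[OF P])
      show "AE \<omega> in P. indicator {..x} (fst \<omega>) * snd \<omega> = (\<Sum>i\<le>2. indicator {\<omega>. fst \<omega> \<in> {..x} \<and> snd \<omega> = y i} \<omega> * (\<lambda>v. v) (y i) :: real)"
        using AE(2) by eventually_elim (use bounds in \<open>auto simp: sum_atMost_2 indicator_def\<close>)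
    qed auto
    then show ?thesis
      using D(5)[of "{..x}"] coupling_integral_fst[OF P, of "\<lambda>t. indicator {..x} t * t"] by (simp add: cdfs_def)
  qed
  show ?thesis
    using mono low high sum1 sum2 by (auto simp: RR_def)
qed

text \<open>A Borel set of the plane is met by the three lines in Borel sections, and on each line
  the half-lines determine the measure.\<close>

lemma cdfs_inject:
  assumes P: "coupling P" and P': "coupling P'" and eq: "\<And>i x. i \<le> 2 \<Longrightarrow> cdfs P i x = cdfs P' i x"
  shows "P = P'"
proof (rule measure_eqI)
  note D = couplingD[OF P] and D' = couplingD[OF P']
  interpret prob_space P by fact
  interpret P': prob_space P' by fact
  have [measurable_cong]: "sets P = sets borel" "sets P' = sets borel" by fact+
  show "sets P = sets P'"
    using D D' by simp
  fix A assume "A \<in> sets P"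
  then have A: "A \<in> sets borel"
    by (simp add: D(2))
  have sec: "{x. (x, v) \<in> A} \<in> sets borel" for v
  proof -
    have "(\<lambda>x. (x, v)) -` A \<inter> space borel \<in> sets (borel :: real measure)"
      using A by (intro measurable_sets[of _ borel borel] borel_measurable_Pair) auto
    then show ?thesis
      by (simp add: vimage_def)
  qed
  have split: "measure Q A = (\<Sum>i\<le>2. measure Q {\<omega>. fst \<omega> \<in> {x. (x, y i) \<in> A} \<and> snd \<omega> = y i})"
    if Q: "coupling Q" for Q
  proof -
    have "(\<integral>\<omega>. indicator A \<omega> \<partial>Q) = (\<Sum>i\<le>2. (\<lambda>_. 1) (y i) * measure Q {\<omega>. fst \<omega> \<in> {x. (x, y i) \<in> A} \<and> snd \<omega> = y i})"
    proof (rule coupling_sum[OF Q])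
      show "AE \<omega> in Q. indicator A \<omega> = (\<Sum>i\<le>2. indicator {\<omega>. fst \<omega> \<in> {x. (x, y i) \<in> A} \<and> snd \<omega> = y i} \<omega> * (\<lambda>_. 1) (y i) :: real)"
        using coupling_AE(2)[OF couplingD(1-4)[OF Q]]
        by eventually_elim (use bounds in \<open>auto simp: sum_atMost_2 indicator_def\<close>)
    qed (use A sec couplingD(2)[OF Q] in auto)
    then show ?thesis
      by (simp add: coupling_space[OF Q])
  qed
  have cond: "measure P {\<omega>. fst \<omega> \<in> S \<and> snd \<omega> = y i} = measure P' {\<omega>. fst \<omega> \<in> S \<and> snd \<omega> = y i}"
    if i: "i \<le> 2" and S [measurable]: "S \<in> sets borel" for S i
  proof -
    have int: "(\<integral>\<omega>. indicator S (fst \<omega>) * indicator {y i} (snd \<omega>) \<partial>Q) = measure Q {\<omega>. fst \<omega> \<in> S \<and> snd \<omega> = y i}"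
      if Q: "coupling Q" for Q and S :: "real set"
    proof -
      have "(\<lambda>\<omega>. indicator S (fst \<omega>) * indicator {y i} (snd \<omega>)) = (indicator {\<omega>. fst \<omega> \<in> S \<and> snd \<omega> = y i} :: real \<times> real \<Rightarrow> real)"
        by (auto simp: indicator_def)
      then show ?thesis
        by (simp add: coupling_space[OF Q])
    qed
    have half: "measure Q {\<omega>. fst \<omega> \<in> {g<..} \<and> snd \<omega> = y i} = measure \<mu>Y {y i} - cdfs Q i g" if Q: "coupling Q" for Q g
    proof -
      interpret Q: prob_space Q
        using Q by (rule couplingD)
      have s: "{\<omega> \<in> space borel. fst \<omega> \<le> g \<and> snd \<omega> = y i} \<in> sets (borel :: (real \<times> real) measure)"
        "{\<omega> \<in> space borel. g < fst \<omega> \<and> snd \<omega> = y i} \<in> sets (borel :: (real \<times> real) measure)"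
        by measurable
      have "{\<omega>. snd \<omega> \<in> {y i}} = {\<omega>. fst \<omega> \<in> {g<..} \<and> snd \<omega> = y i} \<union> {\<omega>. fst \<omega> \<le> g \<and> snd \<omega> = y i}"
        by auto
      then have "measure Q {\<omega>. snd \<omega> \<in> {y i}} = measure Q {\<omega>. fst \<omega> \<in> {g<..} \<and> snd \<omega> = y i} + cdfs Q i g"
        unfolding cdfs_def using s couplingD(2)[OF Q] by (simp add: Q.finite_measure_Union disjoint_iff)
      then show ?thesis
        using coupling_measure_snd[OF Q, of "{y i}"] by simp
    qed
    have "(\<integral>\<omega>. indicator S (fst \<omega>) * indicator {y i} (snd \<omega>) \<partial>P) = (\<integral>\<omega>. indicator S (fst \<omega>) * indicator {y i} (snd \<omega>) \<partial>P' :: real)"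
    proof (rule integral_eq_of_halflines(1)[OF finite_measure_axioms P'.finite_measure_axioms, where B=1 and C=1
          and \<phi>=fst and \<theta>=fst and \<psi>="indicator S" and h="\<lambda>\<omega>. indicator {y i} (snd \<omega>)" and k="\<lambda>\<omega>. indicator {y i} (snd \<omega>)"])
      fix g
      show "(\<integral>\<omega>. indicator {g<..} (fst \<omega>) \<partial>P) = (\<integral>\<omega>. indicator {g<..} (fst \<omega>) \<partial>P' :: real)"
        by (simp add: coupling_integral_fst P P')
      show "(\<integral>\<omega>. indicator {g<..} (fst \<omega>) * indicator {y i} (snd \<omega>) \<partial>P) = (\<integral>\<omega>. indicator {g<..} (fst \<omega>) * indicator {y i} (snd \<omega>) \<partial>P' :: real)"
        unfolding int[OF P] int[OF P'] half[OF P] half[OF P'] eq[OF i] ..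
    qed (auto simp: indicator_def)
    then show ?thesis
      by (simp add: int P P')
  qed
  have "measure P A = measure P' A"
    unfolding split[OF P] split[OF P'] by (intro sum.cong refl cond sec) auto
  then show "emeasure P A = emeasure P' A"
    by (simp add: emeasure_eq_measure P'.emeasure_eq_measure)
qed

section \<open>Superlevel sets of the cost factor on the three lines\<close>

lemma cut_bdd: "insert xl {x \<in> {xl..xu}. g < F x (y i)} \<noteq> {}" "bdd_above (insert xl {x \<in> {xl..xu}. g < F x (y i)})"
  using bounds by (auto intro!: bdd_aboveI[of _ xu])

text \<open>A supremum does not reveal whether it belongs to the set, and \<open>xl\<close> is a
  default value; both points are therefore excluded, at no cost for a measure without atoms.\<close>

lemma less_F_iff_cut:
  assumes i: "i \<le> 2" and x: "xl < x" "x \<le> xu" "x \<noteq> cut i g"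
  shows "g < F x (y i) \<longleftrightarrow> x \<le> cut i g"
proof
  assume "g < F x (y i)"
  then show "x \<le> cut i g"
    unfolding cut_def using x by (intro cSup_upper cut_bdd) auto
next
  assume "x \<le> cut i g"
  then have "x < cut i g"
    using x by simp
  then obtain x' where "x' \<in> insert xl {x \<in> {xl..xu}. g < F x (y i)}" "x < x'"
    unfolding cut_def less_cSup_iff[OF cut_bdd] by blast
  then show "g < F x (y i)"
    using F_dec[OF i, of x x'] x by auto
qed

text \<open>Decrease of \<open>F\<close> in x makes each superlevel set meet the lines in initial
  segments. The mass and the moment of a level thus become linear functions of the distribution
  functions, evaluated at the cuts.\<close>

lemma coupling_superlevel:
  fixes k :: "real \<Rightarrow> real"
  assumes P: "coupling P" and [measurable]: "k \<in> borel_measurable borel"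
  shows "(\<integral>\<omega>. indicator {g<..} (F (fst \<omega>) (snd \<omega>)) * k (snd \<omega>) \<partial>P) = (\<Sum>i\<le>2. k (y i) * cdfs P i (cut i g))"
proof -
  note D = couplingD[OF P]
  note AE = coupling_AE[OF D(1-4)]
  have [measurable_cong]: "sets P = sets borel" by fact
  have "(\<integral>\<omega>. indicator {g<..} (F (fst \<omega>) (snd \<omega>)) * k (snd \<omega>) \<partial>P) =
    (\<Sum>i\<le>2. k (y i) * measure P {\<omega>. fst \<omega> \<in> {..cut i g} \<and> snd \<omega> = y i})"
  proof (rule coupling_sum[OF P])
    show "AE \<omega> in P. indicator {g<..} (F (fst \<omega>) (snd \<omega>)) * k (snd \<omega>) =
      (\<Sum>i\<le>2. indicator {\<omega>. fst \<omega> \<in> {..cut i g} \<and> snd \<omega> = y i} \<omega> * k (y i) :: real)"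
      using AE(1,2) AE(3)[of xl] AE(3)[of "cut 0 g"] AE(3)[of "cut 1 g"] AE(3)[of "cut 2 g"]
    proof eventually_elim
      case (elim \<omega>)
      then have "xl < fst \<omega>" "fst \<omega> \<le> xu"
        by auto
      note * = less_F_iff_cut[OF _ this]
      show ?case
        using elim(2) *[of 0 g] *[of 1 g] *[of 2 g] elim(4-6) bounds
        by (auto simp: sum_atMost_2 indicator_def)
    qed
  qed auto
  then show ?thesis
    by (simp add: cdfs_def)
qed

text \<open>Strict monotonicity leaves at most one point of each level on each line, and
  \<open>\<mu>X\<close> does not charge a finite set.\<close>

lemma AE_F_neq:
  assumes P: "coupling P"
  shows "AE \<omega> in P. F (fst \<omega>) (snd \<omega>) \<noteq> g"
proof -
  define S where "S = (\<Union>i\<in>{..2}. {x \<in> {xl..xu}. F x (y i) = g})"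
  have "countable {x \<in> {xl..xu}. F x (y i) = g}" if "i \<le> 2" for i
  proof -
    have "x = x'" if "x \<in> {xl..xu}" "x' \<in> {xl..xu}" "F x (y i) = g" "F x' (y i) = g" for x x'
      using F_dec[OF \<open>i \<le> 2\<close>, of x x'] F_dec[OF \<open>i \<le> 2\<close>, of x' x] that by (cases x x' rule: linorder_cases) auto
    then have "{x \<in> {xl..xu}. F x (y i) = g} \<subseteq> {SOME x. x \<in> {xl..xu} \<and> F x (y i) = g}"
      by (auto intro: someI2)
    then show ?thesis
      by (rule countable_subset) simp
  qed
  then have "countable S"
    by (auto simp: S_def)
  note D = couplingD[OF P]
  interpret prob_space P by fact
  have "AE \<omega> in P. fst \<omega> \<notin> S"
    using coupling_AE(3)[OF D(1-4)] coupling_measurable[OF D(1-4)] \<open>countable S\<close>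
    by (intro AE_not_in_countable) auto
  then show ?thesis
    using coupling_AE(1,2)[OF D(1-4)]
  proof eventually_elim
    case (elim \<omega>)
    have "\<exists>i\<le>2. snd \<omega> = y i"
      using elim(3) by (elim insertE) (auto intro: exI[of _ "0::nat"] exI[of _ "1::nat"] exI[of _ "2::nat"])
    then obtain i where "i \<le> 2" "snd \<omega> = y i"
      by blast
    then show ?case
      using elim(1,2) by (auto simp: S_def)
  qed
qed

section \<open>Determination of a coupling by its level functions\<close>

lemma RRD:
  assumes "R \<in> RR"
  shows "i \<le> 2 \<Longrightarrow> mono (R i)" "i \<le> 2 \<Longrightarrow> x \<le> xl \<Longrightarrow> R i x = 0" "i \<le> 2 \<Longrightarrow> xu \<le> x \<Longrightarrow> R i x = measure \<mu>Y {y i}"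
    "(\<Sum>i\<le>2. R i x) = measure \<mu>X {..x}" "(\<Sum>i\<le>2. y i * R i x) = (\<integral>t. indicator {..x} t * t \<partial>\<mu>X)"
  using assms by (auto simp: RR_def)

text \<open>Vanishing mass and moment leave a one-dimensional space of vectors on three points,
  spanned by \<open>(y 2 - y 1, y 0 - y 2, y 1 - y 0)\<close>; one component determines the other
  two.\<close>

lemma kernel_of_constraints:
  assumes "d0 + d1 + d2 = 0" "y 0 * d0 + y 1 * d1 + y 2 * d2 = 0"
  shows "d0 * (y 2 - y 0) = - d1 * (y 2 - y 1)" "d2 * (y 2 - y 0) = - d1 * (y 1 - y 0)"
proof -
  have d2: "d2 = - d0 - d1"
    using assms(1) by simp
  show "d0 * (y 2 - y 0) = - d1 * (y 2 - y 1)"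
    using assms(2) unfolding d2 by (simp add: algebra_simps)
  have d0: "d0 = - d2 - d1"
    using assms(1) by simp
  show "d2 * (y 2 - y 0) = - d1 * (y 1 - y 0)"
    using assms(2) unfolding d0 by (simp add: algebra_simps)
qed

text \<open>The difference of two solutions is a multiple of a fixed vector, and equality of the level
  functions makes its first component \<open>d\<close> invariant under \<open>x \<mapsto> cut 1 (F x (y 0))\<close>. By \<open>F_dec_y\<close>, this
  map moves every point to the left, towards \<open>xl\<close>, where \<open>d\<close> vanishes.\<close>

lemma RR_eqI:
  assumes R: "R \<in> RR" and R': "R' \<in> RR"
    and mass: "\<And>g. \<gamma>0 < g \<Longrightarrow> g < \<gamma>1 \<Longrightarrow> (\<Sum>i\<le>2. R i (cut i g)) = (\<Sum>i\<le>2. R' i (cut i g))"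
    and moment: "\<And>g. \<gamma>0 < g \<Longrightarrow> g < \<gamma>1 \<Longrightarrow> (\<Sum>i\<le>2. y i * R i (cut i g)) = (\<Sum>i\<le>2. y i * R' i (cut i g))"
    and i: "i \<le> 2"
  shows "R i x = R' i x"
proof -
  define d where "d i x = R i x - R' i x" for i x
  have d_point: "d 0 x + d 1 x + d 2 x = 0" "y 0 * d 0 x + y 1 * d 1 x + y 2 * d 2 x = 0" for x
    using RRD(4,5)[OF R, of x] RRD(4,5)[OF R', of x] by (auto simp: d_def sum_atMost_2 algebra_simps)
  have d_level: "d 0 (cut 0 g) + d 1 (cut 1 g) + d 2 (cut 2 g) = 0"
    "y 0 * d 0 (cut 0 g) + y 1 * d 1 (cut 1 g) + y 2 * d 2 (cut 2 g) = 0" if "\<gamma>0 < g" "g < \<gamma>1" for g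
    using mass[OF that] moment[OF that] by (auto simp: d_def sum_atMost_2 algebra_simps)
  define c where "c x = cut 1 (F x (y 0))" for x
  \<comment> \<open>By strict decrease, the points of the line \<open>y 0\<close> above the level of
    \<open>x\<close> are those to the left of \<open>x\<close>.\<close>
  have cut0: "cut 0 (F x (y 0)) = x" if "xl \<le> x" "x \<le> xu" for x
  proof -
    have "insert xl {x' \<in> {xl..xu}. F x (y 0) < F x' (y 0)} = insert xl {xl..<x}"
      using F_dec[of 0] that by (auto simp: not_less[symmetric]) (metis less_asym linorder_neqE_linordered_idom order_le_less)+
    moreover have "Sup (insert xl {xl..<x}) = x"
      using that by (cases "xl = x") (auto simp: insert_absorb)
    ultimately show ?thesis
      by (simp add: cut_def)
  qed
  \<comment> \<open>The number \<open>d 1 (c x)\<close> occurs in two constraint systems: that of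
    the level \<open>F x (y 0)\<close>, whose cuts on the first two lines are \<open>x\<close> and
    \<open>c x\<close>, and that of the single point \<open>c x\<close>. Both express the component
    \<open>d 0\<close> by it with the same factor.\<close>
  have d_shift: "d 0 x = d 0 (c x)" if "xl \<le> x" "x \<le> xu" for x
  proof -
    have "d 0 x * (y 2 - y 0) = d 0 (c x) * (y 2 - y 0)"
      using kernel_of_constraints(1)[OF d_level[of "F x (y 0)"]] kernel_of_constraints(1)[OF d_point[of "c x"]]
        F_bounds[of x "y 0"] cut0[OF that] by (simp add: c_def)
    then show ?thesis
      using bounds by simp
  qed
  have c_le: "c x \<le> max xl t" if "xl \<le> x" "x \<le> xu" "\<And>x'. t < x' \<Longrightarrow> xl \<le> x' \<Longrightarrow> x' \<le> xu \<Longrightarrow> F x' (y 1) \<le> F x (y 0)" for x t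
    unfolding c_def cut_def using cut_bdd(1) that(3) by (intro cSup_least) (auto simp: not_less[symmetric] le_max_iff_disj not_le)
  have d_low: "d 0 x = 0" if "x \<le> xl" for x
    using RRD(2)[OF R _ that] RRD(2)[OF R' _ that] by (simp add: d_def)
  have d_high: "d 0 x = 0" if "xu \<le> x" for x
    using RRD(3)[OF R _ that] RRD(3)[OF R' _ that] by (simp add: d_def)
  \<comment> \<open>A continuation argument: \<open>s\<close> is the end of the largest initial
    segment on which \<open>d 0\<close> vanishes, and it is shown to be \<open>xu\<close>.\<close>
  define S where "S = {x \<in> {xl..xu}. \<forall>t\<in>{xl..x}. d 0 t = 0}"
  define s where "s = Sup S"
  have S: "xl \<in> S" "bdd_above S"
    using bounds d_low by (auto simp: S_def intro!: bdd_aboveI[of _ xu])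
  have s: "xl \<le> s" "s \<le> xu"
    using S unfolding s_def by (auto intro: cSup_upper) (auto intro!: cSup_least simp: S_def)
  have below: "d 0 t = 0" if "t < s" for t
  proof (cases "t \<le> xl")
    case False
    have "\<exists>x\<in>S. t < x"
      using that less_cSup_iff[of S t] S unfolding s_def by auto
    then obtain x where "x \<in> S" "t < x"
      by blast
    then show ?thesis
      using False by (auto simp: S_def)
  qed (rule d_low)
  \<comment> \<open>The strict inequality between the two lines at \<open>s\<close> persists
    slightly to the left on the line \<open>y 1\<close>, so \<open>c s\<close> lies strictly below
    \<open>s\<close> or at \<open>xl\<close>; vanishing is known in either case.\<close>
  have at_s: "d 0 s = 0"
  proof -
    have "eventually (\<lambda>t. F t (y 1) < F s (y 0)) (at s)"
      using continuous_on_fst_section[OF F_cont, where v="y 1" and x=s] F_dec_y[OF s]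
      unfolding isCont_def by (rule order_tendstoD(2))
    then obtain e where e: "e > 0" "\<And>t. t \<noteq> s \<Longrightarrow> dist t s < e \<Longrightarrow> F t (y 1) < F s (y 0)"
      by (auto simp: eventually_at)
    have "c s \<le> max xl (s - e)"
    proof (rule c_le[OF s])
      fix t assume t: "s - e < t" "xl \<le> t" "t \<le> xu"
      show "F t (y 1) \<le> F s (y 0)"
      proof (cases "t \<le> s")
        case True
        then show ?thesis
          using e(2)[of t] t F_dec_y[OF s] by (cases "t = s") (auto simp: dist_real_def)
      next
        case False
        then show ?thesis
          using F_dec[of 1 s t] F_dec_y[OF s] t s by simp
      qed
    qed
    then have "c s \<le> xl \<or> c s < s"
      using e(1) by auto
    then have "d 0 (c s) = 0"
      using below d_low by blast
    then show ?thesis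
      using d_shift[OF s] by simp
  qed
  \<comment> \<open>By continuity on the line \<open>y 0\<close>, the level of a point
    \<open>t\<close> slightly to the right of \<open>s\<close> still exceeds
    \<open>F s (y 1)\<close>. Hence \<open>c t\<close> does not pass \<open>s\<close>, and vanishing
    would extend beyond \<open>s\<close>.\<close>
  have "s = xu"
  proof (rule ccontr)
    assume "s \<noteq> xu"
    have "eventually (\<lambda>x. F s (y 1) < F x (y 0)) (at s)"
      using continuous_on_fst_section[OF F_cont, where v="y 0" and x=s] F_dec_y[OF s]
      unfolding isCont_def by (rule order_tendstoD(1))
    then obtain e where e: "e > 0" "\<And>x. x \<noteq> s \<Longrightarrow> dist x s < e \<Longrightarrow> F s (y 1) < F x (y 0)"
      by (auto simp: eventually_at)
    define s' where "s' = min xu (s + e / 2)"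
    have s': "s < s'" "s' \<le> xu" "s' < s + e"
      using \<open>s \<noteq> xu\<close> s e(1) by (auto simp: s'_def)
    have "d 0 t = 0" if t: "t \<in> {xl..s'}" for t
    proof (cases "t \<le> s")
      case True
      then show ?thesis
        using below at_s by (cases "t = s") auto
    next
      case False
      have "c t \<le> max xl s"
      proof (rule c_le)
        fix x' assume x': "s < x'" "xl \<le> x'" "x' \<le> xu"
        have "F x' (y 1) < F s (y 1)"
          using F_dec[of 1 s x'] x' s by simp
        also have "\<dots> < F t (y 0)"
          using e(2)[of t] False t s' by (auto simp: dist_real_def)
        finally show "F x' (y 1) \<le> F t (y 0)"
          by simp
      qed (use t s' in auto)
      then have "c t < s \<or> c t = s"
        using s by auto
      then have "d 0 (c t) = 0"
        using below at_s by auto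
      then show ?thesis
        using d_shift[of t] t s' by simp
    qed
    then have "s' \<in> S"
      using s s' by (auto simp: S_def)
    then have "s' \<le> s"
      unfolding s_def by (rule cSup_upper[OF _ S(2)])
    then show False
      using s' by simp
  qed
  then have d0: "d 0 x = 0" for x
    using below d_high by (cases "x < xu") auto
  have d1: "d 1 x = 0" for x
    using kernel_of_constraints(1)[OF d_point[of x]] d0 bounds by simp
  have d2: "d 2 x = 0" for x
    using kernel_of_constraints(2)[OF d_point[of x]] d1 bounds by simp
  have "i = 0 \<or> i = 1 \<or> i = 2"
    using i by auto
  then show ?thesis
    using d0[of x] d1[of x] d2[of x] by (auto simp: d_def)
qed

section \<open>Realisation and compactness of the admissible distribution functions\<close>

lemma isCont_cdf_X: "isCont (\<lambda>x. measure \<mu>X {..x}) x"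
proof -
  interpret prob_space \<mu>X by (rule prob_marginals)
  interpret finite_borel_measure \<mu>X
    by unfold_locales simp
  show ?thesis
    using isCont_cdf[of x] X(2) by (simp add: cdf_def[abs_def] nonatomic_def)
qed

text \<open>The increments of the components are nonnegative and add up to that of the distribution
  function of \<open>\<mu>X\<close>, which thereby serves as a common modulus of continuity.\<close>

lemma RR_increment:
  assumes R: "R \<in> RR" and i: "i \<le> 2" and ab: "a \<le> b"
  shows "0 \<le> R i b - R i a" "R i b - R i a \<le> measure \<mu>X {..b} - measure \<mu>X {..a}"
proof -
  have pos: "0 \<le> R j b - R j a" if "j \<le> 2" for j
    using monoD[OF RRD(1)[OF R that] ab] by simp
  then show "0 \<le> R i b - R i a"
    using i by simp
  have "R i b - R i a \<le> (\<Sum>j\<le>2. R j b - R j a)"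
    using pos i by (intro member_le_sum[of i "{..2}" "\<lambda>j. R j b - R j a"]) auto
  then show "R i b - R i a \<le> measure \<mu>X {..b} - measure \<mu>X {..a}"
    using RRD(4)[OF R] by (simp add: sum_subtractf)
qed

lemma RR_isCont:
  assumes "R \<in> RR" "i \<le> 2"
  shows "isCont (R i) x"
proof -
  have "((\<lambda>t. measure \<mu>X {..t} - measure \<mu>X {..x}) \<longlongrightarrow> measure \<mu>X {..x} - measure \<mu>X {..x}) (at x)"
    using isCont_cdf_X[of x] unfolding isCont_def by (intro tendsto_intros)
  then have "((\<lambda>t. \<bar>measure \<mu>X {..t} - measure \<mu>X {..x}\<bar>) \<longlongrightarrow> 0) (at x)"
    by (simp add: tendsto_rabs_zero)
  moreover have "norm (R i t - R i x) \<le> \<bar>measure \<mu>X {..t} - measure \<mu>X {..x}\<bar>" for t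
    using RR_increment[OF assms, of t x] RR_increment[OF assms, of x t] by (cases "t \<le> x") auto
  ultimately have "((\<lambda>t. R i t - R i x) \<longlongrightarrow> 0) (at x)"
    by (intro Lim_null_comparison[of "\<lambda>t. R i t - R i x"]) auto
  then show ?thesis
    unfolding isCont_def by (rule LIM_zero_cancel)
qed

text \<open>The measure with distribution function \<open>R i\<close> is placed on the line
  \<open>y = y i\<close> and the three are added. Mass and moment conditions on half-lines then
  yield the first marginal and the martingale property for all Borel sets.\<close>

lemma coupling_of_RR:
  assumes R: "R \<in> RR"
  obtains P where "coupling P" "\<And>i x. i \<le> 2 \<Longrightarrow> cdfs P i x = R i x"
proof -
  interpret \<mu>X: prob_space \<mu>X by (rule prob_marginals)
  interpret \<mu>Y: prob_space \<mu>Y by (rule prob_marginals)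
  define \<rho> where "\<rho> i = interval_measure (R i)" for i
  have [measurable_cong, simp]: "sets (\<rho> i) = sets borel" and [simp]: "space (\<rho> i) = UNIV" for i
    by (auto simp: \<rho>_def)
  have Ioc: "emeasure (\<rho> i) {s<..t} = ennreal (R i t - R i s)" if "i \<le> 2" "s \<le> t" for i s t
    unfolding \<rho>_def using that RR_isCont[OF R that(1)] RRD(1)[OF R that(1)]
    by (intro emeasure_interval_measure_Ioc) (auto simp: mono_def intro: continuous_at_imp_continuous_at_within)
  have atMost: "emeasure (\<rho> i) {..x} = ennreal (R i x)" if i: "i \<le> 2" for i x
  proof -
    have "(\<lambda>n. emeasure (\<rho> i) {x - real n<..x}) \<longlonglongrightarrow> emeasure (\<rho> i) (\<Union>n. {x - real n<..x})"
      by (intro Lim_emeasure_incseq) (auto simp: incseq_def)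
    moreover have "(\<Union>n. {x - real n<..x}) = {..x}"
    proof -
      have "\<exists>n. x - real n < t" for t
        using reals_Archimedean2[of "x - t"] by (auto simp: algebra_simps)
      then show ?thesis by auto
    qed
    moreover have "(\<lambda>n. emeasure (\<rho> i) {x - real n<..x}) \<longlonglongrightarrow> ennreal (R i x)"
    proof (rule tendsto_eventually)
      have "eventually (\<lambda>n. x - xl \<le> real n) sequentially"
        using eventually_ge_at_top[of "nat \<lceil>x - xl\<rceil>"] by eventually_elim linarith
      then show "eventually (\<lambda>n. emeasure (\<rho> i) {x - real n<..x} = ennreal (R i x)) sequentially"
      proof eventually_elim
        case (elim n)
        then have "R i (x - real n) = 0"
          by (intro RRD(2)[OF R i]) auto
        then show ?case
          by (simp add: Ioc[OF i])
      qed
    qed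
    ultimately show ?thesis
      using LIMSEQ_unique by fastforce
  qed
  have Rnn: "0 \<le> R i x" if "i \<le> 2" for i x
    using RR_increment(1)[OF R that, of "min x xl" x] RRD(2)[OF R that, of "min x xl"] by simp
  have total: "emeasure (\<rho> i) UNIV = ennreal (measure \<mu>Y {y i})" if i: "i \<le> 2" for i
  proof -
    have "(\<lambda>n. emeasure (\<rho> i) {..real n}) \<longlonglongrightarrow> emeasure (\<rho> i) (\<Union>n. {..real n})"
      by (intro Lim_emeasure_incseq) (auto simp: incseq_def)
    moreover have "(\<Union>n. {..real n}) = UNIV"
      using real_arch_simple by auto
    moreover have "(\<lambda>n. emeasure (\<rho> i) {..real n}) \<longlonglongrightarrow> ennreal (measure \<mu>Y {y i})"
    proof (rule tendsto_eventually)
      show "eventually (\<lambda>n. emeasure (\<rho> i) {..real n} = ennreal (measure \<mu>Y {y i})) sequentially"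
        using eventually_ge_at_top[of "nat \<lceil>xu\<rceil>"]
        by eventually_elim (subst atMost[OF i], subst RRD(3)[OF R i], linarith, rule refl)
    qed
    ultimately show ?thesis
      using LIMSEQ_unique by fastforce
  qed
  have fin: "finite_measure (\<rho> i)" if "i \<le> 2" for i
    by (rule finite_measureI) (simp add: total[OF that])
  define N where "N i = distr (\<rho> i) (borel :: (real \<times> real) measure) (\<lambda>x. (x, y i))" for i
  define P where "P = sum_measure {..2} N (borel :: (real \<times> real) measure)"
  have sN: "sets (N i) = sets borel" for i
    by (simp add: N_def)
  have fN: "finite_measure (N i)" if "i \<in> {..2}" for i
    using fin that unfolding N_def by (intro finite_measure.finite_measure_distr) auto
  have sP [measurable_cong]: "sets P = sets borel"
    by (simp add: P_def)
  have spP: "space P = UNIV"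
    by (simp add: P_def)
  interpret P: finite_measure P
    unfolding P_def by (intro finite_measure_sum_measure sN fN) auto
  have int: "(\<integral>\<omega>. \<phi> \<omega> \<partial>P) = (\<Sum>i\<le>2. (\<integral>x. \<phi> (x, y i) \<partial>\<rho> i))"
    if [measurable]: "\<phi> \<in> borel_measurable borel" and "\<And>\<omega>. \<bar>\<phi> \<omega>\<bar> \<le> B" for \<phi> :: "real \<times> real \<Rightarrow> real" and B
  proof -
    have "(\<integral>\<omega>. \<phi> \<omega> \<partial>P) = (\<Sum>i\<le>2. (\<integral>\<omega>. \<phi> \<omega> \<partial>N i))"
      unfolding P_def using that by (intro integral_sum_measure sN fN) auto
    also have "\<dots> = (\<Sum>i\<le>2. (\<integral>x. \<phi> (x, y i) \<partial>\<rho> i))"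
      by (intro sum.cong refl) (simp add: N_def integral_distr)
    finally show ?thesis .
  qed
  have mass: "measure P {\<omega>. fst \<omega> \<in> A \<and> snd \<omega> \<in> B} = (\<Sum>i\<le>2. indicator B (y i) * measure (\<rho> i) A)"
    if [measurable]: "A \<in> sets borel" "B \<in> sets borel" for A B :: "real set"
  proof -
    have [measurable]: "{\<omega> \<in> space borel. fst \<omega> \<in> A \<and> snd \<omega> \<in> B} \<in> sets (borel :: (real \<times> real) measure)"
      by measurable
    have "(\<integral>\<omega>. indicator {\<omega> \<in> space borel. fst \<omega> \<in> A \<and> snd \<omega> \<in> B} \<omega> \<partial>P) =
      (\<Sum>i\<le>2. (\<integral>x. indicator {\<omega> \<in> space borel. fst \<omega> \<in> A \<and> snd \<omega> \<in> B} (x, y i) \<partial>\<rho> i) :: real)"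
      by (rule int[of _ 1]) (auto simp: indicator_def)
    also have "\<dots> = (\<Sum>i\<le>2. (\<integral>x. indicator B (y i) * indicator A x \<partial>\<rho> i))"
      by (intro sum.cong refl Bochner_Integration.integral_cong) (auto simp: indicator_def)
    finally show ?thesis
      by (simp add: spP)
  qed
  have m\<rho>: "measure (\<rho> i) {..x} = R i x" "measure (\<rho> i) UNIV = measure \<mu>Y {y i}" if "i \<le> 2" for i x
    using atMost[OF that, of x] total[OF that] Rnn[OF that] by (simp_all add: measure_def)
  have sum_a: "(\<Sum>i\<le>2. measure \<mu>Y {y i}) = 1"
  proof -
    have "(\<Sum>i\<le>2. measure \<mu>Y {y i}) = measure \<mu>X {..xu}"
      using RRD(4)[OF R, of xu] RRD(3)[OF R, of _ xu] by simp
    also have "\<dots> = 1"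
      using AE_marginals(1) by (subst \<mu>X.prob_eq_1) (auto elim!: eventually_mono)
    finally show ?thesis .
  qed
  have "measure P UNIV = 1"
    using mass[of UNIV UNIV] sum_a m\<rho>(2) by simp
  then have prob: "prob_space P"
    by (intro prob_spaceI) (simp add: P.emeasure_eq_measure spP)
  interpret P: prob_space P by (rule prob)
  have dX: "distr P borel fst = \<mu>X"
  proof (rule cdf_unique)
    show "real_distribution (distr P borel fst)"
      by (intro P.real_distribution_distr) simp
    show "real_distribution \<mu>X"
      by unfold_locales simp_all
    show "cdf (distr P borel fst) = cdf \<mu>X"
    proof
      fix x
      have "measure P {\<omega>. fst \<omega> \<in> {..x} \<and> snd \<omega> \<in> UNIV} = measure \<mu>X {..x}"
        by (subst mass) (use RRD(4)[OF R, of x] m\<rho>(1) in auto)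
      then show "cdf (distr P borel fst) x = cdf \<mu>X x"
        by (simp add: cdf_def measure_distr spP vimage_def)
    qed
  qed
  have dY: "distr P borel snd = \<mu>Y"
  proof (rule measure_eqI)
    fix A assume "A \<in> sets (distr P borel snd)"
    then have A [measurable]: "A \<in> sets borel"
      by simp
    have "(\<integral>v. indicator A v \<partial>\<mu>Y) = (\<integral>v. indicator A (y 0) * indicator {y 0} v + indicator A (y 1) * indicator {y 1} v + indicator A (y 2) * indicator {y 2} v \<partial>\<mu>Y :: real)"
      using AE_marginals(2)
      by (intro integral_cong_AE) (use bounds in \<open>auto elim!: eventually_mono simp: indicator_def\<close>)
    also have "\<dots> = (\<Sum>i\<le>2. indicator A (y i) * measure \<mu>Y {y i})"
      by (simp add: sum_atMost_2 \<mu>Y.emeasure_eq_measure)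
    also have "\<dots> = measure P {\<omega>. fst \<omega> \<in> UNIV \<and> snd \<omega> \<in> A}"
      by (subst mass) (auto simp: m\<rho>(2))
    finally have "measure \<mu>Y A = measure P {\<omega>. snd \<omega> \<in> A}"
      by simp
    then show "emeasure (distr P borel snd) A = emeasure \<mu>Y A"
      by (simp add: emeasure_distr P.emeasure_eq_measure \<mu>Y.emeasure_eq_measure spP vimage_def)
  qed simp
  note AE = coupling_AE[OF prob sP dX dY]
  have mart: "(\<integral>\<omega>. indicator A (fst \<omega>) * snd \<omega> \<partial>P) = (\<integral>\<omega>. indicator A (fst \<omega>) * fst \<omega> \<partial>P)"
    if [measurable]: "A \<in> sets borel" for A
  proof (rule integral_eq_of_halflines(1)[OF P.finite_measure_axioms P.finite_measure_axioms, where B=bnd and C=1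
        and \<phi>=fst and \<theta>=fst and \<psi>="indicator A" and h=snd and k=fst])
    fix g :: real
    have "(\<integral>\<omega>. indicator {g<..} (fst \<omega>) * snd \<omega> \<partial>P) = (\<integral>\<omega>. indicator {g<..} (fst \<omega>) * clip (snd \<omega>) \<partial>P)"
      using AE(5) by (intro integral_cong_AE) (auto elim!: eventually_mono simp: clip)
    also have "\<dots> = (\<Sum>i\<le>2. (\<integral>x. indicator {g<..} x * clip (y i) \<partial>\<rho> i))"
      using clip(2) bnd(4) by (subst int[of _ bnd]) (auto simp: indicator_def)
    also have "\<dots> = (\<Sum>i\<le>2. y i * (measure \<mu>Y {y i} - R i g))"
    proof (rule sum.cong[OF refl])
      fix i :: nat assume "i \<in> {..2}"
      then have i: "i \<le> 2"
        by simp
      interpret \<rho>: finite_measure "\<rho> i"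
        using fin[OF i] .
      have "\<bar>y i\<bar> \<le> bnd"
      proof (rule bnd(2))
        have "i = 0 \<or> i = 1 \<or> i = 2"
          using i by auto
        then show "y i \<in> {y 0..y 2}"
          using bounds by auto
      qed
      moreover have "measure (\<rho> i) {g<..} = measure \<mu>Y {y i} - R i g"
        using \<rho>.finite_measure_Diff[of UNIV "{..g}"] m\<rho>(1)[OF i, of g] m\<rho>(2)[OF i] by (simp add: Compl_eq_Diff_UNIV[symmetric] Compl_atMost)
      ultimately show "(\<integral>x. indicator {g<..} x * clip (y i) \<partial>\<rho> i) = y i * (measure \<mu>Y {y i} - R i g)"
        by (simp add: clip)
    qed
    \<comment> \<open>The total masses are the values at \<open>xu\<close>, so the right half-line
      is handled by the difference of two moment conditions.\<close>
    also have "\<dots> = (\<Sum>i\<le>2. y i * R i xu) - (\<Sum>i\<le>2. y i * R i g)"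
      using RRD(3)[OF R, of _ xu] by (simp add: right_diff_distrib sum_subtractf)
    also have "\<dots> = (\<integral>t. indicator {..xu} t * t \<partial>\<mu>X) - (\<integral>t. indicator {..g} t * t \<partial>\<mu>X)"
      using RRD(5)[OF R] by simp
    also have "\<dots> = (\<integral>t. indicator {..xu} t * t - indicator {..g} t * t \<partial>\<mu>X)"
    proof -
      have "AE t in \<mu>X. \<bar>t\<bar> \<le> bnd"
        using AE_marginals(1) by eventually_elim (rule bnd)
      then have "integrable \<mu>X (\<lambda>t. indicator {..x} t * t)" for x
        by (intro \<mu>X.integrable_const_bound[where B=bnd]) (use bnd(4) in \<open>auto elim!: eventually_mono simp: indicator_def\<close>)
      then show ?thesis
        by simp
    qed
    also have "\<dots> = (\<integral>t. indicator {g<..} t * t \<partial>\<mu>X)"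
      by (intro integral_cong_AE eventually_mono[OF AE_marginals(1)]) (auto simp: indicator_def)
    also have "\<dots> = (\<integral>\<omega>. indicator {g<..} (fst \<omega>) * fst \<omega> \<partial>P)"
      unfolding dX[symmetric] by (simp add: integral_distr)
    finally show "(\<integral>\<omega>. indicator {g<..} (fst \<omega>) * snd \<omega> \<partial>P) = (\<integral>\<omega>. indicator {g<..} (fst \<omega>) * fst \<omega> \<partial>P)" .
  qed (use AE in \<open>auto simp: indicator_def\<close>)
  have cP: "coupling P"
    using prob sP dX dY mart by (auto simp: coupling_def)
  have "cdfs P j x = R j x" if j: "j \<le> 2" for j x
  proof -
    have "cdfs P j x = (\<Sum>i\<le>2. indicator {y j} (y i) * measure (\<rho> i) {..x})"
      unfolding cdfs_def using mass[of "{..x}" "{y j}"] by simp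
    also have "\<dots> = (\<Sum>i\<le>2. (if i = j then R i x else 0))"
      using y_inj j m\<rho>(1) by (intro sum.cong refl) (auto simp: indicator_def)
    also have "\<dots> = R j x"
      using j by simp
    finally show ?thesis .
  qed
  then show ?thesis
    using that cP by blast
qed

text \<open>Helly's theorem is applied to the middle component alone. The common modulus of
  continuity gives convergence at every point, and the two linear constraints carry it to the other
  components.\<close>

lemma RR_sequentially_compact:
  assumes R: "\<And>n. R n \<in> RR"
  obtains s R' where "strict_mono (s :: nat \<Rightarrow> nat)" "R' \<in> RR" "\<And>i x. i \<le> 2 \<Longrightarrow> (\<lambda>n. R (s n) i x) \<longlonglongrightarrow> R' i x"
proof -
  interpret \<mu>Y: prob_space \<mu>Y by (rule prob_marginals)
  let ?FX = "\<lambda>x. measure \<mu>X {..x}" and ?mX = "\<lambda>x. (\<integral>t. indicator {..x} t * t \<partial>\<mu>X)"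
  have bd: "\<bar>R n 1 x\<bar> \<le> 1" for n x
  proof -
    have "R n 1 (min x xl) \<le> R n 1 x" "R n 1 x \<le> R n 1 (max x xu)"
      by (intro monoD[OF RRD(1)[OF R]]; simp)+
    moreover have "R n 1 (min x xl) = 0" "R n 1 (max x xu) = measure \<mu>Y {y 1}"
      by (intro RRD(2,3)[OF R]; simp)+
    ultimately show ?thesis
      using \<mu>Y.prob_le_1[of "{y 1}"] by linarith
  qed
  obtain s G where s: "strict_mono s" and G: "mono G" "\<And>x. isCont G x \<Longrightarrow> (\<lambda>n. R (s n) 1 x) \<longlonglongrightarrow> G x"
    using Helly_selection[of "\<lambda>n. R n 1" 1] bd RR_isCont[OF R, of 1] RRD(1)[OF R, of 1]
    by (force intro: continuous_at_imp_continuous_at_within)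
  \<comment> \<open>Continuity points of the Helly limit are dense, so one lies close enough to
    \<open>x\<close> from the left for all members of the sequence to differ little between the two
    points; a Cauchy estimate follows.\<close>
  have conv1: "convergent (\<lambda>n. R (s n) 1 x)" for x
  proof (rule Cauchy_convergent, rule CauchyI)
    fix e :: real assume e: "0 < e"
    have "eventually (\<lambda>t. ?FX x - e / 3 < ?FX t) (at x)"
      using isCont_cdf_X[of x] e unfolding isCont_def by (intro order_tendstoD(1)) auto
    then obtain d where d: "d > 0" "\<And>t. t \<noteq> x \<Longrightarrow> dist t x < d \<Longrightarrow> ?FX x - e / 3 < ?FX t"
      by (auto simp: eventually_at)
    obtain a where a: "x - d < a" "a < x" "isCont G a"
      using open_minus_countable[OF mono_ctble_discont[OF G(1)], of "{x - d<..<x}"] d(1) by auto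
    have close: "\<bar>R (s n) 1 x - R (s n) 1 a\<bar> \<le> e / 3" for n
      using RR_increment[OF R, of 1 a x "s n"] d(2)[of a] a by (auto simp: dist_real_def)
    have "Cauchy (\<lambda>n. R (s n) 1 a)"
      using G(2)[OF a(3)] by (rule LIMSEQ_imp_Cauchy)
    then obtain n0 where n0: "\<And>m n. n0 \<le> m \<Longrightarrow> n0 \<le> n \<Longrightarrow> norm (R (s m) 1 a - R (s n) 1 a) < e / 3"
      using e CauchyD[of "\<lambda>n. R (s n) 1 a" "e / 3"] by auto
    have "norm (R (s m) 1 x - R (s n) 1 x) < e" if "n0 \<le> m" "n0 \<le> n" for m n
      using n0[OF that] close[of m] close[of n] unfolding real_norm_def by linarith
    then show "\<exists>M. \<forall>m\<ge>M. \<forall>n\<ge>M. norm (R (s m) 1 x - R (s n) 1 x) < e"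
      by blast
  qed
  \<comment> \<open>The mass and moment constraints solved for the outer components.\<close>
  have R0: "R n 0 x = (y 2 * ?FX x - ?mX x - (y 2 - y 1) * R n 1 x) / (y 2 - y 0)"
    and R2: "R n 2 x = (?mX x - y 0 * ?FX x - (y 1 - y 0) * R n 1 x) / (y 2 - y 0)" for n x
  proof -
    have y: "y 2 - y 0 \<noteq> 0"
      using bounds by auto
    show "R n 0 x = (y 2 * ?FX x - ?mX x - (y 2 - y 1) * R n 1 x) / (y 2 - y 0)"
      "R n 2 x = (?mX x - y 0 * ?FX x - (y 1 - y 0) * R n 1 x) / (y 2 - y 0)"
      unfolding RRD(4,5)[OF R, of n, symmetric] using y
      by (simp_all add: sum_atMost_2 eq_divide_eq algebra_simps)
  qed
  have conv: "convergent (\<lambda>n. R (s n) i x)" if "i \<le> 2" for i x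
  proof -
    have y: "y 2 - y 0 \<noteq> 0"
      using bounds by auto
    obtain L where L: "(\<lambda>n. R (s n) 1 x) \<longlonglongrightarrow> L"
      using conv1 by (auto simp: convergent_def)
    have "(\<lambda>n. R (s n) 0 x) \<longlonglongrightarrow> (y 2 * ?FX x - ?mX x - (y 2 - y 1) * L) / (y 2 - y 0)"
      unfolding R0 by (intro tendsto_intros L y)
    moreover have "(\<lambda>n. R (s n) 2 x) \<longlonglongrightarrow> (?mX x - y 0 * ?FX x - (y 1 - y 0) * L) / (y 2 - y 0)"
      unfolding R2 by (intro tendsto_intros L y)
    moreover have "i = 0 \<or> i = 1 \<or> i = 2"
      using that by auto
    ultimately show ?thesis
      using L by (auto simp: convergent_def)
  qed
  define R' where "R' i x = lim (\<lambda>n. R (s n) i x)" for i x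
  have lim: "(\<lambda>n. R (s n) i x) \<longlonglongrightarrow> R' i x" if "i \<le> 2" for i x
    using conv[OF that] by (simp add: R'_def convergent_LIMSEQ_iff)
  have "R' \<in> RR"
    unfolding RR_def
  proof (intro CollectI conjI allI impI)
    fix i :: nat and x assume i: "i \<le> 2"
    show "mono (R' i)"
    proof (rule monoI)
      fix a b :: real assume "a \<le> b"
      then show "R' i a \<le> R' i b"
        using monoD[OF RRD(1)[OF R i]] by (intro LIMSEQ_le[OF lim[OF i] lim[OF i]]) auto
    qed
    show "R' i x = 0" if "x \<le> xl"
      using lim[OF i, of x] RRD(2)[OF R i that] by (simp add: LIMSEQ_const_iff)
    show "R' i x = measure \<mu>Y {y i}" if "xu \<le> x"
      using lim[OF i, of x] RRD(3)[OF R i that] by (simp add: LIMSEQ_const_iff)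
  next
    fix x
    have "(\<lambda>n. \<Sum>i\<le>2. R (s n) i x) \<longlonglongrightarrow> (\<Sum>i\<le>2. R' i x)"
      by (intro tendsto_sum lim) auto
    then show "(\<Sum>i\<le>2. R' i x) = ?FX x"
      using RRD(4)[OF R] by (simp add: LIMSEQ_const_iff)
    have "(\<lambda>n. \<Sum>i\<le>2. y i * R (s n) i x) \<longlonglongrightarrow> (\<Sum>i\<le>2. y i * R' i x)"
      by (intro tendsto_sum tendsto_mult_left lim) auto
    then show "(\<Sum>i\<le>2. y i * R' i x) = ?mX x"
      using RRD(5)[OF R] by (simp add: LIMSEQ_const_iff)
  qed
  then show ?thesis
    using that s lim by blast
qed

section \<open>Extension of a coupling to a nested plan\<close>

definition xy :: "real \<times> real \<times> real \<Rightarrow> real \<times> real" where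
  "xy \<omega> = (fst \<omega>, fst (snd \<omega>))"

definition zc :: "real \<times> real \<times> real \<Rightarrow> real" where
  "zc \<omega> = snd (snd \<omega>)"

definition Fp :: "real \<times> real \<Rightarrow> real" where
  "Fp p = F (fst p) (snd p)"

lemma fst_xy [simp]: "fst (xy \<omega>) = fst \<omega>" and snd_xy [simp]: "snd (xy \<omega>) = fst (snd \<omega>)"
  by (simp_all add: xy_def)

lemma measurable_xy_zc_Fp [measurable]:
  "xy \<in> borel_measurable borel" "zc \<in> borel_measurable borel" "Fp \<in> borel_measurable borel"
  unfolding xy_def[abs_def] zc_def[abs_def] Fp_def[abs_def] by measurable

lemma Fp_bounds: "\<gamma>0 < Fp p" "Fp p < \<gamma>1"
  using F_bounds by (auto simp: Fp_def)

definition endpoints :: "(real \<Rightarrow> real) \<Rightarrow> (real \<Rightarrow> real) \<Rightarrow> bool" where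
  "endpoints l u \<longleftrightarrow> mono l \<and> antimono u \<and> (\<forall>g. zml \<le> l g \<and> l g \<le> zmu \<and> zpl \<le> u g \<and> u g \<le> zpu)"

lemma endpointsD:
  assumes "endpoints l u"
  shows "mono l" "antimono u" "zml \<le> l g" "l g \<le> zmu" "zpl \<le> u g" "u g \<le> zpu" "zpl - zmu \<le> u g - l g"
    "\<bar>l g\<bar> \<le> bnd" "\<bar>u g\<bar> \<le> bnd"
proof -
  show *: "mono l" "antimono u" "zml \<le> l g" "l g \<le> zmu" "zpl \<le> u g" "u g \<le> zpu"
    using assms by (auto simp: endpoints_def)
  then show "zpl - zmu \<le> u g - l g"
    by linarith
  show "\<bar>l g\<bar> \<le> bnd" "\<bar>u g\<bar> \<le> bnd"
    using * bounds by (auto intro!: bnd(3))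
qed

lemma gap_pos: "0 < zpl - zmu"
  using bounds by linarith

lemma endpoints_measurable:
  assumes "endpoints l u"
  shows "l \<in> borel_measurable borel" "u \<in> borel_measurable borel"
proof -
  show "l \<in> borel_measurable borel"
    using endpointsD(1)[OF assms] by (rule borel_measurable_mono)
  show "u \<in> borel_measurable borel"
    using endpointsD(2)[OF assms] by (rule borel_measurable_antimono)
qed

text \<open>Mass and moment tie the intervals to the coupling under \<open>\<pi>\<close>; the last
  clause is what makes the quadratic lower bound an equality at all levels simultaneously.\<close>

definition nested :: "(real \<times> real \<times> real) measure \<Rightarrow> (real \<Rightarrow> real) \<Rightarrow> (real \<Rightarrow> real) \<Rightarrow> bool" where
  "nested \<pi> l u \<longleftrightarrow> plan \<pi> \<and> endpoints l u \<and>
    (\<forall>g. measure \<mu>Z {l g<..<u g} = (\<integral>\<omega>. indicator {g<..} (Fp (xy \<omega>)) \<partial>\<pi>)) \<and>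
    (\<forall>g. (\<integral>z. indicator {l g<..<u g} z * z \<partial>\<mu>Z) = (\<integral>\<omega>. indicator {g<..} (Fp (xy \<omega>)) * fst (snd \<omega>) \<partial>\<pi>)) \<and>
    (AE \<omega> in \<pi>. zc \<omega> = l (Fp (xy \<omega>)) \<or> zc \<omega> = u (Fp (xy \<omega>)))"

lemma planD:
  assumes "plan \<pi>"
  shows "prob_space \<pi>" "sets \<pi> = sets borel" "distr \<pi> borel fst = \<mu>X" "distr \<pi> borel (\<lambda>\<omega>. fst (snd \<omega>)) = \<mu>Y"
    "distr \<pi> borel zc = \<mu>Z" "space \<pi> = UNIV" "coupling (distr \<pi> borel xy)"
  using assms plan_coupling[OF assms] sets_eq_imp_space_eq[of \<pi> borel]
  by (auto simp: plan_def zc_def[abs_def] xy_def[abs_def])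

lemma plan_AE:
  assumes "plan \<pi>"
  shows "AE \<omega> in \<pi>. fst \<omega> \<in> {xl..xu}" "AE \<omega> in \<pi>. fst (snd \<omega>) \<in> {y 0, y 1, y 2}"
    "AE \<omega> in \<pi>. zc \<omega> \<in> {zml..zmu} \<union> {zpl..zpu}" "AE \<omega> in \<pi>. fst \<omega> \<noteq> c" "AE \<omega> in \<pi>. zc \<omega> \<noteq> c"
    "AE \<omega> in \<pi>. \<bar>fst (snd \<omega>)\<bar> \<le> bnd" "AE \<omega> in \<pi>. \<bar>zc \<omega>\<bar> \<le> bnd"
  using AE_coordinates[of \<pi>] AE_bounds[of \<pi>] assms by (auto simp: plan_def zc_def)

lemma plan_integral_z:
  assumes P: "plan \<pi>" and [measurable]: "\<phi> \<in> borel_measurable borel"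
  shows "(\<integral>\<omega>. \<phi> (zc \<omega>) \<partial>\<pi>) = (\<integral>z. \<phi> z \<partial>\<mu>Z :: real)"
proof -
  have [measurable_cong]: "sets \<pi> = sets borel"
    using P by (rule planD)
  show ?thesis
    unfolding planD(5)[OF P, symmetric] by (simp add: integral_distr)
qed

lemma plan_integral_xy:
  assumes P: "plan \<pi>" and [measurable]: "\<phi> \<in> borel_measurable borel"
  shows "(\<integral>\<omega>. \<phi> (xy \<omega>) \<partial>\<pi>) = (\<integral>p. \<phi> p \<partial>distr \<pi> borel xy :: real)"
proof -
  have [measurable_cong]: "sets \<pi> = sets borel"
    using P by (rule planD)
  show ?thesis
    by (simp add: integral_distr)
qed

text \<open>Superlevel sets of \<open>\<psi>\<close> are Borel sets of the plane, so the martingale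
  condition gives the identity on half-lines of the values of \<open>\<psi>\<close>, and these
  suffice.\<close>

lemma plan_martingale:
  fixes \<psi> :: "real \<times> real \<Rightarrow> real"
  assumes P: "plan \<pi>" and \<psi> [measurable]: "\<psi> \<in> borel_measurable borel" and b: "\<And>p. \<bar>\<psi> p\<bar> \<le> b"
  shows "(\<integral>\<omega>. \<psi> (xy \<omega>) * zc \<omega> \<partial>\<pi>) = (\<integral>\<omega>. \<psi> (xy \<omega>) * fst (snd \<omega>) \<partial>\<pi>)"
proof -
  have [measurable_cong]: "sets \<pi> = sets borel"
    using P by (rule planD)
  interpret prob_space \<pi>
    using P by (rule planD)
  \<comment> \<open>The identity truncated to the range of \<open>\<psi>\<close>: the outer function
    in \<open>integral_eq_of_halflines\<close> has to be bounded everywhere.\<close>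
  define cl where "cl v = max (- b) (min b v)" for v :: real
  have [measurable]: "cl \<in> borel_measurable borel"
    unfolding cl_def[abs_def] by measurable
  have b0: "0 \<le> b"
    using b[of undefined] by linarith
  have cl: "cl (\<psi> p) = \<psi> p" for p
    using b[of p] by (auto simp: cl_def)
  have "(\<integral>\<omega>. cl (\<psi> (xy \<omega>)) * zc \<omega> \<partial>\<pi>) = (\<integral>\<omega>. cl (\<psi> (xy \<omega>)) * fst (snd \<omega>) \<partial>\<pi>)"
  proof (rule integral_eq_of_halflines(1)[OF finite_measure_axioms finite_measure_axioms, where B=bnd and C=b
      and \<phi>="\<lambda>\<omega>. \<psi> (xy \<omega>)" and \<theta>="\<lambda>\<omega>. \<psi> (xy \<omega>)" and \<psi>=cl and h=zc and k="\<lambda>\<omega>. fst (snd \<omega>)"])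
    show "\<bar>cl t\<bar> \<le> b" for t
      using b0 by (auto simp: cl_def)
    fix g
    have "{p \<in> space borel. g < \<psi> p} \<in> sets borel"
      by measurable
    then have "(\<integral>\<omega>. indicator {p. g < \<psi> p} (xy \<omega>) * zc \<omega> \<partial>\<pi>) = (\<integral>\<omega>. indicator {p. g < \<psi> p} (xy \<omega>) * fst (snd \<omega>) \<partial>\<pi>)"
      using P by (simp add: plan_def xy_def zc_def)
    then show "(\<integral>\<omega>. indicator {g<..} (\<psi> (xy \<omega>)) * zc \<omega> \<partial>\<pi>) = (\<integral>\<omega>. indicator {g<..} (\<psi> (xy \<omega>)) * fst (snd \<omega>) \<partial>\<pi>)"
      by (simp add: indicator_def)
  qed (use plan_AE[OF P] in auto)
  then show ?thesis
    by (simp add: cl)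
qed

text \<open>Given the intervals, the kernel from (x, y) to z has no freedom: the mean y fixes the
  weights of the two ends. That z then has law \<open>\<mu>Z\<close> is the content of
  \<open>endpoint_kernel_marginal\<close>.\<close>

lemma coupling_extends_to_nested:
  assumes P: "coupling P"
  obtains \<pi> l u where "nested \<pi> l u" "distr \<pi> borel xy = P"
proof -
  note D = couplingD[OF P]
  note AE = coupling_AE[OF D(1-4)]
  interpret prob_space P by fact
  have sP [measurable_cong]: "sets P = sets borel" by fact
  define M m :: "real \<Rightarrow> real" where "M g = (\<integral>p. indicator {g<..} (Fp p) \<partial>P)" and "m g = (\<integral>p. indicator {g<..} (Fp p) * snd p \<partial>P)" for g
  have mean: "(\<integral>p. snd p \<partial>P) = (\<integral>z. z \<partial>\<mu>Z)"
  proof -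
    have "(\<integral>p. snd p \<partial>P) = (\<integral>v. v \<partial>\<mu>Y)"
      unfolding D(4)[symmetric] by (simp add: integral_distr)
    then show ?thesis
      using means(2) by simp
  qed
  have iw: "integrable P (\<lambda>p. w p * snd p)" "integrable P w"
    if [measurable]: "w \<in> borel_measurable P" and w: "\<And>p. \<bar>w p\<bar> \<le> 1" for w
  proof -
    have "AE p in P. \<bar>w p * snd p\<bar> \<le> bnd"
      using AE(5)
    proof eventually_elim
      case (elim p)
      then show ?case
        using mult_mono[OF w[of p] elim] by (simp add: abs_mult)
    qed
    then show "integrable P (\<lambda>p. w p * snd p)"
      by (intro integrable_const_bound[where B=bnd]) auto
    show "integrable P w"
      using w by (intro integrable_bounded[where B=1]) auto
  qed
  \<comment> \<open>Since y lies between \<open>y 0\<close> and \<open>y 2\<close>, so does its mean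
    under any weight. Applied to the indicator of a superlevel set, its complement and the
    difference of two of them, this yields the three conditions for nested intervals.\<close>
  have wY: "y 0 * (\<integral>p. w p \<partial>P) \<le> (\<integral>p. w p * snd p \<partial>P) \<and> (\<integral>p. w p * snd p \<partial>P) \<le> y 2 * (\<integral>p. w p \<partial>P)"
    if [measurable]: "w \<in> borel_measurable P" and w: "\<And>p. 0 \<le> w p \<and> w p \<le> 1" for w
  proof -
    have "\<bar>w p\<bar> \<le> 1" for p
      using w[of p] by linarith
    note i = iw[OF that(1) this]
    have "(\<integral>p. y 0 * w p \<partial>P) \<le> (\<integral>p. w p * snd p \<partial>P)" "(\<integral>p. w p * snd p \<partial>P) \<le> (\<integral>p. y 2 * w p \<partial>P)"
      using AE(2) i
      by (intro integral_mono_AE; (auto elim!: eventually_mono)?; use w bounds in \<open>auto simp: mult.commute[of "w _"] intro!: mult_right_mono\<close>)+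
    then show ?thesis
      by simp
  qed
  have ind1: "(\<lambda>p. indicator {g<..} (Fp p) :: real) \<in> borel_measurable P" for g
    by measurable
  have M01: "0 \<le> M g \<and> M g \<le> 1" for g
  proof -
    have "(\<integral>p. indicator {g<..} (Fp p) \<partial>P) \<le> (\<integral>p. 1 \<partial>P :: real)"
      using iw(2)[OF ind1[of g]] by (intro integral_mono) (auto simp: indicator_def)
    then show ?thesis
      by (auto simp: M_def prob_space intro!: integral_nonneg_AE)
  qed
  have diff: "(\<integral>p. a p - b p \<partial>P) = (\<integral>p. a p \<partial>P) - (\<integral>p. b p \<partial>P)"
    "(\<integral>p. (a p - b p) * snd p \<partial>P) = (\<integral>p. a p * snd p \<partial>P) - (\<integral>p. b p * snd p \<partial>P)"
    if "a \<in> borel_measurable P" "b \<in> borel_measurable P" "\<And>p. \<bar>a p\<bar> \<le> 1" "\<And>p. \<bar>b p\<bar> \<le> 1" for a b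
    using iw[OF that(1,3)] iw[OF that(2,4)] by (simp_all add: left_diff_distrib)
  obtain l u where lu: "mono l" "antimono u" "\<And>g. zml \<le> l g \<and> l g \<le> zmu" "\<And>g. zpl \<le> u g \<and> u g \<le> zpu"
    and mass: "\<And>g. measure \<mu>Z {l g<..<u g} = M g" and moment: "\<And>g. (\<integral>z. indicator {l g<..<u g} z * z \<partial>\<mu>Z) = m g"
  proof (rule exists_nested_intervals[OF Z, of "y 0" "y 2" M m])
    show "y 0 * M g \<le> m g \<and> m g \<le> y 2 * M g" for g
      unfolding M_def m_def by (rule wY[OF ind1]) (simp add: indicator_def)
    show "y 0 * (1 - M g) \<le> (\<integral>z. z \<partial>\<mu>Z) - m g \<and> (\<integral>z. z \<partial>\<mu>Z) - m g \<le> y 2 * (1 - M g)" for g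
    proof -
      have "(\<integral>p. 1 - indicator {g<..} (Fp p) \<partial>P) = 1 - M g"
        "(\<integral>p. (1 - indicator {g<..} (Fp p)) * snd p \<partial>P) = (\<integral>z. z \<partial>\<mu>Z) - m g"
        using diff[of "\<lambda>_. 1" "\<lambda>p. indicator {g<..} (Fp p)"] ind1[of g] by (simp_all add: M_def m_def prob_space mean indicator_def)
      then show ?thesis
        using wY[of "\<lambda>p. 1 - indicator {g<..} (Fp p)"] ind1[of g] by (simp add: indicator_def)
    qed
    show "M g' \<le> M g \<and> y 0 * (M g - M g') \<le> m g - m g' \<and> m g - m g' \<le> y 2 * (M g - M g')" if "g \<le> g'" for g g'
    proof -
      let ?w = "\<lambda>p. indicator {g<..} (Fp p) - indicator {g'<..} (Fp p) :: real"
      have w: "0 \<le> ?w p \<and> ?w p \<le> 1" for p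
        using that by (auto simp: indicator_def)
      have "(\<integral>p. ?w p \<partial>P) = M g - M g'" "(\<integral>p. ?w p * snd p \<partial>P) = m g - m g'"
        using diff[OF ind1[of g] ind1[of g']] by (simp_all add: M_def m_def indicator_def)
      moreover have "0 \<le> (\<integral>p. ?w p \<partial>P)"
        using w by (intro integral_nonneg_AE) auto
      moreover have "?w \<in> borel_measurable P"
        using ind1 by (intro borel_measurable_diff)
      ultimately show ?thesis
        using wY[of ?w] w by simp
    qed
  qed (use bounds M01 in auto)
  have ep: "endpoints l u"
    using lu by (simp add: endpoints_def)
  have [measurable]: "l \<in> borel_measurable borel" "u \<in> borel_measurable borel"
    using endpoints_measurable[OF ep] by auto
  have gap: "0 < u g - l g" for g
    using endpointsD(7)[OF ep, of g] gap_pos by linarith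
  \<comment> \<open>The weight of the lower end for which the mean of z is \<open>snd p\<close>; it
    lies in [0, 1] because the support points are in the gap.\<close>
  define w where "w p = (u (Fp p) - snd p) / (u (Fp p) - l (Fp p))" for p
  define T0 T1 where "T0 p = (fst p, snd p, l (Fp p))" and "T1 p = (fst p, snd p, u (Fp p))" for p :: "real \<times> real"
  have w1: "1 - w p = (snd p - l (Fp p)) / (u (Fp p) - l (Fp p))" for p
    using gap[of "Fp p"] by (simp add: w_def field_simps)
  have w01: "AE p in P. 0 \<le> w p \<and> w p \<le> 1"
    using AE(2)
  proof eventually_elim
    case (elim p)
    then have "zmu \<le> snd p" "snd p \<le> zpl"
      using bounds by auto
    then have "l (Fp p) \<le> snd p" "snd p \<le> u (Fp p)"
      using endpointsD(4,5)[OF ep, of "Fp p"] by linarith+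
    then show ?case
      using gap[of "Fp p"] by (simp add: w_def)
  qed
  have [measurable]: "w \<in> borel_measurable P" "T0 \<in> measurable P borel" "T1 \<in> measurable P borel"
    unfolding w_def[abs_def] T0_def[abs_def] T1_def[abs_def] by measurable
  obtain \<pi> where \<pi>: "prob_space \<pi>" "sets \<pi> = sets (borel :: (real \<times> real \<times> real) measure)"
    and int': "\<And>\<phi> :: real \<times> real \<times> real \<Rightarrow> real. \<And>B. \<phi> \<in> borel_measurable borel \<Longrightarrow> (\<And>x. x \<in> space borel \<Longrightarrow> \<bar>\<phi> x\<bar> \<le> B) \<Longrightarrow>
      (\<integral>x. \<phi> x \<partial>\<pi>) = (\<integral>x. w x * \<phi> (T0 x) + (1 - w x) * \<phi> (T1 x) \<partial>P)"
    by (rule exists_two_point_mixture[OF prob_space_axioms _ _ _ w01, of T0 borel T1]) auto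
  have int: "(\<integral>x. \<phi> x \<partial>\<pi>) = (\<integral>x. w x * \<phi> (T0 x) + (1 - w x) * \<phi> (T1 x) \<partial>P)"
    if "\<phi> \<in> borel_measurable borel" "\<And>x. \<bar>\<phi> x\<bar> \<le> B" for \<phi> :: "real \<times> real \<times> real \<Rightarrow> real" and B
    using int'[OF that(1), of B] that(2) by simp
  have T [simp]: "xy (T0 p) = p" "xy (T1 p) = p" "zc (T0 p) = l (Fp p)" "zc (T1 p) = u (Fp p)" for p
    by (simp_all add: T0_def T1_def xy_def zc_def)
  interpret \<pi>: prob_space \<pi> by fact
  have [measurable_cong]: "sets \<pi> = sets borel" by fact
  have sp\<pi>: "space \<pi> = UNIV"
    using sets_eq_imp_space_eq[OF \<pi>(2)] by simp
  have spP: "space P = UNIV"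
    using sets_eq_imp_space_eq[OF sP] by simp
  have dxy: "distr \<pi> borel xy = P"
  proof (rule measure_eqI)
    fix A assume "A \<in> sets (distr \<pi> borel xy)"
    then have A [measurable]: "A \<in> sets borel"
      by simp
    have "(\<integral>\<omega>. indicator A (xy \<omega>) \<partial>\<pi>) = (\<integral>p. w p * indicator A p + (1 - w p) * indicator A p \<partial>P :: real)"
      by (subst int[of _ 1]) (auto simp: indicator_def)
    also have "\<dots> = (\<integral>p. indicator A p \<partial>P)"
      by (intro Bochner_Integration.integral_cong) (auto simp: algebra_simps)
    finally have "(\<integral>\<omega>. indicator (xy -` A) \<omega> \<partial>\<pi>) = measure P A"
      unfolding indicator_vimage by (simp add: spP)
    then show "emeasure (distr \<pi> borel xy) A = emeasure P A"
      by (simp add: emeasure_distr \<pi>.emeasure_eq_measure emeasure_eq_measure sp\<pi>)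
  qed (simp add: sP)
  have dz: "distr \<pi> borel zc = \<mu>Z"
  proof (rule measure_eqI)
    fix A assume "A \<in> sets (distr \<pi> borel zc)"
    then have A [measurable]: "A \<in> sets borel"
      by simp
    interpret \<mu>Z: prob_space \<mu>Z by (rule prob_marginals)
    have "(\<integral>\<omega>. indicator A (zc \<omega>) \<partial>\<pi>) = (\<integral>p. w p * indicator A (l (Fp p)) + (1 - w p) * indicator A (u (Fp p)) \<partial>P :: real)"
      by (subst int[of _ 1]) (auto simp: indicator_def)
    also have "\<dots> = (\<integral>p. (indicator A (l (Fp p)) * (u (Fp p) - snd p) + indicator A (u (Fp p)) * (snd p - l (Fp p))) /
        (u (Fp p) - l (Fp p)) \<partial>P)"
      unfolding w1 by (intro Bochner_Integration.integral_cong refl) (simp add: w_def add_divide_distrib mult.commute)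
    also have "\<dots> = measure \<mu>Z A"
    proof (rule endpoint_kernel_marginal[OF prob_space_axioms _ _ Z(1) _ _ AE(5) mean lu])
      show "\<gamma>0 < Fp p \<and> Fp p < \<gamma>1" for p
        using Fp_bounds by simp
      show "AE p in P. Fp p \<noteq> g" for g
        using AE_F_neq[OF P] by (simp add: Fp_def)
      show "measure \<mu>Z {l g<..<u g} = (\<integral>p. indicator {g<..} (Fp p) \<partial>P)" for g
        using mass by (simp add: M_def)
      show "(\<integral>z. indicator {l g<..<u g} z * z \<partial>\<mu>Z) = (\<integral>p. indicator {g<..} (Fp p) * snd p \<partial>P)" for g
        using moment by (simp add: m_def)
    qed (use bounds in auto)
    finally have "(\<integral>\<omega>. indicator (zc -` A) \<omega> \<partial>\<pi>) = measure \<mu>Z A"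
      unfolding indicator_vimage .
    then show "emeasure (distr \<pi> borel zc) A = emeasure \<mu>Z A"
      by (simp add: emeasure_distr \<pi>.emeasure_eq_measure \<mu>Z.emeasure_eq_measure sp\<pi>)
  qed simp
  have "distr (distr \<pi> borel xy) borel fst = distr \<pi> borel fst" "distr (distr \<pi> borel xy) borel snd = distr \<pi> borel (\<lambda>\<omega>. fst (snd \<omega>))"
    by (simp_all add: distr_distr comp_def)
  then have dx: "distr \<pi> borel fst = \<mu>X" and dy: "distr \<pi> borel (\<lambda>\<omega>. fst (snd \<omega>)) = \<mu>Y"
    using D(3,4) dxy by simp_all
  have int_xy: "(\<integral>\<omega>. \<phi> (xy \<omega>) \<partial>\<pi>) = (\<integral>p. \<phi> p \<partial>P)" if [measurable]: "\<phi> \<in> borel_measurable borel" for \<phi> :: "real \<times> real \<Rightarrow> real"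
    unfolding dxy[symmetric] by (simp add: integral_distr)
  have zb: "AE \<omega> in \<pi>. \<bar>zc \<omega>\<bar> \<le> bnd"
    using AE_bounds(3)[OF \<pi> dx dy] dz by (simp add: zc_def[abs_def])
  have mart1: "(\<integral>\<omega>. indicator A (fst \<omega>) * fst (snd \<omega>) \<partial>\<pi>) = (\<integral>\<omega>. indicator A (fst \<omega>) * fst \<omega> \<partial>\<pi>)" if [measurable]: "A \<in> sets borel" for A
    using int_xy[of "\<lambda>p. indicator A (fst p) * snd p"] int_xy[of "\<lambda>p. indicator A (fst p) * fst p"] D(5)[OF that] by simp
  have mart2: "(\<integral>\<omega>. indicator A (xy \<omega>) * zc \<omega> \<partial>\<pi>) = (\<integral>\<omega>. indicator A (xy \<omega>) * fst (snd \<omega>) \<partial>\<pi>)" if [measurable]: "A \<in> sets borel" for A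
  proof -
    have "(\<integral>\<omega>. indicator A (xy \<omega>) * zc \<omega> \<partial>\<pi>) = (\<integral>\<omega>. indicator A (xy \<omega>) * clip (zc \<omega>) \<partial>\<pi>)"
      using zb by (intro integral_cong_AE) (auto elim!: eventually_mono simp: clip)
    also have "\<dots> = (\<integral>p. w p * (indicator A p * l (Fp p)) + (1 - w p) * (indicator A p * u (Fp p)) \<partial>P)"
      using clip(2) bnd(4) endpointsD(8,9)[OF ep] by (subst int[of _ bnd]) (auto simp: clip indicator_def)
    also have "\<dots> = (\<integral>p. indicator A p * snd p \<partial>P)"
    proof (intro Bochner_Integration.integral_cong refl)
      fix p
      have "w p * l (Fp p) + (1 - w p) * u (Fp p) = u (Fp p) - w p * (u (Fp p) - l (Fp p))"
        by (simp add: algebra_simps)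
      also have "\<dots> = snd p"
        using gap[of "Fp p"] by (simp add: w_def)
      finally show "w p * (indicator A p * l (Fp p)) + (1 - w p) * (indicator A p * u (Fp p)) = indicator A p * snd p"
        by (auto simp: indicator_def)
    qed
    also have "\<dots> = (\<integral>\<omega>. indicator A (xy \<omega>) * fst (snd \<omega>) \<partial>\<pi>)"
      using int_xy[of "\<lambda>p. indicator A p * snd p"] by simp
    finally show ?thesis .
  qed
  have plan: "plan \<pi>"
    using \<pi> dx dy dz mart1 mart2 by (simp add: plan_def zc_def[abs_def] xy_def)
  have end_AE: "AE \<omega> in \<pi>. zc \<omega> = l (Fp (xy \<omega>)) \<or> zc \<omega> = u (Fp (xy \<omega>))"
  proof -
    define E where "E = {\<omega> \<in> space borel. zc \<omega> \<noteq> l (Fp (xy \<omega>)) \<and> zc \<omega> \<noteq> u (Fp (xy \<omega>))}"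
    have E [measurable]: "E \<in> sets borel"
      unfolding E_def by measurable
    have "(\<integral>\<omega>. indicator E \<omega> \<partial>\<pi>) = (\<integral>p. w p * indicator E (T0 p) + (1 - w p) * indicator E (T1 p) \<partial>P :: real)"
      by (rule int[of _ 1]) (auto simp: indicator_def)
    also have "\<dots> = 0"
      by (simp add: E_def indicator_def)
    finally have "measure \<pi> E = 0"
      by (simp add: sp\<pi>)
    then have "AE \<omega> in \<pi>. \<omega> \<notin> E"
      by (subst \<pi>.prob_eq_0[symmetric]) auto
    then show ?thesis
      by (auto elim!: eventually_mono simp: E_def)
  qed
  have "nested \<pi> l u"
    unfolding nested_def using plan ep mass moment end_AE
      int_xy[of "\<lambda>p. indicator {_<..} (Fp p)"] int_xy[of "\<lambda>p. indicator {_<..} (Fp p) * snd p"]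
    by (simp add: M_def m_def)
  then show ?thesis
    using that dxy by blast
qed

section \<open>Level costs and existence of a minimizer\<close>

definition level_mass :: "(real \<times> real \<times> real) measure \<Rightarrow> real \<Rightarrow> real" where
  "level_mass \<pi> g = (\<integral>\<omega>. indicator {g<..} (Fp (xy \<omega>)) \<partial>\<pi>)"

definition level_moment :: "(real \<times> real \<times> real) measure \<Rightarrow> real \<Rightarrow> real" where
  "level_moment \<pi> g = (\<integral>\<omega>. indicator {g<..} (Fp (xy \<omega>)) * fst (snd \<omega>) \<partial>\<pi>)"

definition level_cost :: "(real \<times> real \<times> real) measure \<Rightarrow> real \<Rightarrow> real" where
  "level_cost \<pi> g = (\<integral>\<omega>. indicator {g<..} (Fp (xy \<omega>)) * (zc \<omega>)\<^sup>2 \<partial>\<pi>)"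

text \<open>At levels up to \<open>\<gamma>0\<close> the level cost is the full second moment of
  \<open>\<mu>Z\<close>, and from \<open>\<gamma>1\<close> on it is zero; only the range between
  depends on the plan.\<close>

definition total_cost :: "(real \<times> real \<times> real) measure \<Rightarrow> real" where
  "total_cost \<pi> = (\<integral>g. indicator {\<gamma>0..<\<gamma>1} g * level_cost \<pi> g \<partial>lborel)"

text \<open>A lower bound for the level cost that is affine in the coupling of \<open>\<mu>X\<close> and \<open>\<mu>Y\<close>.\<close>

definition dual_bound :: "(real \<Rightarrow> real) \<Rightarrow> (real \<Rightarrow> real) \<Rightarrow> (real \<times> real \<times> real) measure \<Rightarrow> real \<Rightarrow> real" where
  "dual_bound l u \<pi> g = (\<integral>z. indicator {l g<..<u g} z * ((z - l g) * (z - u g)) \<partial>\<mu>Z) +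
    (l g + u g) * level_moment \<pi> g - l g * u g * level_mass \<pi> g"

text \<open>The integrand of the difference between the level cost and its dual bound.\<close>

definition slack :: "(real \<Rightarrow> real) \<Rightarrow> (real \<Rightarrow> real) \<Rightarrow> real \<Rightarrow> real \<times> real \<times> real \<Rightarrow> real" where
  "slack l u g \<omega> = (indicator {g<..} (Fp (xy \<omega>)) - indicator {l g<..<u g} (zc \<omega>)) * ((zc \<omega> - l g) * (zc \<omega> - u g))"

text \<open>Outside the interval the quadratic is nonnegative and only the first indicator can be 1;
  inside it is nonpositive and the second indicator is 1.\<close>

lemma slack_nonneg:
  assumes "endpoints l u"
  shows "0 \<le> slack l u g \<omega>"
proof -
  have "l g < u g"
    using endpointsD(7)[OF assms, of g] gap_pos by linarith
  then have "zc \<omega> \<le> l g \<or> u g \<le> zc \<omega> \<Longrightarrow> 0 \<le> (zc \<omega> - l g) * (zc \<omega> - u g)"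
    by (auto intro: mult_nonneg_nonneg mult_nonpos_nonpos)
  moreover have "l g < zc \<omega> \<and> zc \<omega> < u g \<Longrightarrow> (zc \<omega> - l g) * (zc \<omega> - u g) \<le> 0"
    by (auto intro: mult_nonneg_nonpos)
  ultimately show ?thesis
    by (auto simp: slack_def indicator_def not_less)
qed

lemma plan_integrable:
  assumes P: "plan \<pi>" and [measurable]: "\<phi> \<in> borel_measurable borel"
    and b: "\<And>\<omega>. \<bar>fst (snd \<omega>)\<bar> \<le> bnd \<Longrightarrow> \<bar>zc \<omega>\<bar> \<le> bnd \<Longrightarrow> \<bar>\<phi> \<omega>\<bar> \<le> (B::real)"
  shows "integrable \<pi> \<phi>"
proof -
  interpret prob_space \<pi>
    using P by (rule planD)
  have [measurable_cong]: "sets \<pi> = sets borel"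
    using P by (rule planD)
  have "AE \<omega> in \<pi>. \<bar>\<phi> \<omega>\<bar> \<le> B"
    using plan_AE(6,7)[OF P] by eventually_elim (rule b)
  then show ?thesis
    by (intro integrable_const_bound[where B=B]) auto
qed

lemma sq_bnd: "\<bar>v\<bar> \<le> bnd \<Longrightarrow> v\<^sup>2 \<le> bnd\<^sup>2"
  by (metis abs_ge_zero power2_abs power_mono)

text \<open>On the superlevel set, the square of z is the quadratic plus
  \<open>(l g + u g) * z - l g * u g\<close>. The martingale condition turns the linear term into
  the moment of y, and the quadratic over the interval itself depends only on
  \<open>\<mu>Z\<close>.\<close>

lemma level_cost_eq:
  assumes P: "plan \<pi>" and lu: "endpoints l u"
  shows "level_cost \<pi> g = dual_bound l u \<pi> g + (\<integral>\<omega>. slack l u g \<omega> \<partial>\<pi>)" and "integrable \<pi> (slack l u g)"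
proof -
  let ?I = "\<lambda>\<omega>. indicator {g<..} (Fp (xy \<omega>)) :: real" and ?h = "\<lambda>z. (z - l g) * (z - u g)"
  have i1: "integrable \<pi> (\<lambda>\<omega>. ?I \<omega> * (zc \<omega>)\<^sup>2)"
    by (intro plan_integrable[OF P, where B="bnd\<^sup>2"]; simp add: indicator_def sq_bnd)
  have i2: "integrable \<pi> (\<lambda>\<omega>. ?I \<omega> * zc \<omega>)"
    by (intro plan_integrable[OF P, where B=bnd]; simp add: indicator_def bnd(4))
  have i3: "integrable \<pi> ?I"
    by (intro plan_integrable[OF P, where B=1]; simp add: indicator_def)
  note i = i1 i2 i3
  have hb: "\<bar>?h z\<bar> \<le> (bnd + bnd) * (bnd + bnd)" if "\<bar>z\<bar> \<le> bnd" for z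
    unfolding abs_mult using that endpointsD(8,9)[OF lu, of g] bnd(4) by (intro mult_mono) auto
  have hb': "\<bar>v * ?h z\<bar> \<le> (bnd + bnd) * (bnd + bnd)" if "\<bar>z\<bar> \<le> bnd" "\<bar>v\<bar> \<le> 1" for v z
    using mult_mono[OF that(2) hb[OF that(1)]] by (simp add: abs_mult)
  have ih: "integrable \<pi> (\<lambda>\<omega>. ?I \<omega> * ?h (zc \<omega>))" "integrable \<pi> (\<lambda>\<omega>. indicator {l g<..<u g} (zc \<omega>) * ?h (zc \<omega>))"
    by (intro plan_integrable[OF P, where B="(bnd + bnd) * (bnd + bnd)"] hb'; simp add: indicator_def)+
  have sl: "slack l u g = (\<lambda>\<omega>. ?I \<omega> * ?h (zc \<omega>) - indicator {l g<..<u g} (zc \<omega>) * ?h (zc \<omega>))"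
    by (rule ext) (simp add: slack_def indicator_def)
  show "integrable \<pi> (slack l u g)"
    unfolding sl using ih by (rule Bochner_Integration.integrable_diff)
  have "(\<integral>\<omega>. ?I \<omega> * zc \<omega> \<partial>\<pi>) = level_moment \<pi> g"
    unfolding level_moment_def
    using plan_martingale[OF P, of "\<lambda>p. indicator {g<..} (Fp p)" 1] by (simp add: indicator_def)
  moreover have "(\<integral>\<omega>. ?I \<omega> * ?h (zc \<omega>) \<partial>\<pi>) = (\<integral>\<omega>. ?I \<omega> * (zc \<omega>)\<^sup>2 - (l g + u g) * (?I \<omega> * zc \<omega>) + l g * u g * ?I \<omega> \<partial>\<pi>)"
    by (intro Bochner_Integration.integral_cong) (auto simp: algebra_simps power2_eq_square)
  ultimately have 1: "(\<integral>\<omega>. ?I \<omega> * ?h (zc \<omega>) \<partial>\<pi>) = level_cost \<pi> g - (l g + u g) * level_moment \<pi> g + l g * u g * level_mass \<pi> g"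
    using i by (simp add: level_cost_def level_mass_def)
  have 2: "(\<integral>\<omega>. indicator {l g<..<u g} (zc \<omega>) * ?h (zc \<omega>) \<partial>\<pi>) = (\<integral>z. indicator {l g<..<u g} z * ?h z \<partial>\<mu>Z)"
    by (rule plan_integral_z[OF P]) measurable
  have "(\<integral>\<omega>. slack l u g \<omega> \<partial>\<pi>) = (\<integral>\<omega>. ?I \<omega> * ?h (zc \<omega>) \<partial>\<pi>) - (\<integral>\<omega>. indicator {l g<..<u g} (zc \<omega>) * ?h (zc \<omega>) \<partial>\<pi>)"
    unfolding sl using ih by (rule Bochner_Integration.integral_diff)
  then show "level_cost \<pi> g = dual_bound l u \<pi> g + (\<integral>\<omega>. slack l u g \<omega> \<partial>\<pi>)"
    unfolding 1 2 dual_bound_def by simp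
qed

lemma dual_bound_le:
  assumes "plan \<pi>" "endpoints l u"
  shows "dual_bound l u \<pi> g \<le> level_cost \<pi> g"
  using level_cost_eq(1)[OF assms] slack_nonneg[OF assms(2)] by (simp add: integral_nonneg_AE)

lemma nestedD:
  assumes "nested \<pi> l u"
  shows "plan \<pi>" "endpoints l u" "measure \<mu>Z {l g<..<u g} = level_mass \<pi> g"
    "(\<integral>z. indicator {l g<..<u g} z * z \<partial>\<mu>Z) = level_moment \<pi> g"
    "AE \<omega> in \<pi>. zc \<omega> = l (Fp (xy \<omega>)) \<or> zc \<omega> = u (Fp (xy \<omega>))"
  using assms by (auto simp: nested_def level_mass_def level_moment_def)

text \<open>An end of the interval of level \<open>F\<close> lies in the closed interval of any
  level below \<open>F\<close>, and outside the open interval of any other level. So the slack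
  vanishes, the ends being zeros of the quadratic.\<close>

lemma nested_level_cost:
  assumes "nested \<pi> l u"
  shows "level_cost \<pi> g = dual_bound l u \<pi> g"
proof -
  note D = nestedD[OF assms]
  have "AE \<omega> in \<pi>. slack l u g \<omega> = 0"
    using D(5)
  proof eventually_elim
    case (elim \<omega>)
    let ?f = "Fp (xy \<omega>)"
    have e: "l ?f \<le> zmu" "zpl \<le> u ?f" "l g \<le> zmu" "zpl \<le> u g"
      using endpointsD[OF D(2)] by auto
    show ?case
    proof (cases "g < ?f")
      case True
      then have "l g \<le> l ?f" "u ?f \<le> u g"
        using monoD[OF endpointsD(1)[OF D(2)], of g ?f] antimonoD[OF endpointsD(2)[OF D(2)], of g ?f] by auto
      then have "zc \<omega> = l g \<or> zc \<omega> = u g \<or> (l g < zc \<omega> \<and> zc \<omega> < u g)"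
        using elim e gap_pos by auto
      then show ?thesis
        using True by (auto simp: slack_def)
    next
      case False
      then have "l ?f \<le> l g" "u g \<le> u ?f"
        using monoD[OF endpointsD(1)[OF D(2)], of ?f g] antimonoD[OF endpointsD(2)[OF D(2)], of ?f g] by auto
      then have "zc \<omega> \<le> l g \<or> u g \<le> zc \<omega>"
        using elim by auto
      then show ?thesis
        using False by (auto simp: slack_def)
    qed
  qed
  then have "(\<integral>\<omega>. slack l u g \<omega> \<partial>\<pi>) = 0"
    by (rule integral_eq_zero_AE)
  then show ?thesis
    using level_cost_eq(1)[OF D(1,2)] by simp
qed

text \<open>A nonnegative slack with zero integral vanishes almost surely. Away from the two zeros
  of the quadratic, which \<open>\<mu>Z\<close> does not charge, the indicators must then
  agree.\<close>

lemma AE_nested_of_level_cost: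
  assumes P: "plan \<pi>" and lu: "endpoints l u" and eq: "level_cost \<pi> g = dual_bound l u \<pi> g"
  shows "AE \<omega> in \<pi>. g < Fp (xy \<omega>) \<longleftrightarrow> zc \<omega> \<in> {l g<..<u g}"
proof -
  have "(\<integral>\<omega>. slack l u g \<omega> \<partial>\<pi>) = 0"
    using level_cost_eq(1)[OF P lu, of g] eq by simp
  then have "AE \<omega> in \<pi>. slack l u g \<omega> = 0"
    using integral_nonneg_eq_0_iff_AE[OF level_cost_eq(2)[OF P lu]] slack_nonneg[OF lu] by simp
  then show ?thesis
    using plan_AE(5)[OF P, of "l g"] plan_AE(5)[OF P, of "u g"]
    by eventually_elim (auto simp: slack_def indicator_def split: if_splits)
qed

lemma level_cost_bounds:
  assumes P: "plan \<pi>"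
  shows "0 \<le> level_cost \<pi> g" "level_cost \<pi> g \<le> bnd\<^sup>2" "antimono (level_cost \<pi>)"
proof -
  interpret prob_space \<pi>
    using P by (rule planD)
  have i: "integrable \<pi> (\<lambda>\<omega>. indicator {g<..} (Fp (xy \<omega>)) * (zc \<omega>)\<^sup>2)" for g
    using sq_bnd by (intro plan_integrable[OF P, where B="bnd\<^sup>2"]) (auto simp: indicator_def)
  show "0 \<le> level_cost \<pi> g"
    unfolding level_cost_def by (intro integral_nonneg_AE) auto
  have "level_cost \<pi> g \<le> (\<integral>\<omega>. bnd\<^sup>2 \<partial>\<pi>)"
    unfolding level_cost_def using plan_AE(7)[OF P]
    by (intro integral_mono_AE i) (auto elim!: eventually_mono simp: indicator_def sq_bnd)
  then show "level_cost \<pi> g \<le> bnd\<^sup>2"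
    by (simp add: prob_space)
  show "antimono (level_cost \<pi>)"
    unfolding level_cost_def by (intro antimonoI integral_mono i) (auto simp: indicator_def)
qed

section \<open>Layer-cake formula for the cost\<close>

lemma level_cost_measurable:
  assumes P: "plan \<pi>"
  shows "level_cost \<pi> \<in> borel_measurable borel"
  using level_cost_bounds(3)[OF P] by (rule borel_measurable_antimono)

lemma integrable_on_levels:
  fixes c :: "real \<Rightarrow> real"
  assumes "c \<in> borel_measurable borel" "\<And>g. \<bar>c g\<bar> \<le> B"
  shows "integrable lborel (\<lambda>g. indicator {\<gamma>0..<\<gamma>1} g * c g)"
proof (rule Bochner_Integration.integrable_bound)
  show "integrable lborel (\<lambda>g. indicator {\<gamma>0..<\<gamma>1} g * B)"
    using Fp_bounds[of undefined] by (intro integrable_mult_left integrable_real_indicator) auto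
  show "AE g in lborel. norm (indicator {\<gamma>0..<\<gamma>1} g * c g) \<le> norm (indicator {\<gamma>0..<\<gamma>1} g * B)"
    using order_trans[OF assms(2) abs_ge_self] by (intro AE_I2) (auto simp: indicator_def)
qed (use assms(1) in measurable)

lemma integrable_level_cost:
  assumes P: "plan \<pi>"
  shows "integrable lborel (\<lambda>g. indicator {\<gamma>0..<\<gamma>1} g * level_cost \<pi> g)"
  using level_cost_bounds[OF P] by (intro integrable_on_levels[where B="bnd\<^sup>2"] level_cost_measurable P) auto

text \<open>\<open>F - \<gamma>0\<close> is the length of the set of levels from
  \<open>\<gamma>0\<close> to \<open>F\<close>, and the integrals over levels and points are
  exchanged. The subtracted constant contributes a term that depends on \<open>\<mu>Z\<close>
  alone.\<close>

lemma cost_eq_total_cost: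
  assumes P: "plan \<pi>"
  shows "(\<integral>\<omega>. Fp (xy \<omega>) * (zc \<omega>)\<^sup>2 \<partial>\<pi>) = \<gamma>0 * (\<integral>z. z\<^sup>2 \<partial>\<mu>Z) + total_cost \<pi>"
proof -
  interpret prob_space \<pi>
    using P by (rule planD)
  have [measurable_cong]: "sets \<pi> = sets borel"
    using P by (rule planD)
  interpret pair_sigma_finite lborel \<pi> ..
  have [measurable]: "level_cost \<pi> \<in> borel_measurable borel"
    by (rule level_cost_measurable[OF P])
  have i: "integrable \<pi> (\<lambda>\<omega>. indicator {g<..} (Fp (xy \<omega>)) * (zc \<omega>)\<^sup>2)" for g
    using sq_bnd by (intro plan_integrable[OF P, where B="bnd\<^sup>2"]) (auto simp: indicator_def)
  have i2: "integrable \<pi> (\<lambda>\<omega>. (zc \<omega>)\<^sup>2)"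
    using sq_bnd by (intro plan_integrable[OF P, where B="bnd\<^sup>2"]) auto
  have i3: "integrable \<pi> (\<lambda>\<omega>. (Fp (xy \<omega>) - \<gamma>0) * (zc \<omega>)\<^sup>2)"
  proof (rule plan_integrable[OF P, where B="(\<gamma>1 - \<gamma>0) * bnd\<^sup>2"])
    fix \<omega> :: "real \<times> real \<times> real" assume "\<bar>zc \<omega>\<bar> \<le> bnd"
    then show "\<bar>(Fp (xy \<omega>) - \<gamma>0) * (zc \<omega>)\<^sup>2\<bar> \<le> (\<gamma>1 - \<gamma>0) * bnd\<^sup>2"
      unfolding abs_mult using Fp_bounds[of "xy \<omega>"] sq_bnd[of "zc \<omega>"] by (intro mult_mono) auto
  qed measurable
  have "ennreal (total_cost \<pi>) = (\<integral>\<^sup>+g. ennreal (indicator {\<gamma>0..<\<gamma>1} g * level_cost \<pi> g) \<partial>lborel)"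
    unfolding total_cost_def using level_cost_bounds(1)[OF P]
    by (intro nn_integral_eq_integral[symmetric] integrable_level_cost P) auto
  also have "\<dots> = (\<integral>\<^sup>+g. (\<integral>\<^sup>+\<omega>. ennreal (indicator {\<gamma>0..<\<gamma>1} g * (indicator {g<..} (Fp (xy \<omega>)) * (zc \<omega>)\<^sup>2)) \<partial>\<pi>) \<partial>lborel)"
  proof (rule nn_integral_cong)
    fix g
    show "ennreal (indicator {\<gamma>0..<\<gamma>1} g * level_cost \<pi> g) =
      (\<integral>\<^sup>+\<omega>. ennreal (indicator {\<gamma>0..<\<gamma>1} g * (indicator {g<..} (Fp (xy \<omega>)) * (zc \<omega>)\<^sup>2)) \<partial>\<pi>)"
      unfolding level_cost_def
      by (subst nn_integral_eq_integral) (auto intro!: integrable_mult_right i)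
  qed
  also have "\<dots> = (\<integral>\<^sup>+\<omega>. (\<integral>\<^sup>+g. ennreal (indicator {\<gamma>0..<\<gamma>1} g * (indicator {g<..} (Fp (xy \<omega>)) * (zc \<omega>)\<^sup>2)) \<partial>lborel) \<partial>\<pi>)"
  proof (rule Fubini'[symmetric])
    have "{p \<in> space (lborel \<Otimes>\<^sub>M \<pi>). fst p < Fp (xy (snd p))} \<in> sets (lborel \<Otimes>\<^sub>M \<pi>)"
      by measurable
    then have "(\<lambda>p. indicator {p \<in> space (lborel \<Otimes>\<^sub>M \<pi>). fst p < Fp (xy (snd p))} p :: real) \<in> borel_measurable (lborel \<Otimes>\<^sub>M \<pi>)"
      by measurable
    moreover have "indicator {p \<in> space (lborel \<Otimes>\<^sub>M \<pi>). fst p < Fp (xy (snd p))} p = (indicator {fst p<..} (Fp (xy (snd p))) :: real)" for p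
      using planD(6)[OF P] by (auto simp: indicator_def space_pair_measure mem_Times_iff)
    ultimately have [measurable]: "(\<lambda>p. indicator {fst p<..} (Fp (xy (snd p))) :: real) \<in> borel_measurable (lborel \<Otimes>\<^sub>M \<pi>)"
      by simp
    show "(\<lambda>(g, \<omega>). ennreal (indicator {\<gamma>0..<\<gamma>1} g * (indicator {g<..} (Fp (xy \<omega>)) * (zc \<omega>)\<^sup>2))) \<in> borel_measurable (lborel \<Otimes>\<^sub>M \<pi>)"
      unfolding case_prod_beta by measurable
  qed
  also have "\<dots> = (\<integral>\<^sup>+\<omega>. ennreal ((Fp (xy \<omega>) - \<gamma>0) * (zc \<omega>)\<^sup>2) \<partial>\<pi>)"
  proof (rule nn_integral_cong)
    fix \<omega>
    have "(\<integral>\<^sup>+g. ennreal (indicator {\<gamma>0..<\<gamma>1} g * (indicator {g<..} (Fp (xy \<omega>)) * (zc \<omega>)\<^sup>2)) \<partial>lborel) =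
      (\<integral>\<^sup>+g. ennreal ((zc \<omega>)\<^sup>2) * indicator {\<gamma>0..<Fp (xy \<omega>)} g \<partial>lborel)"
      using Fp_bounds[of "xy \<omega>"] by (intro nn_integral_cong) (auto simp: indicator_def)
    also have "\<dots> = ennreal ((zc \<omega>)\<^sup>2) * ennreal (Fp (xy \<omega>) - \<gamma>0)"
      using Fp_bounds[of "xy \<omega>"] by (simp add: nn_integral_cmult)
    also have "\<dots> = ennreal ((Fp (xy \<omega>) - \<gamma>0) * (zc \<omega>)\<^sup>2)"
      using Fp_bounds[of "xy \<omega>"] by (simp add: ennreal_mult[symmetric] mult.commute)
    finally show "(\<integral>\<^sup>+g. ennreal (indicator {\<gamma>0..<\<gamma>1} g * (indicator {g<..} (Fp (xy \<omega>)) * (zc \<omega>)\<^sup>2)) \<partial>lborel) =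
      ennreal ((Fp (xy \<omega>) - \<gamma>0) * (zc \<omega>)\<^sup>2)" .
  qed
  also have "\<dots> = ennreal (\<integral>\<omega>. (Fp (xy \<omega>) - \<gamma>0) * (zc \<omega>)\<^sup>2 \<partial>\<pi>)"
    using Fp_bounds by (intro nn_integral_eq_integral i3) (auto intro!: AE_I2 mult_nonneg_nonneg simp: less_imp_le)
  finally have "total_cost \<pi> = (\<integral>\<omega>. (Fp (xy \<omega>) - \<gamma>0) * (zc \<omega>)\<^sup>2 \<partial>\<pi>)"
    using level_cost_bounds(1)[OF P] Fp_bounds
    by (subst (asm) ennreal_inj) (auto simp: total_cost_def less_imp_le intro!: integral_nonneg_AE)
  moreover have "(\<integral>\<omega>. Fp (xy \<omega>) * (zc \<omega>)\<^sup>2 \<partial>\<pi>) = (\<integral>\<omega>. (Fp (xy \<omega>) - \<gamma>0) * (zc \<omega>)\<^sup>2 + \<gamma>0 * (zc \<omega>)\<^sup>2 \<partial>\<pi>)"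
    by (intro Bochner_Integration.integral_cong) (auto simp: algebra_simps)
  ultimately show ?thesis
    using i2 i3 plan_integral_z[OF P, of "\<lambda>z. z\<^sup>2"] by simp
qed

lemma level_functions_eq:
  assumes P: "plan \<pi>" and R: "\<And>i x. i \<le> 2 \<Longrightarrow> cdfs (distr \<pi> borel xy) i x = R i x"
  shows "level_mass \<pi> g = (\<Sum>i\<le>2. R i (cut i g))" "level_moment \<pi> g = (\<Sum>i\<le>2. y i * R i (cut i g))"
proof -
  have "level_mass \<pi> g = (\<integral>p. indicator {g<..} (F (fst p) (snd p)) * (\<lambda>_. 1) (snd p) \<partial>distr \<pi> borel xy)"
    unfolding level_mass_def by (subst plan_integral_xy[OF P]) (auto simp: Fp_def)
  then show "level_mass \<pi> g = (\<Sum>i\<le>2. R i (cut i g))"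
    using coupling_superlevel[OF planD(7)[OF P], of "\<lambda>_. 1" g] R by simp
  have "level_moment \<pi> g = (\<integral>p. indicator {g<..} (F (fst p) (snd p)) * (\<lambda>v. v) (snd p) \<partial>distr \<pi> borel xy)"
    unfolding level_moment_def
    using plan_integral_xy[OF P, of "\<lambda>p. indicator {g<..} (Fp p) * snd p"] by (simp add: Fp_def)
  then show "level_moment \<pi> g = (\<Sum>i\<le>2. y i * R i (cut i g))"
    using coupling_superlevel[OF planD(7)[OF P], of "\<lambda>v. v" g] R by simp
qed

lemma exists_nested_of_RR:
  assumes "R \<in> RR"
  obtains \<sigma> l u where "nested \<sigma> l u" "\<And>i x. i \<le> 2 \<Longrightarrow> cdfs (distr \<sigma> borel xy) i x = R i x"
  by (metis assms coupling_of_RR coupling_extends_to_nested)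

text \<open>The couplings of a minimising sequence converge along a subsequence. The nested plan
  over the limit is optimal: its intervals bound the level costs of the sequence from below by
  functions of the couplings that converge to its own level costs.\<close>

lemma exists_minimizer:
  assumes "RR \<noteq> {}"
  obtains \<sigma> where "plan \<sigma>" "\<And>\<pi>. plan \<pi> \<Longrightarrow> total_cost \<sigma> \<le> total_cost \<pi>"
proof -
  define j where "j = Inf (total_cost ` Collect plan)"
  obtain R0 where "R0 \<in> RR"
    using assms by blast
  then obtain \<sigma>0 l0 u0 where "nested \<sigma>0 l0 u0"
    by (rule exists_nested_of_RR)
  then have "plan \<sigma>0"
    by (rule nestedD)
  then have ne: "total_cost ` Collect plan \<noteq> {}"
    by auto
  have bdd: "bdd_below (total_cost ` Collect plan)"
    using level_cost_bounds(1) by (auto intro!: bdd_belowI[of _ 0] integral_nonneg_AE simp: total_cost_def)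
  have j_le: "j \<le> total_cost \<pi>" if "plan \<pi>" for \<pi>
    unfolding j_def using that by (intro cInf_lower bdd) auto
  have "\<exists>\<pi>. plan \<pi> \<and> total_cost \<pi> < j + 1 / (real n + 1)" for n
  proof -
    have "Inf (total_cost ` Collect plan) < j + 1 / (real n + 1)"
      by (simp add: j_def)
    then show ?thesis
      by (subst (asm) cInf_less_iff[OF ne bdd]) auto
  qed
  then obtain \<pi> where \<pi>: "\<And>n. plan (\<pi> n)" "\<And>n. total_cost (\<pi> n) < j + 1 / (real n + 1)"
    by metis
  define R where "R n = cdfs (distr (\<pi> n) borel xy)" for n
  have "R n \<in> RR" for n
    unfolding R_def by (intro cdfs_in_RR planD \<pi>)
  then obtain s R' where s: "strict_mono s" and R': "R' \<in> RR" and lim: "\<And>i x. i \<le> 2 \<Longrightarrow> (\<lambda>n. R (s n) i x) \<longlonglongrightarrow> R' i x"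
    using RR_sequentially_compact by blast
  obtain \<sigma> l u where \<sigma>: "nested \<sigma> l u" "\<And>i x. i \<le> 2 \<Longrightarrow> cdfs (distr \<sigma> borel xy) i x = R' i x"
    using exists_nested_of_RR[OF R'] by blast
  note D = nestedD[OF \<sigma>(1)]
  have dual_lim: "(\<lambda>n. dual_bound l u (\<pi> (s n)) g) \<longlonglongrightarrow> level_cost \<sigma> g" for g
  proof -
    have *: "level_mass \<sigma> g = (\<Sum>i\<le>2. R' i (cut i g))" "level_moment \<sigma> g = (\<Sum>i\<le>2. y i * R' i (cut i g))"
      using level_functions_eq[OF D(1), of R' g] \<sigma>(2) by auto
    have "(\<lambda>n. level_mass (\<pi> (s n)) g) \<longlonglongrightarrow> level_mass \<sigma> g"
      unfolding *(1) level_functions_eq(1)[OF \<pi>(1) refl]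
      using lim by (intro tendsto_sum) (auto simp: R_def)
    moreover have "(\<lambda>n. level_moment (\<pi> (s n)) g) \<longlonglongrightarrow> level_moment \<sigma> g"
      unfolding *(2) level_functions_eq(2)[OF \<pi>(1) refl]
      using lim by (intro tendsto_sum tendsto_mult_left) (auto simp: R_def)
    ultimately show ?thesis
      unfolding nested_level_cost[OF \<sigma>(1)] dual_bound_def by (intro tendsto_intros)
  qed
  \<comment> \<open>The level costs of the sequence are only bounded below in the limit. Taking the
    minimum with the limit turns this into convergence, so that dominated convergence
    applies.\<close>
  define c where "c n g = min (level_cost (\<pi> (s n)) g) (level_cost \<sigma> g)" for n g
  have c_lim: "(\<lambda>n. c n g) \<longlonglongrightarrow> level_cost \<sigma> g" for g
  proof (rule tendsto_sandwich)
    show "(\<lambda>n. min (dual_bound l u (\<pi> (s n)) g) (level_cost \<sigma> g)) \<longlonglongrightarrow> level_cost \<sigma> g"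
      using tendsto_min[OF dual_lim tendsto_const, of g "level_cost \<sigma> g"] by simp
    show "eventually (\<lambda>n. min (dual_bound l u (\<pi> (s n)) g) (level_cost \<sigma> g) \<le> c n g) sequentially"
      unfolding c_def by (intro always_eventually allI min.mono dual_bound_le \<pi> D order_refl)
    show "eventually (\<lambda>n. c n g \<le> level_cost \<sigma> g) sequentially"
      by (simp add: c_def)
  qed simp
  have [measurable]: "level_cost \<sigma> \<in> borel_measurable borel" "level_cost (\<pi> n) \<in> borel_measurable borel" for n
    using level_cost_measurable D(1) \<pi>(1) by auto
  have c_meas [measurable]: "c n \<in> borel_measurable borel" for n
    unfolding c_def[abs_def] by measurable
  have c_bound: "\<bar>c n g\<bar> \<le> bnd\<^sup>2" for n g
    using level_cost_bounds(1,2)[OF D(1), of g] level_cost_bounds(1,2)[OF \<pi>(1)[of "s n"], of g] by (auto simp: c_def)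
  have "(\<lambda>n. \<integral>g. indicator {\<gamma>0..<\<gamma>1} g * c n g \<partial>lborel) \<longlonglongrightarrow> total_cost \<sigma>"
    unfolding total_cost_def
  proof (rule integral_dominated_convergence[where w="\<lambda>g. indicator {\<gamma>0..<\<gamma>1} g * bnd\<^sup>2"])
    show "integrable lborel (\<lambda>g. indicator {\<gamma>0..<\<gamma>1} g * bnd\<^sup>2)"
      by (rule integrable_on_levels[where B="bnd\<^sup>2"]) auto
    show "AE g in lborel. (\<lambda>n. indicator {\<gamma>0..<\<gamma>1} g * c n g) \<longlonglongrightarrow> indicator {\<gamma>0..<\<gamma>1} g * level_cost \<sigma> g"
      by (intro AE_I2 tendsto_intros c_lim)
    show "AE g in lborel. norm (indicator {\<gamma>0..<\<gamma>1} g * c n g) \<le> indicator {\<gamma>0..<\<gamma>1} g * bnd\<^sup>2" for n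
      using c_bound by (auto simp: indicator_def)
  qed measurable
  moreover have "(\<integral>g. indicator {\<gamma>0..<\<gamma>1} g * c n g \<partial>lborel) \<le> j + 1 / (real n + 1)" for n
  proof -
    have "(\<integral>g. indicator {\<gamma>0..<\<gamma>1} g * c n g \<partial>lborel) \<le> total_cost (\<pi> (s n))"
      unfolding total_cost_def using c_bound
      by (intro integral_mono integrable_on_levels[where B="bnd\<^sup>2"] integrable_level_cost \<pi>) (auto simp: c_def indicator_def)
    also have "\<dots> \<le> j + 1 / (real (s n) + 1)"
      using \<pi>(2)[of "s n"] by simp
    also have "\<dots> \<le> j + 1 / (real n + 1)"
      using seq_suble[OF s, of n] by (simp add: frac_le)
    finally show ?thesis .
  qed
  moreover have "(\<lambda>n. j + 1 / (real n + 1)) \<longlonglongrightarrow> j"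
  proof -
    have "(\<lambda>n. j + inverse (real (Suc n))) \<longlonglongrightarrow> j + 0"
      by (intro tendsto_intros LIMSEQ_inverse_real_of_nat)
    then show ?thesis
      by (simp add: divide_inverse add.commute)
  qed
  ultimately have "total_cost \<sigma> \<le> j"
    by (intro LIMSEQ_le) auto
  then show ?thesis
    using that[OF D(1)] j_le by (meson order_trans)
qed

section \<open>Uniqueness of the minimizer\<close>

lemma RR_midpoint:
  assumes R: "R \<in> RR" and R': "R' \<in> RR"
  shows "(\<lambda>i x. (R i x + R' i x) / 2) \<in> RR"
  unfolding RR_def
proof (intro CollectI conjI allI impI)
  fix i :: nat and x assume i: "i \<le> 2"
  show "mono (\<lambda>x. (R i x + R' i x) / 2)"
    using monoD[OF RRD(1)[OF R i]] monoD[OF RRD(1)[OF R' i]] by (intro monoI divide_right_mono add_mono) auto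
  show "x \<le> xl \<Longrightarrow> (R i x + R' i x) / 2 = 0" "xu \<le> x \<Longrightarrow> (R i x + R' i x) / 2 = measure \<mu>Y {y i}"
    using RRD(2,3)[OF R i, of x] RRD(2,3)[OF R' i, of x] by auto
next
  fix x
  show "(\<Sum>i\<le>2. (R i x + R' i x) / 2) = measure \<mu>X {..x}"
    using RRD(4)[OF R, of x] RRD(4)[OF R', of x] by (simp add: sum_divide_distrib[symmetric] sum.distrib)
  show "(\<Sum>i\<le>2. y i * ((R i x + R' i x) / 2)) = (\<integral>t. indicator {..x} t * t \<partial>\<mu>X)"
    using RRD(5)[OF R, of x] RRD(5)[OF R', of x]
    by (simp add: sum_divide_distrib[symmetric] sum.distrib distrib_left)
qed

text \<open>The inclusion holds almost surely for each level separately, hence simultaneously for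
  the rational ones; as the law of \<open>F\<close> has no atoms, its values avoid the jumps of the
  ends.\<close>

lemma AE_endpoint:
  assumes P: "plan \<pi>" and lu: "endpoints l u"
    and nest: "\<And>g. \<gamma>0 \<le> g \<Longrightarrow> g < \<gamma>1 \<Longrightarrow> AE \<omega> in \<pi>. g < Fp (xy \<omega>) \<longleftrightarrow> zc \<omega> \<in> {l g<..<u g}"
  shows "AE \<omega> in \<pi>. zc \<omega> = (if zc \<omega> \<le> zmu then l (Fp (xy \<omega>)) else u (Fp (xy \<omega>)))"
proof -
  interpret prob_space \<pi>
    using P by (rule planD)
  have [measurable_cong]: "sets \<pi> = sets borel"
    using P by (rule planD)
  have "AE p in distr \<pi> borel xy. Fp p \<noteq> g" for g
    using AE_F_neq[OF planD(7)[OF P]] by (simp add: Fp_def)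
  then have F_neq: "AE \<omega> in \<pi>. Fp (xy \<omega>) \<noteq> g" for g
    by (subst (asm) AE_distr_iff) auto
  have cont: "AE \<omega> in \<pi>. Fp (xy \<omega>) \<notin> {g. \<not> isCont l g} \<union> {g. \<not> isCont u g}"
    by (rule AE_not_in_countable[OF _ F_neq countable_discont_mono_antimono[OF endpointsD(1,2)[OF lu]]]) measurable
  have "AE \<omega> in \<pi>. \<forall>g\<in>\<rat> \<inter> {\<gamma>0..<\<gamma>1}. g < Fp (xy \<omega>) \<longleftrightarrow> zc \<omega> \<in> {l g<..<u g}"
    using nest by (subst AE_ball_countable) (auto intro: countable_rat)
  then show ?thesis
    using cont plan_AE(3)[OF P]
  proof eventually_elim
    case (elim \<omega>)
    show ?case
    proof (rule eq_endpoint_of_nested_intervals[of zml l zmu zpl u zpu _ \<gamma>0 _ \<gamma>1])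
      show "zml \<le> l g \<and> l g \<le> zmu" "zpl \<le> u g \<and> u g \<le> zpu" for g
        using endpointsD[OF lu] by auto
      fix g :: real assume g: "g \<in> \<rat>"
      show "l g < zc \<omega> \<and> zc \<omega> < u g" if "\<gamma>0 < g" "g < Fp (xy \<omega>)"
        using elim(1) g that Fp_bounds[of "xy \<omega>"] by auto
      show "\<not> (l g < zc \<omega> \<and> zc \<omega> < u g)" if "Fp (xy \<omega>) < g" "g < \<gamma>1"
        using bspec[OF elim(1), of g] g that Fp_bounds[of "xy \<omega>"] by auto
    qed (use elim Fp_bounds gap_pos in auto)
  qed
qed

text \<open>With z at one of two ends, the indicator of any event is almost surely affine in z with
  coefficients depending on (x, y). The martingale condition replaces z by y and leaves an
  expression in the law of (x, y) and the intervals.\<close>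

lemma plan_determined:
  assumes P: "plan \<pi>" and lu: "endpoints l u" and [measurable]: "A \<in> sets borel"
    and z: "AE \<omega> in \<pi>. zc \<omega> = (if zc \<omega> \<le> zmu then l (Fp (xy \<omega>)) else u (Fp (xy \<omega>)))"
  shows "measure \<pi> A = (\<integral>p. (indicator A (fst p, snd p, l (Fp p)) * (u (Fp p) - snd p) +
    indicator A (fst p, snd p, u (Fp p)) * (snd p - l (Fp p))) / (u (Fp p) - l (Fp p)) \<partial>distr \<pi> borel xy)"
proof -
  interpret prob_space \<pi>
    using P by (rule planD)
  have [measurable_cong]: "sets \<pi> = sets borel"
    using P by (rule planD)
  note [measurable] = endpoints_measurable[OF lu]
  have gap: "0 < zpl - zmu" "zpl - zmu \<le> u g - l g" for g
    using endpointsD(7)[OF lu] gap_pos by auto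
  define a b where "a p = (indicator A (fst p, snd p, l (Fp p)) :: real)" and "b p = (indicator A (fst p, snd p, u (Fp p)) :: real)" for p
  have [measurable]: "a \<in> borel_measurable borel" "b \<in> borel_measurable borel"
    unfolding a_def[abs_def] b_def[abs_def] by measurable
  define \<psi>1 \<psi>2 where "\<psi>1 p = (a p * u (Fp p) - b p * l (Fp p)) / (u (Fp p) - l (Fp p))"
    and "\<psi>2 p = (b p - a p) / (u (Fp p) - l (Fp p))" for p
  have \<psi> [measurable]: "\<psi>1 \<in> borel_measurable borel" "\<psi>2 \<in> borel_measurable borel"
    unfolding \<psi>1_def[abs_def] \<psi>2_def[abs_def] by measurable
  have quot: "\<bar>x / (u t - l t)\<bar> \<le> c / (zpl - zmu)" if "\<bar>x\<bar> \<le> c" for x c t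
    using gap(1) gap(2)[of t] that by (auto simp: abs_divide intro!: frac_le)
  have b1: "\<bar>\<psi>1 p\<bar> \<le> (bnd + bnd) / (zpl - zmu)" for p
    unfolding \<psi>1_def using endpointsD(8,9)[OF lu, of "Fp p"] bnd(4)
    by (intro quot) (auto simp: a_def b_def indicator_def)
  have b2: "\<bar>\<psi>2 p\<bar> \<le> 1 / (zpl - zmu)" for p
    unfolding \<psi>2_def by (intro quot) (auto simp: a_def b_def indicator_def)
  have b2': "\<bar>\<psi>2 p * v\<bar> \<le> 1 / (zpl - zmu) * bnd" if "\<bar>v\<bar> \<le> bnd" for p v
    unfolding abs_mult using b2[of p] that gap(1) by (intro mult_mono) auto
  have i1: "integrable \<pi> (\<lambda>\<omega>. \<psi>1 (xy \<omega>))"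
    using b1 by (intro plan_integrable[OF P, where B="(bnd + bnd) / (zpl - zmu)"]) measurable
  have i2: "integrable \<pi> (\<lambda>\<omega>. \<psi>2 (xy \<omega>) * zc \<omega>)"
    using b2' by (intro plan_integrable[OF P, where B="1 / (zpl - zmu) * bnd"]) measurable
  have i3: "integrable \<pi> (\<lambda>\<omega>. \<psi>2 (xy \<omega>) * fst (snd \<omega>))"
    using b2' by (intro plan_integrable[OF P, where B="1 / (zpl - zmu) * bnd"]) measurable
  have "measure \<pi> A = (\<integral>\<omega>. indicator A \<omega> \<partial>\<pi>)"
    using planD(6)[OF P] by simp
  also have "\<dots> = (\<integral>\<omega>. \<psi>1 (xy \<omega>) + \<psi>2 (xy \<omega>) * zc \<omega> \<partial>\<pi>)"
  proof (rule integral_cong_AE)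
    show "AE \<omega> in \<pi>. indicator A \<omega> = \<psi>1 (xy \<omega>) + \<psi>2 (xy \<omega>) * zc \<omega>"
      using z
    proof eventually_elim
      case (elim \<omega>)
      let ?l = "l (Fp (xy \<omega>))" and ?u = "u (Fp (xy \<omega>))"
      have \<omega>: "\<omega> = (fst (xy \<omega>), snd (xy \<omega>), zc \<omega>)"
        by (simp add: xy_def zc_def)
      have "?l < ?u"
        using gap(1) gap(2)[of "Fp (xy \<omega>)"] by linarith
      moreover have "zc \<omega> = ?l \<and> a (xy \<omega>) = indicator A \<omega> \<or> zc \<omega> = ?u \<and> b (xy \<omega>) = indicator A \<omega>"
      proof (cases "zc \<omega> \<le> zmu")
        case True
        then have "zc \<omega> = ?l"
          using elim by simp
        then show ?thesis
          using \<omega> by (simp add: a_def)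
      next
        case False
        then have "zc \<omega> = ?u"
          using elim by simp
        then show ?thesis
          using \<omega> by (simp add: b_def)
      qed
      ultimately show ?case
        unfolding \<psi>1_def \<psi>2_def endpoint_average_affine[symmetric] by (rule endpoint_average_eq[symmetric])
    qed
  qed measurable
  also have "\<dots> = (\<integral>\<omega>. \<psi>1 (xy \<omega>) + \<psi>2 (xy \<omega>) * snd (xy \<omega>) \<partial>\<pi>)"
    using i1 i2 i3 plan_martingale[OF P \<psi>(2) b2] by simp
  also have "\<dots> = (\<integral>p. \<psi>1 p + \<psi>2 p * snd p \<partial>distr \<pi> borel xy)"
    by (rule plan_integral_xy[OF P]) measurable
  also have "\<dots> = (\<integral>p. (a p * (u (Fp p) - snd p) + b p * (snd p - l (Fp p))) / (u (Fp p) - l (Fp p)) \<partial>distr \<pi> borel xy)"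
    by (simp only: \<psi>1_def \<psi>2_def endpoint_average_affine)
  finally show ?thesis
    by (simp add: a_def b_def)
qed

lemma minimizer_unique:
  assumes P: "plan \<pi>" "plan \<pi>'"
    and min: "\<And>\<sigma>. plan \<sigma> \<Longrightarrow> total_cost \<pi> \<le> total_cost \<sigma>" "\<And>\<sigma>. plan \<sigma> \<Longrightarrow> total_cost \<pi>' \<le> total_cost \<sigma>"
  shows "\<pi> = \<pi>'"
proof -
  define R R' where "R = cdfs (distr \<pi> borel xy)" and "R' = cdfs (distr \<pi>' borel xy)"
  have RR: "R \<in> RR" "R' \<in> RR"
    unfolding R_def R'_def by (intro cdfs_in_RR planD P)+
  obtain \<sigma> l u where \<sigma>: "nested \<sigma> l u" "\<And>i x. i \<le> 2 \<Longrightarrow> cdfs (distr \<sigma> borel xy) i x = (R i x + R' i x) / 2"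
    by (rule exists_nested_of_RR[OF RR_midpoint[OF RR]]) blast
  note D = nestedD[OF \<sigma>(1)]
  have mid: "2 * level_mass \<sigma> g = level_mass \<pi> g + level_mass \<pi>' g"
    "2 * level_moment \<sigma> g = level_moment \<pi> g + level_moment \<pi>' g" for g
    using level_functions_eq[OF D(1), of "\<lambda>i x. (R i x + R' i x) / 2" g] \<sigma>(2)
      level_functions_eq[OF P(1), of R g] level_functions_eq[OF P(2), of R' g]
    by (simp_all add: R_def R'_def sum_atMost_2 field_simps)
  have dual_mid: "2 * level_cost \<sigma> g = dual_bound l u \<pi> g + dual_bound l u \<pi>' g" for g
  proof -
    have "2 * level_cost \<sigma> g = 2 * (\<integral>z. indicator {l g<..<u g} z * ((z - l g) * (z - u g)) \<partial>\<mu>Z) +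
        (l g + u g) * (2 * level_moment \<sigma> g) - l g * u g * (2 * level_mass \<sigma> g)"
      unfolding nested_level_cost[OF \<sigma>(1)] dual_bound_def by (simp add: algebra_simps)
    then show ?thesis
      unfolding mid dual_bound_def by (simp add: algebra_simps)
  qed
  \<comment> \<open>The dual bounds of the intervals of \<open>\<sigma>\<close> are affine in the
    coupling, so those of the two plans add up to twice the level cost of \<open>\<sigma>\<close>;
    the excess is nonnegative at every level, while optimality makes its integral
    nonpositive.\<close>
  define \<delta> where "\<delta> g = level_cost \<pi> g + level_cost \<pi>' g - 2 * level_cost \<sigma> g" for g
  have \<delta>_nonneg: "0 \<le> \<delta> g" for g
    using dual_mid[of g] dual_bound_le[OF P(1) D(2), of g] dual_bound_le[OF P(2) D(2), of g] by (simp add: \<delta>_def)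
  have int: "integrable lborel (\<lambda>g. indicator {\<gamma>0..<\<gamma>1} g * \<delta> g)"
    "(\<integral>g. indicator {\<gamma>0..<\<gamma>1} g * \<delta> g \<partial>lborel) = total_cost \<pi> + total_cost \<pi>' - 2 * total_cost \<sigma>"
  proof -
    note i = integrable_level_cost[OF P(1)] integrable_level_cost[OF P(2)] integrable_level_cost[OF D(1)]
    have eq: "(\<lambda>g. indicator {\<gamma>0..<\<gamma>1} g * \<delta> g) = (\<lambda>g. indicator {\<gamma>0..<\<gamma>1} g * level_cost \<pi> g +
      indicator {\<gamma>0..<\<gamma>1} g * level_cost \<pi>' g - 2 * (indicator {\<gamma>0..<\<gamma>1} g * level_cost \<sigma> g))"
      by (auto simp: \<delta>_def algebra_simps)
    show "integrable lborel (\<lambda>g. indicator {\<gamma>0..<\<gamma>1} g * \<delta> g)"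
      unfolding eq using i by (intro Bochner_Integration.integrable_diff Bochner_Integration.integrable_add integrable_mult_right)
    show "(\<integral>g. indicator {\<gamma>0..<\<gamma>1} g * \<delta> g \<partial>lborel) = total_cost \<pi> + total_cost \<pi>' - 2 * total_cost \<sigma>"
      unfolding eq total_cost_def using i by simp
  qed
  have "(\<integral>g. indicator {\<gamma>0..<\<gamma>1} g * \<delta> g \<partial>lborel) = 0"
  proof (rule antisym)
    show "(\<integral>g. indicator {\<gamma>0..<\<gamma>1} g * \<delta> g \<partial>lborel) \<le> 0"
      using min[OF D(1)] int(2) by simp
    show "0 \<le> (\<integral>g. indicator {\<gamma>0..<\<gamma>1} g * \<delta> g \<partial>lborel)"
      using \<delta>_nonneg by (intro integral_nonneg_AE) auto
  qed
  then have \<delta>_AE: "AE g in lborel. indicator {\<gamma>0..<\<gamma>1} g * \<delta> g = 0"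
    using integral_nonneg_eq_0_iff_AE[OF int(1)] \<delta>_nonneg by simp
  \<comment> \<open>Later steps need all levels of the range, not almost all. Zeros of
    \<open>\<delta>\<close> accumulate at \<open>g\<close> from the right, and level costs are
    right-continuous.\<close>
  have \<delta>0: "\<delta> g = 0" if g: "\<gamma>0 \<le> g" "g < \<gamma>1" for g
  proof -
    have "\<exists>t. g < t \<and> t < \<gamma>1 \<and> t < g + 1 / (real n + 1) \<and> \<delta> t = 0" for n
    proof (rule ccontr)
      define t where "t = min \<gamma>1 (g + 1 / (real n + 1))"
      have t: "g < t"
        using g by (simp add: t_def)
      assume "\<nexists>t. g < t \<and> t < \<gamma>1 \<and> t < g + 1 / (real n + 1) \<and> \<delta> t = 0"
      then have "\<delta> s \<noteq> 0" if "g < s" "s < t" for s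
        using that by (auto simp: t_def)
      then have "AE s in lborel. s \<notin> {g<..<t}"
        using \<delta>_AE g by (auto elim!: eventually_mono simp: t_def indicator_def)
      then have "{g<..<t} \<in> null_sets lborel"
        by (subst AE_iff_null_sets) auto
      then have "emeasure lborel {g<..<t} = 0"
        by auto
      then show False
        using t by simp
    qed
    then obtain s where s: "\<And>n. g < s n \<and> s n < \<gamma>1 \<and> s n < g + 1 / (real n + 1) \<and> \<delta> (s n) = 0"
      by metis
    have "(\<lambda>n. g + inverse (real (Suc n))) \<longlonglongrightarrow> g + 0"
      by (intro tendsto_intros LIMSEQ_inverse_real_of_nat)
    then have upper: "(\<lambda>n. g + 1 / (real n + 1)) \<longlonglongrightarrow> g"
      by (simp add: divide_inverse add.commute)
    have s_lim: "s \<longlonglongrightarrow> g"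
      by (rule tendsto_sandwich[OF _ _ tendsto_const upper]) (use s in \<open>auto intro!: always_eventually less_imp_le\<close>)
    have lim: "(\<lambda>n. level_cost \<rho> (s n)) \<longlonglongrightarrow> level_cost \<rho> g" if \<rho>: "plan \<rho>" for \<rho>
    proof -
      have [measurable_cong]: "sets \<rho> = sets borel"
        using \<rho> by (rule planD)
      have "integrable \<rho> (\<lambda>\<omega>. (zc \<omega>)\<^sup>2)"
        by (intro plan_integrable[OF \<rho>, where B="bnd\<^sup>2"]; simp add: sq_bnd)
      then show ?thesis
        unfolding level_cost_def using s s_lim by (intro tendsto_integral_superlevel) (auto simp: less_imp_le)
    qed
    have "(\<lambda>n. \<delta> (s n)) \<longlonglongrightarrow> \<delta> g"
      unfolding \<delta>_def by (intro tendsto_intros lim P D(1))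
    then show ?thesis
      using s by (simp add: LIMSEQ_const_iff)
  qed
  have cost_eq: "level_cost \<pi> g = dual_bound l u \<pi> g" "level_cost \<pi>' g = dual_bound l u \<pi>' g" if "\<gamma>0 \<le> g" "g < \<gamma>1" for g
    using \<delta>0[OF that] dual_mid[of g] dual_bound_le[OF P(1) D(2), of g] dual_bound_le[OF P(2) D(2), of g]
    by (auto simp: \<delta>_def)
  have nest: "AE \<omega> in \<pi>. g < Fp (xy \<omega>) \<longleftrightarrow> zc \<omega> \<in> {l g<..<u g}" "AE \<omega> in \<pi>'. g < Fp (xy \<omega>) \<longleftrightarrow> zc \<omega> \<in> {l g<..<u g}"
    if "\<gamma>0 \<le> g" "g < \<gamma>1" for g
    using AE_nested_of_level_cost[OF P(1) D(2) cost_eq(1)[OF that]] AE_nested_of_level_cost[OF P(2) D(2) cost_eq(2)[OF that]] by auto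
  \<comment> \<open>By nesting, z fills the interval of the level exactly on the superlevel set, so
    both level functions are integrals of \<open>\<mu>Z\<close> over an interval common to the two
    plans.\<close>
  have levels: "level_mass \<rho> g = (\<integral>z. indicator {l g<..<u g} z \<partial>\<mu>Z)" "level_moment \<rho> g = (\<integral>z. indicator {l g<..<u g} z * z \<partial>\<mu>Z)"
    if \<rho>: "plan \<rho>" and n: "AE \<omega> in \<rho>. g < Fp (xy \<omega>) \<longleftrightarrow> zc \<omega> \<in> {l g<..<u g}" for \<rho> g
  proof -
    have [measurable_cong]: "sets \<rho> = sets borel"
      using \<rho> by (rule planD)
    have "level_mass \<rho> g = (\<integral>\<omega>. indicator {l g<..<u g} (zc \<omega>) \<partial>\<rho>)"
      unfolding level_mass_def using n by (intro integral_cong_AE) (auto elim!: eventually_mono simp: indicator_def)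
    then show "level_mass \<rho> g = (\<integral>z. indicator {l g<..<u g} z \<partial>\<mu>Z)"
      using plan_integral_z[OF \<rho>, of "indicator {l g<..<u g}"] by simp
    have "level_moment \<rho> g = (\<integral>\<omega>. indicator {g<..} (Fp (xy \<omega>)) * zc \<omega> \<partial>\<rho>)"
      unfolding level_moment_def
      using plan_martingale[OF \<rho>, of "\<lambda>p. indicator {g<..} (Fp p)" 1] by (simp add: indicator_def)
    also have "\<dots> = (\<integral>\<omega>. indicator {l g<..<u g} (zc \<omega>) * zc \<omega> \<partial>\<rho>)"
      using n by (intro integral_cong_AE) (auto elim!: eventually_mono simp: indicator_def)
    also have "\<dots> = (\<integral>z. indicator {l g<..<u g} z * z \<partial>\<mu>Z)"
      by (rule plan_integral_z[OF \<rho>]) measurable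
    finally show "level_moment \<rho> g = (\<integral>z. indicator {l g<..<u g} z * z \<partial>\<mu>Z)" .
  qed
  have "R i x = R' i x" if "i \<le> 2" for i x
  proof (rule RR_eqI[OF RR _ _ that])
    fix g assume "\<gamma>0 < g" "g < \<gamma>1"
    then have g: "\<gamma>0 \<le> g" "g < \<gamma>1"
      by auto
    show "(\<Sum>i\<le>2. R i (cut i g)) = (\<Sum>i\<le>2. R' i (cut i g))"
      using levels(1)[OF P(1) nest(1)[OF g]] levels(1)[OF P(2) nest(2)[OF g]]
        level_functions_eq(1)[OF P(1), of R g] level_functions_eq(1)[OF P(2), of R' g] by (simp add: R_def R'_def)
    show "(\<Sum>i\<le>2. y i * R i (cut i g)) = (\<Sum>i\<le>2. y i * R' i (cut i g))"
      using levels(2)[OF P(1) nest(1)[OF g]] levels(2)[OF P(2) nest(2)[OF g]]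
        level_functions_eq(2)[OF P(1), of R g] level_functions_eq(2)[OF P(2), of R' g] by (simp add: R_def R'_def)
  qed
  then have XY: "distr \<pi> borel xy = distr \<pi>' borel xy"
    by (intro cdfs_inject planD P) (simp add: R_def R'_def)
  show ?thesis
  proof (rule measure_eqI)
    show "sets \<pi> = sets \<pi>'"
      using planD(2)[OF P(1)] planD(2)[OF P(2)] by simp
    interpret \<pi>: prob_space \<pi> by (rule planD(1)[OF P(1)])
    interpret \<pi>': prob_space \<pi>' by (rule planD(1)[OF P(2)])
    fix A assume "A \<in> sets \<pi>"
    then have A: "A \<in> sets borel"
      using planD(2)[OF P(1)] by simp
    have "AE \<omega> in \<pi>. zc \<omega> = (if zc \<omega> \<le> zmu then l (Fp (xy \<omega>)) else u (Fp (xy \<omega>)))"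
      "AE \<omega> in \<pi>'. zc \<omega> = (if zc \<omega> \<le> zmu then l (Fp (xy \<omega>)) else u (Fp (xy \<omega>)))"
      by (intro AE_endpoint P D(2) nest; assumption)+
    then have "measure \<pi> A = measure \<pi>' A"
      using plan_determined[OF P(1) D(2) A] plan_determined[OF P(2) D(2) A] XY by simp
    then show "emeasure \<pi> A = emeasure \<pi>' A"
      by (simp add: \<pi>.emeasure_eq_measure \<pi>'.emeasure_eq_measure)
  qed
qed

section \<open>Existence of a coupling\<close>

lemma integral_\<mu>Y:
  fixes \<phi> :: "real \<Rightarrow> real"
  assumes [measurable]: "\<phi> \<in> borel_measurable borel"
  shows "(\<integral>v. \<phi> v \<partial>\<mu>Y) = (\<Sum>i\<le>2. \<phi> (y i) * measure \<mu>Y {y i})"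
proof -
  interpret prob_space \<mu>Y by (rule prob_marginals)
  have "(\<integral>v. \<phi> v \<partial>\<mu>Y) = (\<integral>v. \<phi> (y 0) * indicator {y 0} v + \<phi> (y 1) * indicator {y 1} v + \<phi> (y 2) * indicator {y 2} v \<partial>\<mu>Y)"
    using AE_marginals(2)
    by (intro integral_cong_AE) (use bounds in \<open>auto elim!: eventually_mono simp: indicator_def\<close>)
  then show ?thesis
    by (simp add: sum_atMost_2 emeasure_eq_measure)
qed

text \<open>A martingale coupling is given by the density \<open>p 1\<close> of the mass sent to \<open>y 1\<close>, which ranges between
  \<open>0\<close> and the tent function \<open>T\<close>. The convex order provides \<open>\<integral> T d\<mu>X \<ge> a 1\<close>, so that a multiple of
  \<open>T\<close> has the right mass.\<close>

lemma RR_nonempty: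
  assumes order: "\<mu>X \<preceq>\<^sub>c \<mu>Y"
  shows "RR \<noteq> {}"
proof -
  interpret \<mu>X: prob_space \<mu>X by (rule prob_marginals)
  interpret \<mu>Y: prob_space \<mu>Y by (rule prob_marginals)
  define a where "a i = measure \<mu>Y {y i}" for i
  have convex_le: "(\<integral>t. \<phi> t \<partial>\<mu>X) \<le> (\<integral>t. \<phi> t \<partial>\<mu>Y)" if "convex_on UNIV \<phi>" for \<phi>
    using order that by (simp add: convex_order_def)
  have bX: "AE t in \<mu>X. \<bar>t\<bar> \<le> bnd"
    using AE_marginals(1) by eventually_elim (rule bnd)
  have idX: "integrable \<mu>X (\<lambda>t. t)"
    using bX by (intro \<mu>X.integrable_const_bound[where B=bnd]) auto
  \<comment> \<open>The positive part of an affine function is convex. If it vanishes at the support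
    points of \<open>\<mu>Y\<close>, the convex order forces it to vanish almost everywhere for
    \<open>\<mu>X\<close>.\<close>
  have support: "AE t in \<mu>X. \<phi> t \<le> 0"
    if \<phi>: "\<phi> = (\<lambda>t. b * t + c)" and le: "\<And>i. i \<le> 2 \<Longrightarrow> \<phi> (y i) \<le> 0" for \<phi> :: "real \<Rightarrow> real" and b c
  proof -
    have "convex_on UNIV (\<lambda>t. max (\<phi> t) (0 * t + 0))"
      unfolding \<phi> by (intro convex_on_max convex_on_affine)
    then have "(\<integral>t. max (\<phi> t) 0 \<partial>\<mu>X) \<le> (\<integral>t. max (\<phi> t) 0 \<partial>\<mu>Y)"
      using convex_le by simp
    also have "\<dots> = 0"
    proof -
      have "(\<lambda>t. max (\<phi> t) 0) \<in> borel_measurable borel"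
        unfolding \<phi> by measurable
      then show ?thesis
        using le by (subst integral_\<mu>Y) (auto simp: max_absorb2)
    qed
    finally have "(\<integral>t. max (\<phi> t) 0 \<partial>\<mu>X) \<le> 0" .
    moreover have "0 \<le> (\<integral>t. max (\<phi> t) 0 \<partial>\<mu>X)"
      by (intro integral_nonneg_AE) auto
    moreover have "integrable \<mu>X (\<lambda>t. max (\<phi> t) 0)"
      unfolding \<phi> using idX by (intro integrable_max Bochner_Integration.integrable_add integrable_mult_right) auto
    ultimately have "AE t in \<mu>X. max (\<phi> t) 0 = 0"
      by (subst integral_nonneg_eq_0_iff_AE[symmetric]) auto
    then show ?thesis
      by eventually_elim (auto simp: max_def split: if_splits)
  qed
  have i3: "i = 0 \<or> i = 1 \<or> i = 2" if "i \<le> 2" for i :: nat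
    using that by auto
  have "AE t in \<mu>X. - 1 * t + y 0 \<le> 0" "AE t in \<mu>X. 1 * t + (- y 2) \<le> 0"
    using i3 bounds by (intro support[OF refl]; force)+
  then have supp: "AE t in \<mu>X. y 0 \<le> t \<and> t \<le> y 2"
    by eventually_elim auto
  \<comment> \<open>The largest mass that a probability vector on the three points with mean
    \<open>t\<close> can put on \<open>y 1\<close>: the two quotients express nonnegativity of the
    outer masses.\<close>
  define T where "T t = min ((t - y 0) / (y 1 - y 0)) ((y 2 - t) / (y 2 - y 1))" for t
  have T_meas [measurable]: "T \<in> borel_measurable borel"
    unfolding T_def[abs_def] by measurable
  have T_int: "integrable \<mu>X T"
    unfolding T_def[abs_def] using idX by (intro integrable_min integrable_divide Bochner_Integration.integrable_diff) auto
  have T_nonneg: "AE t in \<mu>X. 0 \<le> T t"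
    using supp by eventually_elim (use bounds in \<open>auto simp: T_def\<close>)
  have T_y: "T (y 0) = 0" "T (y 1) = 1" "T (y 2) = 0"
    using bounds by (auto simp: T_def min_def divide_simps)
  have mass_T: "a 1 \<le> (\<integral>t. T t \<partial>\<mu>X)"
  proof -
    have eq: "- T t = max ((- 1 / (y 1 - y 0)) * t + y 0 / (y 1 - y 0)) ((1 / (y 2 - y 1)) * t + (- y 2 / (y 2 - y 1)))" for t
    proof -
      have "- ((t - y 0) / (y 1 - y 0)) = (- 1 / (y 1 - y 0)) * t + y 0 / (y 1 - y 0)"
        "- ((y 2 - t) / (y 2 - y 1)) = (1 / (y 2 - y 1)) * t + (- y 2 / (y 2 - y 1))"
        by (simp_all add: diff_divide_distrib)
      then show ?thesis
        unfolding T_def minus_min_eq_max by simp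
    qed
    have "convex_on UNIV (\<lambda>t. - T t)"
      unfolding eq by (intro convex_on_max convex_on_affine)
    then have "(\<integral>t. - T t \<partial>\<mu>X) \<le> (\<integral>t. - T t \<partial>\<mu>Y)"
      by (rule convex_le)
    moreover have "(\<integral>t. T t \<partial>\<mu>Y) = a 1"
      by (subst integral_\<mu>Y) (simp_all add: sum_atMost_2 T_y[simplified] a_def)
    ultimately show ?thesis
      by simp
  qed
  \<comment> \<open>If the integral of \<open>T\<close> is zero, then so is \<open>a 1\<close>, and
    division by zero gives the value 0, which is the right one.\<close>
  define c where "c = a 1 / (\<integral>t. T t \<partial>\<mu>X)"
  have a1: "0 \<le> a 1"
    by (simp add: a_def)
  have c: "0 \<le> c" "c \<le> 1" "c * (\<integral>t. T t \<partial>\<mu>X) = a 1"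
    using mass_T a1 by (auto simp: c_def divide_le_eq)
  \<comment> \<open>The outer densities are obtained from the middle one by solving the conditions
    of total mass 1 and mean \<open>t\<close>.\<close>
  define p where "p i t = (if i = 0 then (y 2 - t - (y 2 - y 1) * (c * T t)) / (y 2 - y 0)
    else if i = 1 then c * T t else (t - y 0 - (y 1 - y 0) * (c * T t)) / (y 2 - y 0))" for i :: nat and t
  have p_int: "integrable \<mu>X (p i)" for i
    unfolding p_def[abs_def] using idX T_int by (cases "i = 0"; cases "i = 1") auto
  have p_nonneg: "AE t in \<mu>X. \<forall>i. 0 \<le> p i t"
    using supp T_nonneg
  proof eventually_elim
    case (elim t)
    have cT: "c * T t \<le> T t" "0 \<le> c * T t"
      using mult_right_mono[OF c(2) elim(2)] c(1) elim(2) by simp_all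
    have "(y 2 - y 1) * (c * T t) \<le> (y 2 - y 1) * ((y 2 - t) / (y 2 - y 1))"
      "(y 1 - y 0) * (c * T t) \<le> (y 1 - y 0) * ((t - y 0) / (y 1 - y 0))"
      using cT(1) bounds by (intro mult_left_mono; simp add: T_def)+
    then have "(y 2 - y 1) * (c * T t) \<le> y 2 - t" "(y 1 - y 0) * (c * T t) \<le> t - y 0"
      using bounds by auto
    then show ?case
      using cT(2) bounds by (auto simp: p_def)
  qed
  have y20: "y 2 - y 0 \<noteq> 0"
    using bounds by auto
  have p_sum: "p 0 t + p 1 t + p 2 t = 1" "y 0 * p 0 t + y 1 * p 1 t + y 2 * p 2 t = t" for t
  proof -
    have "p 0 t * (y 2 - y 0) = y 2 - t - (y 2 - y 1) * p 1 t" "p 2 t * (y 2 - y 0) = t - y 0 - (y 1 - y 0) * p 1 t"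
      using y20 by (simp_all add: p_def)
    then have "(p 0 t + p 1 t + p 2 t) * (y 2 - y 0) = 1 * (y 2 - y 0)"
      "(y 0 * p 0 t + y 1 * p 1 t + y 2 * p 2 t) * (y 2 - y 0) = t * (y 2 - y 0)"
      by algebra+
    then show "p 0 t + p 1 t + p 2 t = 1" "y 0 * p 0 t + y 1 * p 1 t + y 2 * p 2 t = t"
      using y20 unfolding mult_cancel_right by auto
  qed
  have a_sum: "a 0 + a 1 + a 2 = 1" "y 0 * a 0 + y 1 * a 1 + y 2 * a 2 = (\<integral>t. t \<partial>\<mu>X)"
    using integral_\<mu>Y[of "\<lambda>_. 1"] integral_\<mu>Y[of "\<lambda>t. t"] means(1) \<mu>Y.prob_space
    by (simp_all add: sum_atMost_2 a_def)
  have p_total: "(\<integral>t. p i t \<partial>\<mu>X) = a i" if "i \<le> 2" for i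
  proof -
    have p1: "(\<integral>t. p 1 t \<partial>\<mu>X) = a 1"
      using c(3) by (simp add: p_def)
    have s: "(\<integral>t. p 0 t \<partial>\<mu>X) + (\<integral>t. p 1 t \<partial>\<mu>X) + (\<integral>t. p 2 t \<partial>\<mu>X) = 1"
      "y 0 * (\<integral>t. p 0 t \<partial>\<mu>X) + y 1 * (\<integral>t. p 1 t \<partial>\<mu>X) + y 2 * (\<integral>t. p 2 t \<partial>\<mu>X) = (\<integral>t. t \<partial>\<mu>X)"
    proof -
      have "(\<integral>t. p 0 t + p 1 t + p 2 t \<partial>\<mu>X) = 1"
        unfolding p_sum by (simp add: \<mu>X.prob_space[simplified])
      then show "(\<integral>t. p 0 t \<partial>\<mu>X) + (\<integral>t. p 1 t \<partial>\<mu>X) + (\<integral>t. p 2 t \<partial>\<mu>X) = 1"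
        using p_int by simp
      have "(\<integral>t. y 0 * p 0 t + y 1 * p 1 t + y 2 * p 2 t \<partial>\<mu>X) = (\<integral>t. t \<partial>\<mu>X)"
        unfolding p_sum ..
      then show "y 0 * (\<integral>t. p 0 t \<partial>\<mu>X) + y 1 * (\<integral>t. p 1 t \<partial>\<mu>X) + y 2 * (\<integral>t. p 2 t \<partial>\<mu>X) = (\<integral>t. t \<partial>\<mu>X)"
        using p_int by simp
    qed
    \<comment> \<open>Only the middle density was normalised. Total mass and mean agree as well, so
      the deviations lie in the kernel of the constraints with middle component zero.\<close>
    have d: "((\<integral>t. p 0 t \<partial>\<mu>X) - a 0) + ((\<integral>t. p 1 t \<partial>\<mu>X) - a 1) + ((\<integral>t. p 2 t \<partial>\<mu>X) - a 2) = 0"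
      "y 0 * ((\<integral>t. p 0 t \<partial>\<mu>X) - a 0) + y 1 * ((\<integral>t. p 1 t \<partial>\<mu>X) - a 1) + y 2 * ((\<integral>t. p 2 t \<partial>\<mu>X) - a 2) = 0"
      using s a_sum by (simp_all add: right_diff_distrib)
    have "(\<integral>t. p 0 t \<partial>\<mu>X) = a 0" "(\<integral>t. p 2 t \<partial>\<mu>X) = a 2"
      using kernel_of_constraints[OF d] p1 y20 by auto
    then show ?thesis
      using p1 i3[OF that] by auto
  qed
  define R where "R i x = (\<integral>t. indicator {..x} t * p i t \<partial>\<mu>X)" for i x
  have pi_int: "integrable \<mu>X (\<lambda>t. indicator {..x} t * p i t)" for i x
    using integrable_mult_indicator[OF _ p_int[of i], of "{..x}"] by simp
  have "R \<in> RR"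
    unfolding RR_def
  proof (intro CollectI conjI allI impI)
    fix i :: nat and x assume i: "i \<le> 2"
    show "mono (R i)"
      unfolding R_def using p_nonneg
      by (intro monoI integral_mono_AE pi_int) (auto elim!: eventually_mono simp: indicator_def)
    show "R i x = 0" if "x \<le> xl"
      unfolding R_def
    proof (rule integral_eq_zero_AE)
      show "AE t in \<mu>X. indicator {..x} t * p i t = 0"
        using AE_marginals(1) AE_marginals(4)[of xl] by eventually_elim (use that in \<open>auto simp: indicator_def\<close>)
    qed
    show "R i x = measure \<mu>Y {y i}" if "xu \<le> x"
    proof -
      have "R i x = (\<integral>t. p i t \<partial>\<mu>X)"
        unfolding R_def
      proof (rule integral_cong_AE)
        show "AE t in \<mu>X. indicator {..x} t * p i t = p i t"
          using AE_marginals(1) by eventually_elim (use that in \<open>auto simp: indicator_def\<close>)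
      qed (use pi_int p_int in \<open>auto intro: borel_measurable_integrable\<close>)
      then show ?thesis
        using p_total[OF i] by (simp add: a_def)
    qed
  next
    fix x
    have "(\<Sum>i\<le>2. R i x) = (\<integral>t. indicator {..x} t * p 0 t + indicator {..x} t * p 1 t + indicator {..x} t * p 2 t \<partial>\<mu>X)"
      using pi_int by (simp add: R_def sum_atMost_2)
    also have "\<dots> = (\<integral>t. indicator {..x} t * (p 0 t + p 1 t + p 2 t) \<partial>\<mu>X)"
      by (simp add: distrib_left)
    finally show "(\<Sum>i\<le>2. R i x) = measure \<mu>X {..x}"
      unfolding p_sum by simp
    have "(\<Sum>i\<le>2. y i * R i x) = (\<integral>t. y 0 * (indicator {..x} t * p 0 t) + y 1 * (indicator {..x} t * p 1 t) + y 2 * (indicator {..x} t * p 2 t) \<partial>\<mu>X)"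
      using pi_int by (simp add: R_def sum_atMost_2)
    also have "\<dots> = (\<integral>t. indicator {..x} t * (y 0 * p 0 t + y 1 * p 1 t + y 2 * p 2 t) \<partial>\<mu>X)"
      by (intro Bochner_Integration.integral_cong) (auto simp: algebra_simps)
    finally show "(\<Sum>i\<le>2. y i * R i x) = (\<integral>t. indicator {..x} t * t \<partial>\<mu>X)"
      unfolding p_sum .
  qed
  then show ?thesis
    by auto
qed

lemma unique_total_cost_minimizer:
  assumes "\<mu>X \<preceq>\<^sub>c \<mu>Y"
  shows "\<exists>!\<pi>. plan \<pi> \<and> (\<forall>\<sigma>. plan \<sigma> \<longrightarrow> total_cost \<pi> \<le> total_cost \<sigma>)"
proof -
  obtain \<pi> where "plan \<pi>" "\<And>\<sigma>. plan \<sigma> \<Longrightarrow> total_cost \<pi> \<le> total_cost \<sigma>"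
    using exists_minimizer[OF RR_nonempty[OF assms]] by blast
  then show ?thesis
    using minimizer_unique by blast
qed

end

section \<open>Reduction to a bounded continuous cost factor on the plane\<close>

theorem theorem4p5:
  fixes \<mu>X \<mu>Y \<mu>Z :: "real measure"
    and X Y Z :: "real set"
    and xl xu zml zmu zpl zpu :: real
    and a y :: "nat \<Rightarrow> real"
    and f fx fy :: "real \<Rightarrow> real \<Rightarrow> real"
  assumes "compact X" and "compact Y" and "compact Z"
    and "prob_measure_on X \<mu>X" and "prob_measure_on Y \<mu>Y" and "prob_measure_on Z \<mu>Z"
    and "\<mu>X \<preceq>\<^sub>c \<mu>Y" and "\<mu>Y \<preceq>\<^sub>c \<mu>Z"
    and A1: "xl \<le> xu" "X = {xl..xu}" "absolutely_continuous lborel \<mu>X"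
    and A2: "\<forall>A\<in>sets borel. measure \<mu>Y A = (\<Sum>i=0..2. a i * measure (return borel (y i)) A)"
    and A3: "zml \<le> zmu" "zpl \<le> zpu" "Z = {zml..zmu} \<union> {zpl..zpu}"
      "zmu < y 0" "y 0 < y 1" "y 1 < y 2" "y 2 < zpl"
      "nonatomic \<mu>Z"
    and A4: "(\<lambda>(u, v). f u v) differentiable_on (X \<times> {y 0..y 2})"
      "\<forall>u\<in>X. \<forall>v\<in>{y 0..y 2}.
         ((\<lambda>s. f s v) has_real_derivative fx u v) (at u within X) \<and> fx u v < 0"
      "\<forall>u\<in>X. \<forall>v\<in>{y 0..y 2}.
         ((\<lambda>t. f u t) has_real_derivative fy u v) (at v within {y 0..y 2}) \<and> fy u v < 0"
  shows "\<exists>!\<pi>. mot_solution (X \<times> {y 0..y 2} \<times> Z) (\<lambda>x y z. f x y * z\<^sup>2) \<mu>X \<mu>Y \<mu>Z \<pi>"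
proof -
  have pX: "prob_space \<mu>X" "sets \<mu>X = sets borel" "AE x in \<mu>X. x \<in> X"
    and pY: "prob_space \<mu>Y" "sets \<mu>Y = sets borel"
    using assms(4,5) by (auto simp: prob_measure_on_def)
  have atom: "measure \<mu>X {x} = 0" for x
  proof -
    have "{x} \<in> null_sets lborel"
      by auto
    then have "{x} \<in> null_sets \<mu>X"
      using A1(3) by (auto simp: absolutely_continuous_def)
    then show ?thesis
      by (rule measure_eq_0_null_sets)
  qed
  have nonatomic_X: "nonatomic \<mu>X"
    using atom by (simp add: nonatomic_def)
  \<comment> \<open>A degenerate interval would make \<open>\<mu>X\<close> a point mass, against
    absolute continuity.\<close>
  have lt: "xl < xu"
  proof (rule ccontr)
    assume "\<not> xl < xu"
    then have "AE x in \<mu>X. x \<in> {xl}"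
      using pX(3) A1(1,2) by auto
    then have "measure \<mu>X {xl} = 1"
      using prob_space.prob_eq_1[OF pX(1), of "{xl}"] pX(2) by simp
    then show False
      using atom by simp
  qed
  have Y3: "prob_measure_on {y 0, y 1, y 2} \<mu>Y"
  proof -
    have r: "measure (return borel (y i)) A = (1::real)" if "A \<in> sets borel" "y i \<in> A" for i A
      using that by (simp add: measure_return)
    have "space \<mu>Y = UNIV"
      using sets_eq_imp_space_eq[OF pY(2)] by simp
    then have "measure \<mu>Y UNIV = 1"
      using prob_space.prob_space[OF pY(1)] by simp
    then have "(\<Sum>i=0..2. a i) = 1"
      using A2[rule_format, of UNIV] by (simp add: r)
    moreover have "measure \<mu>Y {y 0, y 1, y 2} = (\<Sum>i=0..2. a i)"
    proof -
      have "y i \<in> {y 0, y 1, y 2}" if "i \<in> {0..2}" for i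
      proof -
        have "i = 0 \<or> i = 1 \<or> i = 2"
          using that by auto
        then show ?thesis by auto
      qed
      then show ?thesis
        by (subst A2[rule_format]) (auto simp: r intro!: sum.cong)
    qed
    ultimately have "AE v in \<mu>Y. v \<in> {y 0, y 1, y 2}"
      using prob_space.prob_eq_1[OF pY(1), of "{y 0, y 1, y 2}"] pY(2) by simp
    then show ?thesis
      using pY by (simp add: prob_measure_on_def)
  qed
  \<comment> \<open>The identity and its negative are both convex.\<close>
  have mean: "(\<integral>x. x \<partial>\<mu>) = (\<integral>x. x \<partial>\<nu>)" if "\<mu> \<preceq>\<^sub>c \<nu>" for \<mu> \<nu> :: "real measure"
  proof (rule antisym)
    show "(\<integral>x. x \<partial>\<mu>) \<le> (\<integral>x. x \<partial>\<nu>)"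
      using that convex_on_affine[of 1 0] by (auto simp: convex_order_def)
    have "(\<integral>x. - x \<partial>\<mu>) \<le> (\<integral>x. - x \<partial>\<nu>)"
      using that convex_on_affine[of "- 1" 0] by (auto simp: convex_order_def)
    then show "(\<integral>x. x \<partial>\<nu>) \<le> (\<integral>x. x \<partial>\<mu>)"
      by simp
  qed
  have f_cont: "continuous_on (X \<times> {y 0..y 2}) (\<lambda>(u, v). f u v)"
    using A4(1) by (rule differentiable_imp_continuous_on)
  \<comment> \<open>Projections onto the two intervals; composing \<open>f\<close> with them extends
    it continuously to the plane with the same range.\<close>
  define cx cy where "cx t = max xl (min xu t)" and "cy t = max (y 0) (min (y 2) t)" for t
  have cx: "cx t \<in> X" "t \<in> X \<Longrightarrow> cx t = t" and cy: "cy t \<in> {y 0..y 2}" "t \<in> {y 0..y 2} \<Longrightarrow> cy t = t" for t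
    using A1 A3 by (auto simp: cx_def cy_def)
  define F where "F u v = f (cx u) (cy v)" for u v
  have F_eq: "F u v = f u v" if "u \<in> X" "v \<in> {y 0..y 2}" for u v
    using that cx cy by (simp add: F_def)
  have F_cont: "continuous_on UNIV (\<lambda>(u, v). F u v)"
  proof -
    have "continuous_on UNIV (\<lambda>p :: real \<times> real. (cx (fst p), cy (snd p)))"
      unfolding cx_def cy_def by (intro continuous_intros)
    then have "continuous_on UNIV (\<lambda>p. (\<lambda>(u, v). f u v) (cx (fst p), cy (snd p)))"
      by (rule continuous_on_compose2[OF f_cont]) (use cx cy in auto)
    then show ?thesis
      by (simp add: F_def case_prod_beta)
  qed
  have "compact ((\<lambda>(u, v). f u v) ` (X \<times> {y 0..y 2}))"
    using f_cont assms(1) by (intro compact_continuous_image compact_Times) auto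
  then have "bounded ((\<lambda>(u, v). f u v) ` (X \<times> {y 0..y 2}))"
    by (rule compact_imp_bounded)
  then obtain B where "\<forall>w\<in>(\<lambda>(u, v). f u v) ` (X \<times> {y 0..y 2}). \<bar>w\<bar> \<le> B"
    unfolding bounded_real ..
  then have B: "\<bar>f u v\<bar> \<le> B" if "u \<in> X" "v \<in> {y 0..y 2}" for u v
    using that by force
  \<comment> \<open>The margin 1 makes the bounds strict, as required for \<open>\<gamma>0\<close>
    and \<open>\<gamma>1\<close>.\<close>
  have F_bounds: "- B - 1 < F u v \<and> F u v < B + 1" for u v
  proof -
    have "\<bar>F u v\<bar> \<le> B"
      unfolding F_def by (intro B cx cy)
    then show ?thesis by auto
  qed
  interpret mot_data \<mu>X \<mu>Y \<mu>Z xl xu zml zmu zpl zpu "- B - 1" "B + 1" y F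
  proof
    show "F x' (y i) < F x (y i)" if "i \<le> 2" "xl \<le> x" "x < x'" "x' \<le> xu" for i x x'
    proof -
      have "i = 0 \<or> i = 1 \<or> i = 2"
        using that by auto
      then have yi: "y i \<in> {y 0..y 2}"
        using A3 by auto
      have "f x' (y i) < f x (y i)"
        using A4(2) yi that unfolding A1(2)
        by (intro strict_decreasing_of_derivative[of xl xu "\<lambda>s. f s (y i)" "\<lambda>u. fx u (y i)"]) auto
      then show ?thesis
        using that yi by (simp add: F_eq A1(2))
    qed
    show "F x (y 1) < F x (y 0)" if "xl \<le> x" "x \<le> xu" for x
    proof -
      have "f x (y 1) < f x (y 0)"
        using A3 A4(3) that unfolding A1(2)
        by (intro strict_decreasing_of_derivative[of "y 0" "y 2" "f x" "fy x"]) auto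
      then show ?thesis
        using that A3 by (simp add: F_eq A1(2))
    qed
  qed (use assms(4,6,7,8) A1 A3 lt nonatomic_X Y3 mean F_cont F_bounds in auto)
  let ?D = "X \<times> {y 0..y 2} \<times> Z"
  \<comment> \<open>Plans are concentrated on the domain, where \<open>F\<close> agrees with
    \<open>f\<close>. The remaining constant is the same for all plans, so both minimisation
    problems have the same solutions.\<close>
  have cost: "transport_cost ?D (\<lambda>x y z. f x y * z\<^sup>2) \<pi> = (- B - 1) * (\<integral>z. z\<^sup>2 \<partial>\<mu>Z) + total_cost \<pi>" if P: "plan \<pi>" for \<pi>
  proof -
    have [measurable_cong]: "sets \<pi> = sets borel"
      using P by (rule planD)
    have D [measurable]: "?D \<in> sets borel"
      using assms(1,3) by (intro borel_closed closed_Times) (auto intro: compact_imp_closed)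
    have "transport_cost ?D (\<lambda>x y z. f x y * z\<^sup>2) \<pi> = (\<integral>\<omega>. indicator ?D \<omega> * (Fp (xy \<omega>) * (zc \<omega>)\<^sup>2) \<partial>\<pi>)"
      unfolding transport_cost_def set_lebesgue_integral_def
      by (intro Bochner_Integration.integral_cong) (auto simp: indicator_def Fp_def zc_def F_eq)
    also have "\<dots> = (\<integral>\<omega>. Fp (xy \<omega>) * (zc \<omega>)\<^sup>2 \<partial>\<pi>)"
    proof (rule integral_cong_AE)
      show "AE \<omega> in \<pi>. indicator ?D \<omega> * (Fp (xy \<omega>) * (zc \<omega>)\<^sup>2) = Fp (xy \<omega>) * (zc \<omega>)\<^sup>2"
        using plan_AE(1-3)[OF P]
      proof eventually_elim
        case (elim \<omega>)
        then have "\<omega> \<in> ?D"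
          using A1(2) A3 by (cases \<omega>) (auto simp: zc_def)
        then show ?case
          by simp
      qed
    qed measurable
    finally show ?thesis
      using cost_eq_total_cost[OF P] by simp
  qed
  have "mot_solution ?D (\<lambda>x y z. f x y * z\<^sup>2) \<mu>X \<mu>Y \<mu>Z \<pi> \<longleftrightarrow>
    plan \<pi> \<and> (\<forall>\<sigma>. plan \<sigma> \<longrightarrow> total_cost \<pi> \<le> total_cost \<sigma>)" for \<pi>
    unfolding mot_solution_def mem_martingale_plans Ball_def using cost by auto
  then show ?thesis
    using unique_total_cost_minimizer[OF assms(7)] by simp
qed

end
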